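(* Let $k$ be an algebraically closed field and $n\geq 3$ an integer. The unique irredundant decomposition of $\mathcal{C}_n^2(k)$ into irreducible varieties is \[\mathcal{C}_n^2(k)=\overline{\mathcal{Z}_1}\cup\cdots\cup \overline{\mathcal{Z}_{\lfloor n/2\rfloor}},\] where for $1\le i\le \lfloor n/2\rfloor$ \[\mathcal{Z}_i=\{(A,B)\in \mathrm{Mat}_{n\times n}(k)^2\mid \exists P\in\mathrm{Mat}_{n\times n}(k)\text{ with } P^2=P,\ \mathrm{rank}(P)=i,\ AP=PA,\ BP=PB\}\] and $\overline{\mathcal{Z}_i}$ is the Zariski closure of $\mathcal{Z}_i$. That is, equality holds, each $\overline{\mathcal{Z}_i}$ is irreducible, and $\overline{\mathcal{Z}_i}\not\subset\overline{\mathcal{Z}_j}$ for $i\neq j$.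
   Context: $\mathrm{Mat}_{n\times n}(k)^2$ is identified with the affine space $k^{2n^2}$ with its Zariski topology. A matrix is scalar if it is a constant multiple of the identity. The commuting graph $\Gamma(\mathrm{Mat}_{n\times n}(k))$ has as vertices the non-scalar $n\times n$ matrices over $k$, with an edge between distinct $A$ and $B$ if and only if $AB=BA$. For non-scalar $A,B$, the commuting distance $d_k(A,B)$ is the graph distance between $A$ and $B$ (equal to $\infty$ if they lie in different connected components). It is extended to all matrices by $d_k(A,A)=0$ and $d_k(A,B)=d_k(B,A)=1$ whenever $A$ is scalar and $A\neq B$. Then $\mathcal{C}^{2}_n(k)=\{(A,B)\in\mathrm{Mat}_{n\times n}(k)^2\mid d_k(A,B)\leq 2\}$. Varieties are Zariski-closed subsets of affine space, not necessarily irreducible; a variety is irreducible if it is not a union of two proper subvarieties. *)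

theory Defs
  imports
    "HOL-Computational_Algebra.Polynomial"
    "HOL-Library.Poly_Mapping"
    "HOL-Library.Extended_Nat"
    "Jordan_Normal_Form.DL_Rank"
begin

section \<open>Varieties in the space of pairs of matrices\<close>

type_synonym 'k mat_pair = "'k mat \<times> 'k mat"

definition mat_pairs :: "nat \<Rightarrow> 'k mat_pair set" where
  "mat_pairs n = carrier_mat n n \<times> carrier_mat n n"

text \<open>
  The \<open>2n\<^sup>2\<close> coordinates of \<open>(A, B)\<close>: \<open>Inl (i, j)\<close> stands for the entry \<open>A $$ (i, j)\<close>
  and \<open>Inr (i, j)\<close> for the entry \<open>B $$ (i, j)\<close>.
\<close>

type_synonym coord = "nat \<times> nat + nat \<times> nat"

definition coords :: "nat \<Rightarrow> coord set" where
  "coords n = ({..<n} \<times> {..<n}) <+> ({..<n} \<times> {..<n})"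

fun coord_val :: "'k mat_pair \<Rightarrow> coord \<Rightarrow> 'k" where
  "coord_val (A, B) (Inl ij) = A $$ ij"
| "coord_val (A, B) (Inr ij) = B $$ ij"

text \<open>
  A multivariate polynomial is a finitely supported map from monomials to coefficients, where a
  monomial is a finitely supported map from variables to exponents.
\<close>

type_synonym ('v, 'k) mpoly = "('v \<Rightarrow>\<^sub>0 nat) \<Rightarrow>\<^sub>0 'k"

definition mpoly_vars :: "('v, 'k::zero) mpoly \<Rightarrow> 'v set" where
  "mpoly_vars p = (\<Union>m\<in>Poly_Mapping.keys p. Poly_Mapping.keys m)"

definition mpoly_eval :: "('v, 'k::comm_semiring_1) mpoly \<Rightarrow> ('v \<Rightarrow> 'k) \<Rightarrow> 'k" where
  "mpoly_eval p x = (\<Sum>m\<in>Poly_Mapping.keys p. Poly_Mapping.lookup p m * (\<Prod>v\<in>Poly_Mapping.keys m. x v ^ Poly_Mapping.lookup m v))"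

definition zero_locus :: "nat \<Rightarrow> (coord, 'k::field) mpoly set \<Rightarrow> 'k mat_pair set" where
  "zero_locus n S = {X \<in> mat_pairs n. \<forall>p\<in>S. mpoly_eval p (coord_val X) = 0}"

definition variety :: "nat \<Rightarrow> 'k::field mat_pair set \<Rightarrow> bool" where
  "variety n V \<longleftrightarrow> (\<exists>S. (\<forall>p\<in>S. mpoly_vars p \<subseteq> coords n) \<and> V = zero_locus n S)"

definition zariski_closure :: "nat \<Rightarrow> 'k::field mat_pair set \<Rightarrow> 'k mat_pair set" where
  "zariski_closure n X = \<Inter>{V. variety n V \<and> X \<subseteq> V}"

definition irreducible_variety :: "nat \<Rightarrow> 'k::field mat_pair set \<Rightarrow> bool" where
  "irreducible_variety n V \<longleftrightarrow>
     variety n V \<and> (\<nexists>V1 V2. variety n V1 \<and> variety n V2 \<and> V1 \<subset> V \<and> V2 \<subset> V \<and> V = V1 \<union> V2)"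

definition irredundant_decomposition :: "nat \<Rightarrow> 'k::field mat_pair set \<Rightarrow> 'k mat_pair set set \<Rightarrow> bool"
  where
  "irredundant_decomposition n X F \<longleftrightarrow>
     finite F \<and> (\<forall>V\<in>F. irreducible_variety n V) \<and> X = \<Union>F \<and>
     (\<forall>V\<in>F. \<forall>W\<in>F. V \<noteq> W \<longrightarrow> \<not> V \<subseteq> W)"

section \<open>Commuting distance\<close>

definition scalar_matrix :: "nat \<Rightarrow> 'k::field mat \<Rightarrow> bool" where
  "scalar_matrix n A \<longleftrightarrow> (\<exists>c. A = c \<cdot>\<^sub>m 1\<^sub>m n)"

definition commuting_graph_vertices :: "nat \<Rightarrow> 'k::field mat set" where
  "commuting_graph_vertices n = {A \<in> carrier_mat n n. \<not> scalar_matrix n A}"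

definition commuting_graph_edges :: "nat \<Rightarrow> 'k::field mat rel" where
  "commuting_graph_edges n =
     {(A, B). A \<in> commuting_graph_vertices n \<and> B \<in> commuting_graph_vertices n \<and>
              A \<noteq> B \<and> A * B = B * A}"

text \<open>
  The least length of a walk from \<open>A\<close> to \<open>B\<close>; the infimum of the empty set in \<^typ>\<open>enat\<close>
  is \<open>\<infinity>\<close>.
\<close>

definition commuting_graph_dist :: "nat \<Rightarrow> 'k::field mat \<Rightarrow> 'k mat \<Rightarrow> enat" where
  "commuting_graph_dist n A B = (INF m \<in> {m. (A, B) \<in> commuting_graph_edges n ^^ m}. enat m)"

definition commuting_dist :: "nat \<Rightarrow> 'k::field mat \<Rightarrow> 'k mat \<Rightarrow> enat" where
  "commuting_dist n A B =
     (if A = B then 0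
      else if scalar_matrix n A \<or> scalar_matrix n B then 1
      else commuting_graph_dist n A B)"

definition commuting_C2 :: "nat \<Rightarrow> 'k::field mat_pair set" where
  "commuting_C2 n = {(A, B) \<in> mat_pairs n. commuting_dist n A B \<le> 2}"

definition commuting_Z :: "nat \<Rightarrow> nat \<Rightarrow> 'k::field mat_pair set" where
  "commuting_Z n i =
     {(A, B) \<in> mat_pairs n. \<exists>P \<in> carrier_mat n n.
        P * P = P \<and> vec_space.rank n P = i \<and> A * P = P * A \<and> B * P = P * B}"

end

theory Submission
  imports Defs "Jordan_Normal_Form.Char_Poly"
begin

text \<open>
  A pair \<open>(A, B)\<close> has distance at most two iff \<open>A\<close> and \<open>B\<close> commute with a common non-scalar \<open>C\<close>.
  This is a rank condition on a linear system in \<open>C\<close>, so it defines a variety.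
  The algebra generated by \<open>C\<close> contains a nontrivial idempotent, which puts \<open>(A, B)\<close> into some
  \<open>Z\<^sub>i\<close>, or a nonzero matrix \<open>E\<close> with \<open>E\<^sup>2 = 0\<close>. In the latter case a generalised inverse \<open>G\<close> of \<open>E\<close>
  gives idempotents \<open>G E + E / t\<close>, and \<open>A\<close> and \<open>B\<close> extend to matrices \<open>A + t D\<close>, \<open>B + t D'\<close>
  commuting with them; letting \<open>t\<close> tend to \<open>0\<close> puts \<open>(A, B)\<close> into the closure of some \<open>Z\<^sub>i\<close>.
  Since \<open>Z\<^sub>i = Z\<^sub>n\<^sub>-\<^sub>i\<close>, indices up to \<open>n div 2\<close> suffice.

  The closure of \<open>Z\<^sub>i\<close> is irreducible because \<open>Z\<^sub>i\<close> is the image of an open subset of an affine space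
  under \<open>(Q, M, N) \<mapsto> (Q M adj Q, Q N adj Q)\<close> with \<open>M\<close>, \<open>N\<close> block diagonal; it suffices to look at lines
  in this space.

  The components are separated by the alternating sum
  \<open>f\<^sub>m = \<Sum>\<^sub>\<sigma> sgn \<sigma> A\<^bsup>\<sigma> 0\<^esup> B A\<^bsup>\<sigma> 1\<^esup> B \<dots> B A\<^bsup>\<sigma> m\<^esup>\<close>, which is an identity of \<open>m \<times> m\<close> matrices
  by Cayley-Hamilton. On \<open>Z\<^sub>j\<close> one has \<open>f\<^sub>n\<^sub>-\<^sub>j = 0\<close> and \<open>det f\<^sub>j = 0\<close>, while for a diagonal matrix \<open>A\<close>
  with distinct entries and a permutation matrix \<open>B\<close> with cycles of length \<open>i\<close> and \<open>n - i\<close> the entries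
  of \<open>f\<^sub>m\<close> are Vandermonde determinants.
\<close>

section \<open>Polynomial functions\<close>

text \<open>No equations of the closures are used. Membership in a closure is shown by polynomial
  curves: over an infinite field a curve stays in the closure once all but finitely many of its
  points lie in the set. Non-membership is shown by one explicit polynomial function.

  The idempotents attached to a square-zero \<open>E\<close> have a pole at \<open>t = 0\<close>;
  only \<open>t\<close> times them has a limit, namely \<open>E\<close>. What must be extended
  polynomially in \<open>t\<close> is therefore \<open>A\<close> and \<open>B\<close>. Normalising
  \<open>G\<close> by \<open>G^2 = 0\<close> gives a block form in which the correction
  \<open>D\<close> can be read off.

  Ranks of idempotents are accessed through factorisations \<open>P = F H\<close> with
  \<open>H F = 1\<close>.

  The separation uses two tests because dim Z_i = n^2 + i^2 + (n - i)^2 decreases for i up to n/2: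
  dimension only explains why Z_i is not in the closure of Z_j for i < j, the case settled by
  f_{n-j}. The case j < i needs the finer condition det f_j = 0.\<close>

abbreviation lookup where "lookup \<equiv> Poly_Mapping.lookup"
abbreviation keys where "keys \<equiv> Poly_Mapping.keys"

section \<open>Evaluation of multivariate polynomials is a ring homomorphism\<close>

definition monom_val :: "('v \<Rightarrow> 'k::comm_semiring_1) \<Rightarrow> ('v \<Rightarrow>\<^sub>0 nat) \<Rightarrow> 'k" where
  "monom_val x m = (\<Prod>v\<in>keys m. x v ^ lookup m v)"

lemma monom_val_superset:
  "finite S \<Longrightarrow> keys m \<subseteq> S \<Longrightarrow> monom_val x m = (\<Prod>v\<in>S. x v ^ lookup m v)"
  unfolding monom_val_def by (rule prod.mono_neutral_left) (auto simp: in_keys_iff)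

lemma monom_val_add: "monom_val x (m + m') = monom_val x m * monom_val x m'"
proof -
  have k: "keys (m + m') \<subseteq> keys m \<union> keys m'" by (rule Poly_Mapping.keys_add)
  show ?thesis
    by (subst (1 2 3) monom_val_superset[of "keys m \<union> keys m'"])
      (use k in \<open>auto simp: lookup_add power_add prod.distrib\<close>)
qed

lemma mpoly_eval_superset:
  "finite S \<Longrightarrow> keys p \<subseteq> S \<Longrightarrow> mpoly_eval p x = (\<Sum>m\<in>S. lookup p m * monom_val x m)"
  unfolding mpoly_eval_def monom_val_def
  by (rule sum.mono_neutral_left) (auto simp: in_keys_iff)

lemma mpoly_eval_single: "mpoly_eval (Poly_Mapping.single m c) x = c * monom_val x m"
  by (subst mpoly_eval_superset[of "{m}"]) auto

lemma mpoly_eval_zero [simp]: "mpoly_eval 0 x = 0"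
  by (simp add: mpoly_eval_def)

lemma mpoly_eval_add: "mpoly_eval (p + q) x = mpoly_eval p x + mpoly_eval q x"
proof -
  have k: "keys (p + q) \<subseteq> keys p \<union> keys q" by (rule Poly_Mapping.keys_add)
  show ?thesis
    by (subst (1 2 3) mpoly_eval_superset[of "keys p \<union> keys q"])
      (use k in \<open>auto simp: lookup_add distrib_right sum.distrib\<close>)
qed

lemma mpoly_eval_sum: "mpoly_eval (\<Sum>i\<in>I. p i) x = (\<Sum>i\<in>I. mpoly_eval (p i) x)"
  by (induction I rule: infinite_finite_induct) (auto simp: mpoly_eval_add)

lemma poly_mapping_sum_singles:
  fixes p :: "'a \<Rightarrow>\<^sub>0 'b::comm_monoid_add"
  shows "p = (\<Sum>m\<in>keys p. Poly_Mapping.single m (lookup p m))"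
proof (rule poly_mapping_eqI)
  fix k
  have "(\<Sum>m\<in>keys p. lookup (Poly_Mapping.single m (lookup p m)) k)
      = (\<Sum>m\<in>keys p. if m = k then lookup p k else 0)"
    by (rule sum.cong) (auto simp: lookup_single when_def)
  also have "\<dots> = lookup p k"
    by (auto simp: in_keys_iff sum.delta')
  finally show "lookup p k = lookup (\<Sum>m\<in>keys p. Poly_Mapping.single m (lookup p m)) k"
    by (simp add: lookup_sum)
qed

lemma mpoly_eval_mult: "mpoly_eval (p * q) x = mpoly_eval p x * mpoly_eval q x"
proof -
  have "p * q = (\<Sum>m\<in>keys p. \<Sum>m'\<in>keys q.
      Poly_Mapping.single (m + m') (lookup p m * lookup q m'))"
    by (subst (1) poly_mapping_sum_singles[of p], subst (1) poly_mapping_sum_singles[of q])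
      (simp add: sum_product mult_single)
  then have "mpoly_eval (p * q) x = (\<Sum>m\<in>keys p. \<Sum>m'\<in>keys q.
      (lookup p m * monom_val x m) * (lookup q m' * monom_val x m'))"
    by (simp add: mpoly_eval_sum mpoly_eval_single monom_val_add ac_simps)
  also have "\<dots> = mpoly_eval p x * mpoly_eval q x"
    by (simp add: sum_product mpoly_eval_def monom_val_def)
  finally show ?thesis .
qed

lemma mpoly_vars_add: "mpoly_vars (p + q) \<subseteq> mpoly_vars p \<union> mpoly_vars q"
  using Poly_Mapping.keys_add[of p q] unfolding mpoly_vars_def by blast

lemma mpoly_vars_mult: "mpoly_vars (p * q) \<subseteq> mpoly_vars p \<union> mpoly_vars q"
proof
  fix v assume "v \<in> mpoly_vars (p * q)"
  then obtain m where "m \<in> keys (p * q)" and v: "v \<in> keys m"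
    unfolding mpoly_vars_def by blast
  then obtain a b where m: "m = a + b" "a \<in> keys p" "b \<in> keys q"
    using keys_mult[of p q] by blast
  then have "v \<in> keys a \<union> keys b"
    using v Poly_Mapping.keys_add[of a b] by blast
  with m show "v \<in> mpoly_vars p \<union> mpoly_vars q"
    unfolding mpoly_vars_def by blast
qed

text \<open>Abstracts two instances, polynomial functions on pairs of matrices and polynomial
  functions of one parameter, so that closure under matrix products, powers, determinants and
  adjugates is proved once. The axiom \<open>cong\<close> lets functions differ off
  \<open>D\<close>, where matrices may have wrong dimensions.\<close>

locale function_algebra =
  fixes D :: "'x set" and R :: "('x \<Rightarrow> 'k::comm_ring_1) set"
  assumes const: "(\<lambda>_. c) \<in> R"
    and add: "f \<in> R \<Longrightarrow> g \<in> R \<Longrightarrow> (\<lambda>x. f x + g x) \<in> R"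
    and mult: "f \<in> R \<Longrightarrow> g \<in> R \<Longrightarrow> (\<lambda>x. f x * g x) \<in> R"
    and cong: "f \<in> R \<Longrightarrow> (\<And>x. x \<in> D \<Longrightarrow> f x = g x) \<Longrightarrow> g \<in> R"
begin

lemma sum: "(\<And>i. i \<in> I \<Longrightarrow> f i \<in> R) \<Longrightarrow> (\<lambda>x. \<Sum>i\<in>I. f i x) \<in> R"
  by (induction I rule: infinite_finite_induct) (auto intro: const add)

lemma prod: "(\<And>i. i \<in> I \<Longrightarrow> f i \<in> R) \<Longrightarrow> (\<lambda>x. \<Prod>i\<in>I. f i x) \<in> R"
  by (induction I rule: infinite_finite_induct) (auto intro: const mult)

lemma power: "f \<in> R \<Longrightarrow> (\<lambda>x. f x ^ k) \<in> R"
  by (induction k) (auto intro: const mult)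

lemma uminus: "f \<in> R \<Longrightarrow> (\<lambda>x. - f x) \<in> R"
  using mult[OF const[of "-1"], of f] by simp

lemma diff: "f \<in> R \<Longrightarrow> g \<in> R \<Longrightarrow> (\<lambda>x. f x - g x) \<in> R"
  using add[OF _ uminus, of f g] by simp

definition mats :: "nat \<Rightarrow> nat \<Rightarrow> ('x \<Rightarrow> 'k mat) set" where
  "mats r c = {F. (\<forall>x\<in>D. F x \<in> carrier_mat r c) \<and> (\<forall>i<r. \<forall>j<c. (\<lambda>x. F x $$ (i, j)) \<in> R)}"

lemma matsI:
  "(\<And>x. x \<in> D \<Longrightarrow> F x \<in> carrier_mat r c) \<Longrightarrow>
   (\<And>i j. i < r \<Longrightarrow> j < c \<Longrightarrow> (\<lambda>x. F x $$ (i, j)) \<in> R) \<Longrightarrow> F \<in> mats r c"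
  unfolding mats_def by auto

lemma mats_carrier: "F \<in> mats r c \<Longrightarrow> x \<in> D \<Longrightarrow> F x \<in> carrier_mat r c"
  unfolding mats_def by auto

lemma mats_index: "F \<in> mats r c \<Longrightarrow> i < r \<Longrightarrow> j < c \<Longrightarrow> (\<lambda>x. F x $$ (i, j)) \<in> R"
  unfolding mats_def by auto

lemma mats_cong:
  assumes F: "F \<in> mats r c" and eq: "\<And>x. x \<in> D \<Longrightarrow> F x = G x"
  shows "G \<in> mats r c"
proof (rule matsI)
  fix i j assume "i < r" "j < c"
  from mats_index[OF F this] show "(\<lambda>x. G x $$ (i, j)) \<in> R"
    by (rule cong) (simp add: eq)
qed (use mats_carrier[OF F] eq in force)

lemma mats_const: "A \<in> carrier_mat r c \<Longrightarrow> (\<lambda>_. A) \<in> mats r c"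
  by (auto intro!: matsI const)

lemma mats_mat:
  "(\<And>i j. i < r \<Longrightarrow> j < c \<Longrightarrow> (\<lambda>x. f x i j) \<in> R) \<Longrightarrow>
    (\<lambda>x. mat r c (\<lambda>(i, j). f x i j)) \<in> mats r c"
  by (auto intro!: matsI)

lemma mats_add: "F \<in> mats r c \<Longrightarrow> G \<in> mats r c \<Longrightarrow> (\<lambda>x. F x + G x) \<in> mats r c"
proof (rule matsI)
  fix i j assume F: "F \<in> mats r c" and G: "G \<in> mats r c" and ij: "i < r" "j < c"
  show "(\<lambda>x. (F x + G x) $$ (i, j)) \<in> R"
    by (rule cong[OF add[OF mats_index[OF F ij] mats_index[OF G ij]]])
      (use mats_carrier[OF F] mats_carrier[OF G] ij in \<open>force\<close>)
qed (auto dest: mats_carrier)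

lemma mats_smult: "f \<in> R \<Longrightarrow> F \<in> mats r c \<Longrightarrow> (\<lambda>x. f x \<cdot>\<^sub>m F x) \<in> mats r c"
proof (rule matsI)
  fix i j assume f: "f \<in> R" and F: "F \<in> mats r c" and ij: "i < r" "j < c"
  show "(\<lambda>x. (f x \<cdot>\<^sub>m F x) $$ (i, j)) \<in> R"
    by (rule cong[OF mult[OF f mats_index[OF F ij]]])
      (use mats_carrier[OF F] ij in \<open>force\<close>)
qed (auto dest: mats_carrier)

lemma mats_diff: "F \<in> mats r c \<Longrightarrow> G \<in> mats r c \<Longrightarrow> (\<lambda>x. F x - G x) \<in> mats r c"
proof (rule matsI)
  fix i j assume F: "F \<in> mats r c" and G: "G \<in> mats r c" and ij: "i < r" "j < c"
  show "(\<lambda>x. (F x - G x) $$ (i, j)) \<in> R"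
    by (rule cong[OF diff[OF mats_index[OF F ij] mats_index[OF G ij]]])
      (use mats_carrier[OF F] mats_carrier[OF G] ij in \<open>force\<close>)
qed (use mats_carrier minus_carrier_mat in blast)

lemma mats_mult: "F \<in> mats r k \<Longrightarrow> G \<in> mats k c \<Longrightarrow> (\<lambda>x. F x * G x) \<in> mats r c"
proof (rule matsI)
  fix i j assume F: "F \<in> mats r k" and G: "G \<in> mats k c" and ij: "i < r" "j < c"
  have "(\<lambda>x. \<Sum>l\<in>{0..<k}. F x $$ (i, l) * G x $$ (l, j)) \<in> R"
    by (intro sum mult mats_index[OF F] mats_index[OF G] ij) auto
  then show "(\<lambda>x. (F x * G x) $$ (i, j)) \<in> R"
    by (rule cong)
      (use mats_carrier[OF F] mats_carrier[OF G] ij in \<open>force simp: scalar_prod_def\<close>)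
qed (use mats_carrier mult_carrier_mat in blast)

lemma mats_pow: "F \<in> mats r r \<Longrightarrow> (\<lambda>x. F x ^\<^sub>m k) \<in> mats r r"
proof (induction k)
  case 0
  have "(\<lambda>_. 1\<^sub>m r) \<in> mats r r" by (rule mats_const) simp
  then show ?case
    by (rule mats_cong) (use 0 mats_carrier in force)
qed (auto intro: mats_mult)

lemma det: "F \<in> mats r r \<Longrightarrow> (\<lambda>x. det (F x)) \<in> R"
proof -
  assume F: "F \<in> mats r r"
  have "(\<lambda>x. \<Sum>p\<in>{p. p permutes {0..<r}}. signof p * (\<Prod>i=0..<r. F x $$ (i, p i))) \<in> R"
  proof (intro sum mult const prod mats_index[OF F])
    fix p i assume "p \<in> {p. p permutes {0..<r}}" "i \<in> {0..<r}"
    then show "i < r" "p i < r" using permutes_in_image[of p "{0..<r}" i] by auto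
  qed
  then show ?thesis
    by (rule cong) (simp add: det_def'[OF mats_carrier[OF F]])
qed

lemma mats_adj: "F \<in> mats r r \<Longrightarrow> (\<lambda>x. adj_mat (F x)) \<in> mats r r"
proof (rule matsI)
  fix i j assume F: "F \<in> mats r r" and ij: "i < r" "j < r"
  \<comment> \<open>Row \<open>j\<close> and column \<open>i\<close> are deleted, since the adjugate
    is the transposed cofactor matrix.\<close>
  have "(\<lambda>x. mat (r - 1) (r - 1) (\<lambda>(i', j').
      F x $$ (if i' < j then i' else Suc i', if j' < i then j' else Suc j'))) \<in> mats (r - 1) (r - 1)"
    by (intro mats_mat mats_index[OF F]) auto
  from mult[OF const[of "(-1)^(j+i)"] det[OF this]]
  show "(\<lambda>x. adj_mat (F x) $$ (i, j)) \<in> R"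
  proof (rule cong)
    fix x assume "x \<in> D"
    from mats_carrier[OF F this]
    show "(-1)^(j+i) * det (mat (r - 1) (r - 1) (\<lambda>(i', j').
      F x $$ (if i' < j then i' else Suc i', if j' < i then j' else Suc j'))) = adj_mat (F x) $$ (i, j)"
      using ij unfolding adj_mat_def cofactor_def mat_delete_def by auto
  qed
qed (use mats_carrier adj_mat in blast)

end

text \<open>Working with functions instead of polynomials allows determinants and matrix products to
  serve as equations without naming the polynomials that represent them.\<close>

definition poly_funs :: "nat \<Rightarrow> ('k::field mat_pair \<Rightarrow> 'k) set" where
  "poly_funs n = {f. \<exists>p. mpoly_vars p \<subseteq> coords n \<and>
     (\<forall>X\<in>mat_pairs n. mpoly_eval p (coord_val X) = f X)}"

lemma mpoly_vars_const: "mpoly_vars (Poly_Mapping.single 0 c) \<subseteq> V"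
  unfolding mpoly_vars_def by auto

interpretation pf: function_algebra "mat_pairs n" "poly_funs n" for n
proof
  fix c :: "'a::field"
  show "(\<lambda>_. c) \<in> poly_funs n"
    unfolding poly_funs_def
    using mpoly_vars_const[of c] by (fastforce simp: mpoly_eval_single monom_val_def)
next
  fix f g :: "'a mat_pair \<Rightarrow> 'a"
  assume "f \<in> poly_funs n" "g \<in> poly_funs n"
  then obtain p q where pq: "mpoly_vars p \<subseteq> coords n" "mpoly_vars q \<subseteq> coords n"
    "\<forall>X\<in>mat_pairs n. mpoly_eval p (coord_val X) = f X"
    "\<forall>X\<in>mat_pairs n. mpoly_eval q (coord_val X) = g X"
    unfolding poly_funs_def by blast
  then show "(\<lambda>x. f x + g x) \<in> poly_funs n"
    unfolding poly_funs_def using mpoly_vars_add[of p q]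
    by (auto simp: mpoly_eval_add intro!: exI[of _ "p + q"])
  from pq show "(\<lambda>x. f x * g x) \<in> poly_funs n"
    unfolding poly_funs_def using mpoly_vars_mult[of p q]
    by (auto simp: mpoly_eval_mult intro!: exI[of _ "p * q"])
next
  fix f g :: "'a mat_pair \<Rightarrow> 'a"
  assume "f \<in> poly_funs n" "\<And>x. x \<in> mat_pairs n \<Longrightarrow> f x = g x"
  then show "g \<in> poly_funs n" unfolding poly_funs_def by auto
qed

lemma coord_poly_fun: "v \<in> coords n \<Longrightarrow> (\<lambda>X. coord_val X v) \<in> poly_funs n"
  unfolding poly_funs_def
  by (auto intro!: exI[of _ "Poly_Mapping.single (Poly_Mapping.single v 1) 1"]
      simp: mpoly_eval_single monom_val_def mpoly_vars_def)

lemma fst_poly_mats: "fst \<in> pf.mats n n n"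
proof (rule pf.matsI)
  fix i j assume "i < n" "j < n"
  then have "Inl (i, j) \<in> coords n" unfolding coords_def by auto
  from coord_poly_fun[OF this] show "(\<lambda>x. fst x $$ (i, j)) \<in> poly_funs n"
    by (rule pf.cong) auto
qed (auto simp: mat_pairs_def)

lemma snd_poly_mats: "snd \<in> pf.mats n n n"
proof (rule pf.matsI)
  fix i j assume "i < n" "j < n"
  then have "Inr (i, j) \<in> coords n" unfolding coords_def by auto
  from coord_poly_fun[OF this] show "(\<lambda>x. snd x $$ (i, j)) \<in> poly_funs n"
    by (rule pf.cong) auto
qed (auto simp: mat_pairs_def)

section \<open>Polynomial functions of one parameter and curves of matrix pairs\<close>

definition upoly_funs :: "('k::comm_ring_1 \<Rightarrow> 'k) set" where
  "upoly_funs = range poly"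

interpretation uf: function_algebra UNIV upoly_funs
proof
  fix c :: "'a::comm_ring_1"
  have "(\<lambda>_. c) = poly [:c:]" by auto
  then show "(\<lambda>_. c) \<in> upoly_funs" unfolding upoly_funs_def by blast
next
  fix f g :: "'a \<Rightarrow> 'a"
  assume "f \<in> upoly_funs" "g \<in> upoly_funs"
  then obtain p q where "f = poly p" "g = poly q" unfolding upoly_funs_def by blast
  then have "(\<lambda>x. f x + g x) = poly (p + q)" "(\<lambda>x. f x * g x) = poly (p * q)" by auto
  then show "(\<lambda>x. f x + g x) \<in> upoly_funs" "(\<lambda>x. f x * g x) \<in> upoly_funs"
    unfolding upoly_funs_def by blast+
next
  fix f g :: "'a \<Rightarrow> 'a"
  assume "f \<in> upoly_funs" "\<And>x. x \<in> UNIV \<Longrightarrow> f x = g x"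
  then show "g \<in> upoly_funs" by (metis UNIV_I ext)
qed

lemma id_upoly_fun: "(\<lambda>t :: 'k::comm_ring_1. t) \<in> upoly_funs"
proof -
  have "(\<lambda>t. t) = (poly [:0, 1:] :: 'k \<Rightarrow> 'k)" by (rule ext) simp
  then show ?thesis unfolding upoly_funs_def by blast
qed

text \<open>Makes the bound on roots in one variable available for functions on pairs: substituting
  polynomial entries into a polynomial leaves a polynomial in \<open>t\<close>.\<close>

lemma poly_fun_curve:
  assumes f: "f \<in> poly_funs n" and a: "a \<in> uf.mats n n" and b: "b \<in> uf.mats n n"
  shows "(\<lambda>t. f (a t, b t)) \<in> upoly_funs"
proof -
  obtain p where p: "mpoly_vars p \<subseteq> coords n"
    "\<And>X. X \<in> mat_pairs n \<Longrightarrow> mpoly_eval p (coord_val X) = f X"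
    using f unfolding poly_funs_def by blast
  have "(\<lambda>t. mpoly_eval p (coord_val (a t, b t))) \<in> upoly_funs"
    unfolding mpoly_eval_def
  proof (intro uf.sum uf.mult uf.const uf.prod uf.power)
    fix m v assume "m \<in> keys p" "v \<in> keys m"
    then have "v \<in> coords n" using p(1) unfolding mpoly_vars_def by blast
    then show "(\<lambda>t. coord_val (a t, b t) v) \<in> upoly_funs"
      unfolding coords_def using uf.mats_index[OF a] uf.mats_index[OF b] by auto
  qed
  moreover have "(a t, b t) \<in> mat_pairs n" for t
    using uf.mats_carrier[OF a] uf.mats_carrier[OF b] by (simp add: mat_pairs_def)
  ultimately show ?thesis using p(2) by simp
qed

section \<open>Varieties and irreducibility\<close>

lemma varietyI:
  assumes "\<And>f. f \<in> \<F> \<Longrightarrow> f \<in> poly_funs n"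
  shows "variety n {X \<in> mat_pairs n. \<forall>f\<in>\<F>. f X = 0}"
proof -
  have "\<forall>f\<in>\<F>. \<exists>p. mpoly_vars p \<subseteq> coords n \<and> (\<forall>X\<in>mat_pairs n. mpoly_eval p (coord_val X) = f X)"
    using assms unfolding poly_funs_def by blast
  then obtain P where P: "\<And>f. f \<in> \<F> \<Longrightarrow> mpoly_vars (P f) \<subseteq> coords n"
    "\<And>f X. f \<in> \<F> \<Longrightarrow> X \<in> mat_pairs n \<Longrightarrow> mpoly_eval (P f) (coord_val X) = f X"
    by metis
  have "{X \<in> mat_pairs n. \<forall>f\<in>\<F>. f X = 0} = zero_locus n (P ` \<F>)"
    unfolding zero_locus_def using P(2) by auto
  moreover have "\<forall>p\<in>P ` \<F>. mpoly_vars p \<subseteq> coords n" using P(1) by simp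
  ultimately show ?thesis unfolding variety_def by (intro exI[of _ "P ` \<F>"] conjI)
qed

lemma varietyE:
  assumes "variety n V"
  obtains \<F> where "\<F> \<subseteq> poly_funs n" "V = {X \<in> mat_pairs n. \<forall>f\<in>\<F>. f X = 0}"
proof -
  from assms obtain S where S: "\<forall>p\<in>S. mpoly_vars p \<subseteq> coords n" "V = zero_locus n S"
    unfolding variety_def by blast
  show thesis
    by (rule that[of "(\<lambda>p X. mpoly_eval p (coord_val X)) ` S"])
      (use S in \<open>auto simp: poly_funs_def zero_locus_def\<close>)
qed

lemma variety_subset: "variety n V \<Longrightarrow> V \<subseteq> mat_pairs n"
  by (auto simp: variety_def zero_locus_def)

text \<open>As equations serve all polynomial functions that vanish on some member, which avoids
  choosing equations for each member. Nonemptiness matters because the empty intersection is not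
  contained in \<open>mat_pairs n\<close>.\<close>

lemma variety_Inter:
  assumes "\<V> \<noteq> {}" "\<And>V. V \<in> \<V> \<Longrightarrow> variety n V"
  shows "variety n (\<Inter>\<V>)"
proof -
  let ?F = "{f \<in> poly_funs n. \<exists>V\<in>\<V>. \<forall>X\<in>V. f X = 0}"
  have "\<Inter>\<V> = {X \<in> mat_pairs n. \<forall>f\<in>?F. f X = 0}"
  proof (intro equalityI subsetI)
    fix X assume "X \<in> \<Inter>\<V>"
    then show "X \<in> {X \<in> mat_pairs n. \<forall>f\<in>?F. f X = 0}"
      using assms variety_subset[of n] by fast
  next
    fix X assume X: "X \<in> {X \<in> mat_pairs n. \<forall>f\<in>?F. f X = 0}"
    show "X \<in> \<Inter>\<V>"
    proof
      fix V assume V: "V \<in> \<V>"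
      from varietyE[OF assms(2)[OF this]] obtain \<F>
        where F: "\<F> \<subseteq> poly_funs n" "V = {X \<in> mat_pairs n. \<forall>f\<in>\<F>. f X = 0}" by blast
      have "f X = 0" if "f \<in> \<F>" for f
      proof -
        have "\<forall>Y\<in>V. f Y = 0" using that unfolding F(2) by simp
        then have "f \<in> ?F" using that F(1) V by auto
        with X show ?thesis by simp
      qed
      then show "X \<in> V" using X unfolding F(2) by simp
    qed
  qed
  then show ?thesis using varietyI[of ?F n] by simp
qed

lemma variety_Int: "variety n V \<Longrightarrow> variety n W \<Longrightarrow> variety n (V \<inter> W)"
  using variety_Inter[of "{V, W}" n] by auto

lemma variety_Un:
  assumes "variety n V" "variety n W"
  shows "variety n (V \<union> W)"
proof -
  from varietyE[OF assms(1)] obtain F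
    where F: "F \<subseteq> poly_funs n" "V = {X \<in> mat_pairs n. \<forall>f\<in>F. f X = 0}" by blast
  from varietyE[OF assms(2)] obtain G
    where G: "G \<subseteq> poly_funs n" "W = {X \<in> mat_pairs n. \<forall>f\<in>G. f X = 0}" by blast
  let ?H = "(\<lambda>(f, g) X. f X * g X) ` (F \<times> G)"
  have "V \<union> W = {X \<in> mat_pairs n. \<forall>h\<in>?H. h X = 0}"
    unfolding F(2) G(2) by auto
  moreover have "h \<in> poly_funs n" if "h \<in> ?H" for h
    using that F(1) G(1) by (auto intro!: pf.mult)
  ultimately show ?thesis using varietyI[of ?H n] by simp
qed

lemma variety_empty: "variety n ({} :: 'k::field mat_pair set)"
proof -
  have "variety n {X \<in> mat_pairs n :: 'k mat_pair set. \<forall>f\<in>{\<lambda>_. 1 :: 'k}. f X = 0}"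
    by (rule varietyI) (auto intro: pf.const)
  then show ?thesis by simp
qed

lemma variety_Union:
  "finite \<V> \<Longrightarrow> (\<And>V. V \<in> \<V> \<Longrightarrow> variety n V) \<Longrightarrow> variety n (\<Union>\<V>)"
  by (induction \<V> rule: finite_induct) (auto intro: variety_Un variety_empty)

lemma variety_mat_pairs: "variety n (mat_pairs n)"
  using varietyI[of "{}" n] by simp

lemma zariski_closure_variety:
  "X \<subseteq> mat_pairs n \<Longrightarrow> variety n (zariski_closure n X)"
  unfolding zariski_closure_def by (rule variety_Inter) (use variety_mat_pairs in auto)

lemma zariski_closure_superset: "X \<subseteq> zariski_closure n X"
  unfolding zariski_closure_def by auto

lemma zariski_closure_minimal: "variety n V \<Longrightarrow> X \<subseteq> V \<Longrightarrow> zariski_closure n X \<subseteq> V"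
  unfolding zariski_closure_def by auto

lemma zariski_closure_vanish:
  assumes f: "f \<in> poly_funs n" and Z: "Z \<subseteq> mat_pairs n" "\<And>X. X \<in> Z \<Longrightarrow> f X = 0"
    and X: "X \<in> zariski_closure n Z"
  shows "f X = 0"
proof -
  have "variety n {X \<in> mat_pairs n. \<forall>g\<in>{f}. g X = 0}"
    by (rule varietyI) (use f in auto)
  then have "variety n {X \<in> mat_pairs n. f X = 0}" by simp
  moreover have "Z \<subseteq> {X \<in> mat_pairs n. f X = 0}" using Z by (simp add: subset_iff)
  ultimately have "zariski_closure n Z \<subseteq> {X \<in> mat_pairs n. f X = 0}"
    by (rule zariski_closure_minimal)
  from subsetD[OF this X] show ?thesis by simp
qed

lemma zariski_closureI:
  assumes "X \<in> mat_pairs n"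
    and "\<And>f. f \<in> poly_funs n \<Longrightarrow> (\<And>Y. Y \<in> Z \<Longrightarrow> f Y = 0) \<Longrightarrow> f X = 0"
  shows "X \<in> zariski_closure n Z"
  unfolding zariski_closure_def
proof
  fix V assume "V \<in> {V. variety n V \<and> Z \<subseteq> V}"
  then have V: "variety n V" "Z \<subseteq> V" by auto
  from varietyE[OF V(1)] obtain F
    where F: "F \<subseteq> poly_funs n" "V = {X \<in> mat_pairs n. \<forall>f\<in>F. f X = 0}" by blast
  then show "X \<in> V" using assms V(2) by blast
qed

section \<open>Polynomial curves over an infinite field\<close>

lemma alg_closed_infinite: "infinite (UNIV :: 'k::alg_closed_field set)"
proof
  assume fin: "finite (UNIV :: 'k set)"
  \<comment> \<open>Over a finite field \<open>p\<close> vanishes everywhere, so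
    \<open>p + 1\<close> is a nonconstant polynomial without roots.\<close>
  define p :: "'k poly" where "p = (\<Prod>a\<in>UNIV. [:- a, 1:])"
  have deg: "degree p = card (UNIV :: 'k set)"
    unfolding p_def by (subst degree_prod_eq_sum_degree) auto
  moreover have "card (UNIV :: 'k set) > 0" using fin by (simp add: card_gt_0_iff)
  ultimately have "degree (p + 1) > 0" by (simp add: degree_add_eq_left)
  then obtain x where "poly (p + 1) x = 0" using alg_closed_imp_poly_has_root by blast
  moreover have "poly p x = 0"
    unfolding p_def poly_prod by (rule prod_zero[OF fin]) (auto intro: bexI[of _ x])
  ultimately show False by simp
qed

lemma upoly_fun_finite_zeros:
  fixes f :: "'k::idom \<Rightarrow> 'k"
  assumes "f \<in> upoly_funs" "f s \<noteq> 0"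
  shows "finite {t. f t = 0}"
proof -
  obtain p where p: "f = poly p" using assms unfolding upoly_funs_def by blast
  then have "p \<noteq> 0" using assms(2) by auto
  then show ?thesis unfolding p using poly_roots_finite by blast
qed

text \<open>Takes the place of limits: a polynomial function vanishing on \<open>Z\<close> has
  infinitely many zeros on the curve, hence vanishes along all of it, also at the parameters in
  \<open>T\<close>.\<close>

lemma zariski_closure_curve:
  fixes a b :: "'k::alg_closed_field \<Rightarrow> 'k mat"
  assumes a: "a \<in> uf.mats n n" and b: "b \<in> uf.mats n n"
    and fin: "finite T" and Z: "\<And>t. t \<notin> T \<Longrightarrow> (a t, b t) \<in> Z"
  shows "(a s, b s) \<in> zariski_closure n Z"
proof (rule zariski_closureI)
  show "(a s, b s) \<in> mat_pairs n"
    using uf.mats_carrier[OF a] uf.mats_carrier[OF b] by (simp add: mat_pairs_def)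
next
  fix f assume f: "f \<in> poly_funs n" "\<And>Y. Y \<in> Z \<Longrightarrow> f Y = 0"
  have "UNIV \<subseteq> {t. f (a t, b t) = 0} \<union> T" using Z f(2) by blast
  then have "infinite {t. f (a t, b t) = 0}"
    using fin alg_closed_infinite by (metis finite_Un finite_subset)
  with upoly_fun_finite_zeros[OF poly_fun_curve[OF f(1) a b]]
  show "f (a s, b s) = 0" by blast
qed

text \<open>Any two points are joined by a polynomial curve that leaves the set only finitely often,
  and on such a curve a product of two polynomial functions vanishes only if a factor does.\<close>

lemma irreducible_zariski_closure:
  fixes Z :: "'k::alg_closed_field mat_pair set"
  assumes Z: "Z \<subseteq> mat_pairs n"
    and curve: "\<And>X Y. X \<in> Z \<Longrightarrow> Y \<in> Z \<Longrightarrow> \<exists>a b T. a \<in> uf.mats n n \<and> b \<in> uf.mats n n \<and>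
      (a 0, b 0) = X \<and> (a 1, b 1) = Y \<and> finite T \<and> (\<forall>t. t \<notin> T \<longrightarrow> (a t, b t) \<in> Z)"
  shows "irreducible_variety n (zariski_closure n Z)"
  unfolding irreducible_variety_def
proof (intro conjI notI)
  show "variety n (zariski_closure n Z)" by (rule zariski_closure_variety[OF Z])
next
  \<comment> \<open>By minimality of the closure a proper subvariety misses a point of
    \<open>Z\<close> itself, so one of its equations is nonzero there.\<close>
  have *: "\<exists>f X. f \<in> poly_funs n \<and> (\<forall>Y\<in>V. f Y = 0) \<and> X \<in> Z \<and> f X \<noteq> 0"
    if V: "variety n V" "V \<subset> zariski_closure n Z" for V
  proof -
    have "\<not> Z \<subseteq> V" using zariski_closure_minimal[OF V(1), of Z] V(2) by blast
    then obtain X where X: "X \<in> Z" "X \<notin> V" by blast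
    from varietyE[OF V(1)] obtain F
      where F: "F \<subseteq> poly_funs n" "V = {X \<in> mat_pairs n. \<forall>f\<in>F. f X = 0}" by blast
    then obtain f where "f \<in> F" "f X \<noteq> 0" using X Z by blast
    with X F show ?thesis by blast
  qed
  assume "\<exists>V1 V2. variety n V1 \<and> variety n V2 \<and> V1 \<subset> zariski_closure n Z \<and>
    V2 \<subset> zariski_closure n Z \<and> zariski_closure n Z = V1 \<union> V2"
  then obtain V1 V2 where V: "variety n V1" "variety n V2" "V1 \<subset> zariski_closure n Z"
    "V2 \<subset> zariski_closure n Z" "zariski_closure n Z = V1 \<union> V2" by blast
  obtain f X where f: "f \<in> poly_funs n" "\<And>Y. Y \<in> V1 \<Longrightarrow> f Y = 0" "X \<in> Z" "f X \<noteq> 0"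
    using *[OF V(1,3)] by blast
  obtain g Y where g: "g \<in> poly_funs n" "\<And>Y. Y \<in> V2 \<Longrightarrow> g Y = 0" "Y \<in> Z" "g Y \<noteq> 0"
    using *[OF V(2,4)] by blast
  obtain a b T where ab: "a \<in> uf.mats n n" "b \<in> uf.mats n n" "(a 0, b 0) = X" "(a 1, b 1) = Y"
    "finite T" "\<And>t. t \<notin> T \<Longrightarrow> (a t, b t) \<in> Z"
    using curve[OF f(3) g(3)] by blast
  have "finite {t. f (a t, b t) = 0}"
    by (rule upoly_fun_finite_zeros[OF poly_fun_curve[OF f(1) ab(1,2)], of 0]) (use ab f in simp)
  moreover have "finite {t. g (a t, b t) = 0}"
    by (rule upoly_fun_finite_zeros[OF poly_fun_curve[OF g(1) ab(1,2)], of 1]) (use ab g in simp)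
  ultimately have "finite ({t. f (a t, b t) = 0} \<union> {t. g (a t, b t) = 0} \<union> T)"
    using ab(5) by simp
  from ex_new_if_finite[OF alg_closed_infinite this]
  obtain t where t: "t \<notin> {t. f (a t, b t) = 0} \<union> {t. g (a t, b t) = 0} \<union> T"
    by (rule exE)
  then have "(a t, b t) \<in> V1 \<union> V2"
    using subsetD[OF zariski_closure_superset[of Z n] ab(6)[of t]] V(5) by simp
  with f(2)[of "(a t, b t)"] g(2)[of "(a t, b t)"] t show False by auto
qed

section \<open>Uniqueness of irredundant decompositions\<close>

lemma irreducible_subset_Union:
  assumes V: "irreducible_variety n V" and fin: "finite \<W>" "\<W> \<noteq> {}"
    and W: "\<And>W. W \<in> \<W> \<Longrightarrow> variety n W" and sub: "V \<subseteq> \<Union>\<W>"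
  shows "\<exists>W\<in>\<W>. V \<subseteq> W"
  using fin W sub
proof (induction \<W> rule: finite_ne_induct)
  case (insert W \<W>)
  have "variety n V" using V by (simp add: irreducible_variety_def)
  then have v: "variety n (V \<inter> W)" "variety n (V \<inter> \<Union>\<W>)"
    using insert.prems insert.hyps by (auto intro!: variety_Int variety_Union)
  have "V = (V \<inter> W) \<union> (V \<inter> \<Union>\<W>)" using insert.prems by blast
  then have "V \<inter> W = V \<or> V \<inter> \<Union>\<W> = V"
    using V v unfolding irreducible_variety_def by blast
  then show ?case
  proof
    assume "V \<inter> \<Union>\<W> = V"
    then have "V \<subseteq> \<Union>\<W>" by blast
    with insert show ?thesis by blast
  qed blast
qed auto

text \<open>A component of one decomposition lies in a component of the other, which lies in one of
  the first; irredundancy makes the three equal. The empty set counts as irreducible here, so an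
  empty \<open>X\<close> would be decomposed both by the empty family and by the family whose only
  member is the empty set.\<close>

lemma irredundant_decomposition_unique:
  assumes F: "irredundant_decomposition n X F" and G: "irredundant_decomposition n X G"
    and "X \<noteq> {}"
  shows "F = G"
proof -
  have *: "F' \<subseteq> G'" if F: "irredundant_decomposition n X F'" and G: "irredundant_decomposition n X G'"
    for F' G'
  proof
    fix V assume V: "V \<in> F'"
    have ne: "F' \<noteq> {}" "G' \<noteq> {}"
      using F G \<open>X \<noteq> {}\<close> unfolding irredundant_decomposition_def by auto
    have fin: "finite F'" "finite G'" and irr: "\<And>V. V \<in> F' \<union> G' \<Longrightarrow> irreducible_variety n V"
      and un: "\<Union>F' = X" "\<Union>G' = X"
      using F G unfolding irredundant_decomposition_def by auto
    have var: "variety n V" if "V \<in> F' \<union> G'" for V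
      using irr[OF that] by (simp add: irreducible_variety_def)
    have "V \<subseteq> \<Union>G'" using V un by blast
    then obtain W where W: "W \<in> G'" "V \<subseteq> W"
      using irreducible_subset_Union[OF irr fin(2) ne(2) var] V by blast
    have "W \<subseteq> \<Union>F'" using W un by blast
    then obtain V' where V': "V' \<in> F'" "W \<subseteq> V'"
      using irreducible_subset_Union[OF irr fin(1) ne(1) var] W by blast
    have "V = V'" using F V V' W unfolding irredundant_decomposition_def by blast
    with W V' show "V \<in> G'" by auto
  qed
  show ?thesis using *[OF F G] *[OF G F] by blast
qed

section \<open>Generalised inverses and idempotent matrices\<close>

lemma mat_mult_index:
  "A \<in> carrier_mat r k \<Longrightarrow> B \<in> carrier_mat k c \<Longrightarrow> i < r \<Longrightarrow> j < c \<Longrightarrow>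
    (A * B) $$ (i, j) = (\<Sum>l<k. A $$ (i, l) * B $$ (l, j))"
  by (auto simp: scalar_prod_def atLeast0LessThan intro!: sum.cong)

lemma mat_eqI:
  "A \<in> carrier_mat r c \<Longrightarrow> B \<in> carrier_mat r c \<Longrightarrow>
    (\<And>i j. i < r \<Longrightarrow> j < c \<Longrightarrow> A $$ (i, j) = B $$ (i, j)) \<Longrightarrow> A = B"
  by (rule eq_matI) auto

lemma assoc_mult_mat4:
  "A \<in> carrier_mat n1 n2 \<Longrightarrow> B \<in> carrier_mat n2 n3 \<Longrightarrow> C \<in> carrier_mat n3 n4 \<Longrightarrow>
    D \<in> carrier_mat n4 n5 \<Longrightarrow> A * (B * C) * D = A * B * (C * D)"
  using assoc_mult_mat[of A n1 n2 B n3 C n4] assoc_mult_mat[of "A * B" n1 n3 C n4 D n5]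
  by (simp del: assoc_mult_mat)

text \<open>A generalised inverse plays the role of row reduction: it yields left inverses of
  injective matrices and the partner of a square-zero matrix. It is built by clearing the defect
  \<open>M - M * G * M\<close> one column at a time, starting from \<open>G = 0\<close>.\<close>

lemma inner_inverse:
  fixes M :: "'k::field mat"
  assumes M: "M \<in> carrier_mat m n"
  shows "\<exists>G\<in>carrier_mat n m. M * G * M = M"
proof -
  have "b \<le> n \<Longrightarrow> \<exists>G\<in>carrier_mat n m. \<forall>a<m. \<forall>b'<b. (M - M * G * M) $$ (a, b') = 0" for b
  proof (induction b)
    case 0
    show ?case by (auto intro: bexI[of _ "0\<^sub>m n m"])
  next
    case (Suc b)
    then obtain G where G: "G \<in> carrier_mat n m"
      and z: "\<And>a b'. a < m \<Longrightarrow> b' < b \<Longrightarrow> (M - M * G * M) $$ (a, b') = 0" by auto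
    define D where "D = M - M * G * M"
    have MGM: "M * G * M \<in> carrier_mat m n" using M G by auto
    then have D: "D \<in> carrier_mat m n" unfolding D_def by (rule minus_carrier_mat)
    show ?case
    proof (cases "\<forall>a<m. D $$ (a, b) = 0")
      case True
      then show ?thesis using G z unfolding D_def by (auto intro!: bexI[of _ G] simp: less_Suc_eq)
    next
      case False
      then obtain a where a: "a < m" and d: "D $$ (a, b) \<noteq> 0" by auto
      \<comment> \<open>The Wedderburn rank reduction: adding \<open>U\<close> to \<open>G\<close> subtracts the rank-one matrix
        \<open>D e\<^sub>b e\<^sub>a\<^sup>T D / D\<^sub>a\<^sub>b\<close> from the defect \<open>D\<close>, which clears column \<open>b\<close> and
        keeps zero columns zero.\<close>
      define E where "E = mat n m (\<lambda>(p, q). if p = b \<and> q = a then inverse (D $$ (a, b)) else 0)"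
      define U where "U = (1\<^sub>m n - G * M) * E * (1\<^sub>m m - M * G)"
      have E: "E \<in> carrier_mat n m" unfolding E_def by simp
      have GM: "G * M \<in> carrier_mat n n" and MG: "M * G \<in> carrier_mat m m" using M G by auto
      have L: "1\<^sub>m n - G * M \<in> carrier_mat n n" and R: "1\<^sub>m m - M * G \<in> carrier_mat m m"
        using GM MG minus_carrier_mat by blast+
      have LE: "(1\<^sub>m n - G * M) * E \<in> carrier_mat n m" using L E by auto
      have U: "U \<in> carrier_mat n m" unfolding U_def using LE R by auto
      have MLD: "M * (1\<^sub>m n - G * M) = D"
        unfolding D_def
        by (simp only: mult_minus_distrib_mat[OF M one_carrier_mat GM] right_mult_one_mat[OF M]
            assoc_mult_mat[OF M G M])
      have RMD: "(1\<^sub>m m - M * G) * M = D"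
        unfolding D_def
        by (simp only: minus_mult_distrib_mat[OF one_carrier_mat MG M] left_mult_one_mat[OF M])
      have "M * U * M = M * ((1\<^sub>m n - G * M) * E) * ((1\<^sub>m m - M * G) * M)"
        unfolding U_def by (rule assoc_mult_mat4[OF M LE R M])
      also have "\<dots> = D * E * D"
        unfolding RMD using assoc_mult_mat[OF M L E] MLD by simp
      finally have MUM: "M * U * M = D * E * D" .
      have DE: "D * E \<in> carrier_mat m m" using D E by auto
      have DED: "(D * E * D) $$ (x, y) = D $$ (x, b) * inverse (D $$ (a, b)) * D $$ (a, y)"
        if x: "x < m" and y: "y < n" for x y
      proof -
        have b: "b < n" using Suc.prems by simp
        have "(D * E) $$ (x, q) = (if q = a then D $$ (x, b) * inverse (D $$ (a, b)) else 0)"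
          if "q < m" for q
        proof -
          have "(D * E) $$ (x, q) = (\<Sum>p<n. D $$ (x, p) * E $$ (p, q))"
            by (rule mat_mult_index[OF D E x that])
          also have "\<dots> = (\<Sum>p<n. if p = b then (if q = a then D $$ (x, b) * inverse (D $$ (a, b)) else 0) else 0)"
            by (rule sum.cong) (use that in \<open>auto simp: E_def\<close>)
          finally show ?thesis using b by simp
        qed
        then have "(D * E * D) $$ (x, y) = (\<Sum>q<m. (if q = a then D $$ (x, b) * inverse (D $$ (a, b)) else 0) * D $$ (q, y))"
          by (subst mat_mult_index[OF DE D x y]) auto
        also have "\<dots> = (\<Sum>q<m. if q = a then D $$ (x, b) * inverse (D $$ (a, b)) * D $$ (a, y) else 0)"
          by (rule sum.cong) auto
        finally show ?thesis using a by simp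
      qed
      have "M * (G + U) * M = M * G * M + D * E * D"
        unfolding MUM[symmetric] mult_add_distrib_mat[OF M G U]
        by (rule add_mult_distrib_mat[of _ m m]) (use M G U in auto)
      then have new: "(M - M * (G + U) * M) $$ (x, y) = D $$ (x, y) - (D * E * D) $$ (x, y)"
        if "x < m" "y < n" for x y
        using that M MGM D E DE unfolding D_def by (simp del: index_mult_mat(1))
      have "(M - M * (G + U) * M) $$ (x, y) = 0" if x: "x < m" and y: "y < Suc b" for x y
      proof -
        have yn: "y < n" using y Suc.prems by simp
        have "D $$ (x', y) = 0" if "x' < m" "y < b" for x'
          using z that unfolding D_def by simp
        then show ?thesis
          unfolding new[OF x yn] DED[OF x yn] using x a d y by (cases "y = b") auto
      qed
      then show ?thesis using G U by (intro bexI[of _ "G + U"]) auto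
    qed
  qed
  from this[of n] obtain G where G: "G \<in> carrier_mat n m"
    and z: "\<And>a b. a < m \<Longrightarrow> b < n \<Longrightarrow> (M - M * G * M) $$ (a, b) = 0" by auto
  have "M * G * M = M"
  proof (rule mat_eqI[of _ m n])
    show MGM: "M * G * M \<in> carrier_mat m n" using M G by auto
    fix a b assume "a < m" "b < n"
    with z[OF this] M MGM show "(M * G * M) $$ (a, b) = M $$ (a, b)"
      by (simp del: index_mult_mat(1))
  qed (rule M)
  with G show ?thesis by blast
qed

lemma inj_mat_cancel:
  fixes F :: "'k::field mat"
  assumes F: "F \<in> carrier_mat n r" and inj: "\<And>v. v \<in> carrier_vec r \<Longrightarrow> F *\<^sub>v v = 0\<^sub>v n \<Longrightarrow> v = 0\<^sub>v r"
    and X: "X \<in> carrier_mat r c" and Y: "Y \<in> carrier_mat r c" and eq: "F * X = F * Y"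
  shows "X = Y"
proof (rule mat_col_eqI)
  fix i assume "i < dim_col Y"
  then have i: "i < c" using Y by simp
  have c: "col X i \<in> carrier_vec r" "col Y i \<in> carrier_vec r" using X Y i by auto
  have "F *\<^sub>v col X i = F *\<^sub>v col Y i"
    using arg_cong[OF eq, of "\<lambda>M. col M i"] col_mult2[OF F X i] col_mult2[OF F Y i] by simp
  then have "F *\<^sub>v (col X i - col Y i) = 0\<^sub>v n"
    using mult_minus_distrib_mat_vec[OF F c] F c by simp
  from inj[OF _ this] have "col X i - col Y i = 0\<^sub>v r" using c by simp
  then have "(col X i - col Y i) $ j = 0" if "j < r" for j using that by simp
  then show "col X i = col Y i" using c X Y by (intro eq_vecI) auto
qed (use X Y in auto)

text \<open>In \<open>M (G M) = M\<close> an injective \<open>M\<close> can be cancelled on the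
  left.\<close>

lemma left_inverse:
  fixes M :: "'k::field mat"
  assumes M: "M \<in> carrier_mat m n" and inj: "\<And>v. v \<in> carrier_vec n \<Longrightarrow> M *\<^sub>v v = 0\<^sub>v m \<Longrightarrow> v = 0\<^sub>v n"
  shows "\<exists>G\<in>carrier_mat n m. G * M = 1\<^sub>m n"
proof -
  obtain G where G: "G \<in> carrier_mat n m" "M * G * M = M" using inner_inverse[OF M] by blast
  have "G * M = 1\<^sub>m n"
    by (rule inj_mat_cancel[OF M inj]) (use M G in auto)
  with G show ?thesis by blast
qed

text \<open>If \<open>b < a\<close>, padding with zeros turns \<open>X\<close> and \<open>Y\<close>
  into square matrices of size \<open>a\<close> with product \<open>1\<close>. A one-sided inverse
  of a square matrix is two-sided, but row \<open>b\<close> of the padded \<open>Y\<close> is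
  zero.\<close>

lemma right_inverse_dim_le:
  fixes X :: "'k::field mat"
  assumes X: "X \<in> carrier_mat a b" and Y: "Y \<in> carrier_mat b a" and XY: "X * Y = 1\<^sub>m a"
  shows "a \<le> b"
proof (rule ccontr)
  assume "\<not> a \<le> b"
  then have ba: "b < a" by simp
  define X' where "X' = mat a a (\<lambda>(i, j). if j < b then X $$ (i, j) else 0)"
  define Y' where "Y' = mat a a (\<lambda>(i, j). if i < b then Y $$ (i, j) else 0)"
  have c: "X' \<in> carrier_mat a a" "Y' \<in> carrier_mat a a" unfolding X'_def Y'_def by auto
  have "X' * Y' = 1\<^sub>m a"
  proof (rule mat_eqI[of _ a a])
    fix i j assume ij: "i < a" "j < a"
    have "(X' * Y') $$ (i, j) = (\<Sum>l<a. if l < b then X $$ (i, l) * Y $$ (l, j) else 0)"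
      by (subst mat_mult_index[OF c ij], rule sum.cong) (use ij in \<open>auto simp: X'_def Y'_def\<close>)
    also have "\<dots> = (\<Sum>l<b. X $$ (i, l) * Y $$ (l, j))"
      by (rule sum.mono_neutral_cong_right) (use ba in auto)
    also have "\<dots> = (X * Y) $$ (i, j)" by (rule mat_mult_index[OF X Y ij, symmetric])
    finally show "(X' * Y') $$ (i, j) = 1\<^sub>m a $$ (i, j)" unfolding XY .
  qed (use c in auto)
  then have "Y' * X' = 1\<^sub>m a" using mat_mult_left_right_inverse[OF c] by simp
  then have "(Y' * X') $$ (b, b) = 1" using ba by simp
  moreover have "(Y' * X') $$ (b, b) = 0"
    by (subst mat_mult_index[OF c(2,1) ba ba]) (use ba in \<open>auto simp: Y'_def\<close>)
  ultimately show False by simp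
qed

section \<open>Rank factorisation and diagonalisation of idempotents\<close>

lemma sum_lessThan_add:
  fixes f :: "nat \<Rightarrow> 'a::comm_monoid_add"
  shows "(\<Sum>k<r + s. f k) = (\<Sum>k<r. f k) + (\<Sum>k<s. f (r + k))"
  by (induction s) (auto simp: add.assoc)

text \<open>The columns of \<open>F\<close> are a basis of the image of \<open>P\<close>, and
  \<open>H\<close> gives the coordinates of the projected vector. The number \<open>r\<close> is
  left free and identified with the rank only afterwards, so exhibiting a factorisation computes a
  rank.\<close>

definition idem_factor :: "nat \<Rightarrow> nat \<Rightarrow> 'k::field mat \<Rightarrow> 'k mat \<Rightarrow> 'k mat \<Rightarrow> bool" where
  "idem_factor n r P F H \<longleftrightarrow>
     F \<in> carrier_mat n r \<and> H \<in> carrier_mat r n \<and> F * H = P \<and> H * F = 1\<^sub>m r"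

lemma idem_factor_carrier: "idem_factor n r P F H \<Longrightarrow> P \<in> carrier_mat n n"
  unfolding idem_factor_def by auto

lemma idem_factor_idem: "idem_factor n r P F H \<Longrightarrow> P * P = P"
  unfolding idem_factor_def
  using assoc_mult_mat4[of F n r H n F r H n] by auto

text \<open>The change of basis \<open>H F'\<close> on the image of \<open>P\<close> has the right
  inverse \<open>H' F\<close>, because \<open>F' H' = P = F H\<close>.\<close>

lemma idem_factor_le:
  assumes "idem_factor n r P F H" "idem_factor n s P F' H'"
  shows "r \<le> s"
proof (rule right_inverse_dim_le)
  note * = assms[unfolded idem_factor_def]
  show "H * F' \<in> carrier_mat r s" "H' * F \<in> carrier_mat s r" using * by auto
  have "H * F' * (H' * F) = H * (F' * H') * F"
    by (rule assoc_mult_mat4[symmetric]) (use * in auto)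
  also have "\<dots> = H * (F * H) * F" using * by simp
  also have "\<dots> = H * F * (H * F)"
    by (rule assoc_mult_mat4) (use * in auto)
  finally show "H * F' * (H' * F) = 1\<^sub>m r" using * by simp
qed

text \<open>\<open>F\<close> collects a maximal independent set of columns of \<open>P\<close>, and
  \<open>H\<close> the coordinates of all columns with respect to it. Then
  \<open>F (H F) = P F = F\<close>, and injectivity of \<open>F\<close> gives
  \<open>H F = 1\<close>.\<close>

lemma idempotent_factor:
  fixes P :: "'k::field mat"
  assumes P: "P \<in> carrier_mat n n" and PP: "P * P = P"
  shows "\<exists>F H. idem_factor n (vec_space.rank n P) P F H"
proof -
  interpret vec_space "TYPE('k)" n .
  have colsP: "set (cols P) \<subseteq> carrier_vec n" using P cols_dim by blast
  obtain S where S: "maximal S (\<lambda>T. T \<subseteq> set (cols P) \<and> lin_indpt T)" "finite S"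
    using maximal_exists_superset[of "set (cols P)" "\<lambda>T. T \<subseteq> set (cols P) \<and> lin_indpt T" "{}"]
      finite_lin_indpt2[of "{}"] by auto
  have Ss: "S \<subseteq> set (cols P)" and Si: "lin_indpt S"
    using S(1) unfolding maximal_def by auto
  obtain xs where xs: "set xs = S" "distinct xs" using finite_distinct_list[OF S(2)] by blast
  define r where "r = length xs"
  have rank: "rank P = r"
    using rank_card_indpt[OF P S(1)] xs distinct_card[of xs] unfolding r_def by simp
  define F where "F = mat_of_cols n xs"
  have F: "F \<in> carrier_mat n r" unfolding F_def r_def by simp
  have xsn: "set xs \<subseteq> carrier_vec n" using Ss colsP xs by blast
  have colsF: "cols F = xs" unfolding F_def using xsn by simp
  have span: "s \<in> span S" if s: "s \<in> set (cols P)" for s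
  proof (rule ccontr)
    assume ns: "s \<notin> span S"
    have "S \<subseteq> carrier_vec n" using Ss colsP by blast
    then have nS: "s \<notin> S" using ns span_mem by auto
    have "lin_indpt (S \<union> {s})"
      using lin_dep_iff_in_span[of S s] ns nS Si s colsP Ss by auto
    then have "S \<union> {s} = S" using S(1) s Ss unfolding maximal_def by blast
    with nS show False by blast
  qed
  have "\<exists>h\<in>carrier_vec r. F *\<^sub>v h = col P j" if j: "j < n" for j
  proof -
    have "col P j \<in> set (cols P)" using P j by (auto simp: cols_def)
    then have "col P j \<in> col_space F" using span unfolding col_space_def colsF xs(1) by blast
    then show ?thesis unfolding col_space_eq[OF F] using F by auto
  qed
  then obtain h where h: "\<And>j. j < n \<Longrightarrow> h j \<in> carrier_vec r" "\<And>j. j < n \<Longrightarrow> F *\<^sub>v h j = col P j"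
    by metis
  define H where "H = mat_of_cols r (map h [0..<n])"
  have H: "H \<in> carrier_mat r n" unfolding H_def
    using mat_of_cols_carrier(1)[of r "map h [0..<n]"] by simp
  have FH: "F * H = P"
  proof (rule mat_col_eqI)
    fix j assume "j < dim_col P"
    then have j: "j < n" using P by simp
    have "col H j = h j" unfolding H_def using j h(1) by simp
    then show "col (F * H) j = col P j" using col_mult2[OF F H j] h(2)[OF j] by simp
  qed (use F H P in auto)
  have inj: "v = 0\<^sub>v r" if v: "v \<in> carrier_vec r" "F *\<^sub>v v = 0\<^sub>v n" for v
    using lin_depI[OF F v(1) _ v(2)] Si xs unfolding colsF by auto
  \<comment> \<open>\<open>P\<close> fixes each of its own columns since \<open>P P = P\<close>, and
    the columns of \<open>F\<close> are among them.\<close>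
  have PF: "P * F = F"
  proof (rule mat_col_eqI)
    fix k assume "k < dim_col F"
    then have k: "k < r" using F by simp
    have "col F k = xs ! k" using k F colsF cols_nth[of k F] by simp
    moreover have "xs ! k \<in> set xs" using k unfolding r_def by (rule nth_mem)
    ultimately have "col F k \<in> set (cols P)" using Ss xs(1) by auto
    then obtain j where j: "j < n" "col F k = col P j" using P by (auto simp: cols_def)
    show "col (P * F) k = col F k"
      using col_mult2[OF P F k] col_mult2[OF P P j(1)] j(2) PP by simp
  qed (use F P in auto)
  have "H * F = 1\<^sub>m r"
  proof (rule inj_mat_cancel[OF F inj])
    show "F * (H * F) = F * 1\<^sub>m r"
      using assoc_mult_mat[OF F H F] F by (simp add: FH PF)
  qed (use F H in auto)
  with F H FH show ?thesis unfolding idem_factor_def rank by blast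
qed

lemma idem_factor_rank:
  assumes "idem_factor n r P F H"
  shows "vec_space.rank n P = r"
proof -
  obtain F' H' where "idem_factor n (vec_space.rank n P) P F' H'"
    using idempotent_factor[OF idem_factor_carrier[OF assms] idem_factor_idem[OF assms]] by blast
  then show ?thesis using idem_factor_le[OF assms] idem_factor_le[OF _ assms] by (meson le_antisym)
qed

definition proj_mat :: "nat \<Rightarrow> nat \<Rightarrow> 'k::field mat" where
  "proj_mat n r = mat n n (\<lambda>(i, j). if i = j \<and> i < r then 1 else 0)"

lemma proj_mat_carrier [simp]: "proj_mat n r \<in> carrier_mat n n"
  unfolding proj_mat_def by simp

lemma mult_proj_mat_index:
  "A \<in> carrier_mat m n \<Longrightarrow> i < m \<Longrightarrow> j < n \<Longrightarrow>
    (A * proj_mat n r) $$ (i, j) = (if j < r then A $$ (i, j) else 0)"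
proof -
  assume A: "A \<in> carrier_mat m n" and ij: "i < m" "j < n"
  have "(A * proj_mat n r) $$ (i, j) = (\<Sum>l<n. A $$ (i, l) * proj_mat n r $$ (l, j))"
    by (rule mat_mult_index[OF A _ ij]) simp
  also have "\<dots> = (\<Sum>l<n. if l = j then (if j < r then A $$ (i, j) else 0) else 0)"
    by (rule sum.cong) (use ij in \<open>auto simp: proj_mat_def\<close>)
  finally show ?thesis using ij by simp
qed

lemma proj_mat_mult_index:
  "A \<in> carrier_mat n m \<Longrightarrow> i < n \<Longrightarrow> j < m \<Longrightarrow>
    (proj_mat n r * A) $$ (i, j) = (if i < r then A $$ (i, j) else 0)"
proof -
  assume A: "A \<in> carrier_mat n m" and ij: "i < n" "j < m"
  have "(proj_mat n r * A) $$ (i, j) = (\<Sum>l<n. proj_mat n r $$ (i, l) * A $$ (l, j))"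
    by (rule mat_mult_index[OF _ A ij]) simp
  also have "\<dots> = (\<Sum>l<n. if l = i then (if i < r then A $$ (i, j) else 0) else 0)"
    by (rule sum.cong) (use ij in \<open>auto simp: proj_mat_def\<close>)
  finally show ?thesis using ij by simp
qed

lemma complement_idempotent:
  assumes P: "P \<in> carrier_mat n n" and PP: "P * P = (P :: 'k::field mat)"
  shows "1\<^sub>m n - P \<in> carrier_mat n n" "(1\<^sub>m n - P) * (1\<^sub>m n - P) = 1\<^sub>m n - P"
    "A \<in> carrier_mat n n \<Longrightarrow> A * P = P * A \<Longrightarrow> A * (1\<^sub>m n - P) = (1\<^sub>m n - P) * A"
proof -
  show P': "1\<^sub>m n - P \<in> carrier_mat n n" using P by (rule minus_carrier_mat)
  have "(1\<^sub>m n - P) * P = 0\<^sub>m n n"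
    using minus_mult_distrib_mat[OF one_carrier_mat P P] P PP by simp
  then show "(1\<^sub>m n - P) * (1\<^sub>m n - P) = 1\<^sub>m n - P"
    using mult_minus_distrib_mat[OF P' one_carrier_mat P] right_mult_one_mat[OF P'] P
    by (intro eq_matI) (auto simp del: index_mult_mat(1))
  show "A * (1\<^sub>m n - P) = (1\<^sub>m n - P) * A" if A: "A \<in> carrier_mat n n" and AP: "A * P = P * A"
    using mult_minus_distrib_mat[OF A one_carrier_mat P] minus_mult_distrib_mat[OF one_carrier_mat P A] A AP
    by simp
qed

text \<open>The factors of \<open>P\<close> and of \<open>1 - P\<close>, placed side by side, form
  mutually inverse \<open>Q\<close> and \<open>Q'\<close>; the mixed products vanish because
  \<open>P (1 - P) = 0\<close>. Both claims come from this one \<open>Q\<close>, whose number of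
  columns is the sum of the two ranks.\<close>

lemma idempotent_diagonal:
  fixes P :: "'k::field mat"
  assumes P: "P \<in> carrier_mat n n" and PP: "P * P = P"
  shows "vec_space.rank n P + vec_space.rank n (1\<^sub>m n - P) = n"
    and "\<exists>Q Q'. Q \<in> carrier_mat n n \<and> Q' \<in> carrier_mat n n \<and> Q * Q' = 1\<^sub>m n \<and> Q' * Q = 1\<^sub>m n \<and>
      P = Q * proj_mat n (vec_space.rank n P) * Q'"
proof -
  let ?P = "1\<^sub>m n - P"
  let ?r = "vec_space.rank n P" and ?s = "vec_space.rank n ?P"
  note P' = complement_idempotent(1)[OF P PP] and PP' = complement_idempotent(2)[OF P PP]
  obtain F H where FH: "idem_factor n ?r P F H" using idempotent_factor[OF P PP] by blast
  obtain F' H' where FH': "idem_factor n ?s ?P F' H'" using idempotent_factor[OF P' PP'] by blast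
  note fh = FH[unfolded idem_factor_def] FH'[unfolded idem_factor_def]
  have F: "F \<in> carrier_mat n ?r" and H: "H \<in> carrier_mat ?r n"
    and F': "F' \<in> carrier_mat n ?s" and H': "H' \<in> carrier_mat ?s n"
    using fh by auto
  have HP: "H * P = H" and H'P: "H' * ?P = H'"
    using fh assoc_mult_mat[OF H F H] assoc_mult_mat[OF H' F' H'] by auto
  have PF: "P * F = F" and P'F': "?P * F' = F'"
    using fh assoc_mult_mat[OF F H F] assoc_mult_mat[OF F' H' F'] by auto
  have z: "P * ?P = 0\<^sub>m n n" "?P * P = 0\<^sub>m n n"
    using mult_minus_distrib_mat[OF P _ P, of "1\<^sub>m n"] minus_mult_distrib_mat[OF _ P P, of "1\<^sub>m n"] P PP
    by auto
  have "H * F' = H * P * (?P * F')" unfolding HP P'F' ..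
  also have "\<dots> = H * (P * ?P) * F'" by (rule assoc_mult_mat4[OF H P P' F', symmetric])
  finally have HF': "H * F' = 0\<^sub>m ?r ?s" unfolding z using H F' by auto
  have "H' * F = H' * ?P * (P * F)" unfolding H'P PF ..
  also have "\<dots> = H' * (?P * P) * F" by (rule assoc_mult_mat4[OF H' P' P F, symmetric])
  finally have H'F: "H' * F = 0\<^sub>m ?s ?r" unfolding z using H' F by auto
  \<comment> \<open>\<open>N\<close> is kept apart from \<open>n\<close> until \<open>Q\<close> and
    \<open>Q'\<close> are known to be inverse on both sides, which forces the sizes to
    agree.\<close>
  define N where "N = ?r + ?s"
  define Q where "Q = mat n N (\<lambda>(i, j). if j < ?r then F $$ (i, j) else F' $$ (i, j - ?r))"
  define Q' where "Q' = mat N n (\<lambda>(i, j). if i < ?r then H $$ (i, j) else H' $$ (i - ?r, j))"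
  have Q: "Q \<in> carrier_mat n N" and Q': "Q' \<in> carrier_mat N n" unfolding Q_def Q'_def by auto
  have sum: "(\<Sum>k<N. f k) = (\<Sum>k<?r. f k) + (\<Sum>k<?s. f (?r + k))" for f :: "nat \<Rightarrow> 'k"
    unfolding N_def by (rule sum_lessThan_add)
  have QQ': "Q * Q' = 1\<^sub>m n"
  proof (rule mat_eqI[of _ n n])
    fix i j assume ij: "i < n" "j < n"
    have "(Q * Q') $$ (i, j) = (\<Sum>k<?r. F $$ (i, k) * H $$ (k, j)) + (\<Sum>k<?s. F' $$ (i, k) * H' $$ (k, j))"
      unfolding mat_mult_index[OF Q Q' ij] sum
      by (intro arg_cong2[of _ _ _ _ "(+)"] sum.cong) (use ij in \<open>auto simp: Q_def Q'_def N_def\<close>)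
    also have "\<dots> = (F * H) $$ (i, j) + (F' * H') $$ (i, j)"
      unfolding mat_mult_index[OF F H ij] mat_mult_index[OF F' H' ij] ..
    also have "\<dots> = 1\<^sub>m n $$ (i, j)" using fh P ij by simp
    finally show "(Q * Q') $$ (i, j) = 1\<^sub>m n $$ (i, j)" .
  qed (use Q Q' in auto)
  have Q'Q: "Q' * Q = 1\<^sub>m N"
  proof (rule mat_eqI[of _ N N])
    fix i j assume ij: "i < N" "j < N"
    have r: "row Q' i = (if i < ?r then row H i else row H' (i - ?r))"
      using ij H H' by (auto simp: Q'_def N_def intro!: eq_vecI)
    have c: "col Q j = (if j < ?r then col F j else col F' (j - ?r))"
      using ij F F' by (auto simp: Q_def N_def intro!: eq_vecI)
    have "(Q' * Q) $$ (i, j) = (if i < ?r then (if j < ?r then (H * F) $$ (i, j) else (H * F') $$ (i, j - ?r))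
        else (if j < ?r then (H' * F) $$ (i - ?r, j) else (H' * F') $$ (i - ?r, j - ?r)))"
      using ij F F' H H' Q Q' by (auto simp: r c N_def)
    also have "\<dots> = 1\<^sub>m N $$ (i, j)"
      unfolding HF' H'F using ij fh by (auto simp: N_def)
    finally show "(Q' * Q) $$ (i, j) = 1\<^sub>m N $$ (i, j)" .
  qed (use Q Q' in auto)
  have Nn: "N = n"
    using right_inverse_dim_le[OF Q Q' QQ'] right_inverse_dim_le[OF Q' Q Q'Q] by simp
  then show "?r + ?s = n" unfolding N_def .
  have Q: "Q \<in> carrier_mat n n" and Q': "Q' \<in> carrier_mat n n" using Q Q' Nn by auto
  have "P = Q * proj_mat n ?r * Q'"
  proof (rule mat_eqI[of _ n n])
    fix i j assume ij: "i < n" "j < n"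
    have QE: "Q * proj_mat n ?r \<in> carrier_mat n n" using Q by auto
    have "(Q * proj_mat n ?r * Q') $$ (i, j) = (\<Sum>k<N. (if k < ?r then Q $$ (i, k) else 0) * Q' $$ (k, j))"
      unfolding mat_mult_index[OF QE Q' ij] Nn
      by (rule sum.cong) (use ij Q in \<open>auto simp: mult_proj_mat_index simp del: index_mult_mat(1)\<close>)
    also have "\<dots> = (\<Sum>k<?r. F $$ (i, k) * H $$ (k, j))"
      unfolding sum using ij by (auto simp: Q_def Q'_def N_def)
    also have "\<dots> = P $$ (i, j)" using mat_mult_index[OF F H ij] fh by simp
    finally show "P $$ (i, j) = (Q * proj_mat n ?r * Q') $$ (i, j)" by simp
  qed (use P Q Q' in auto)
  then show "\<exists>Q Q'. Q \<in> carrier_mat n n \<and> Q' \<in> carrier_mat n n \<and> Q * Q' = 1\<^sub>m n \<and> Q' * Q = 1\<^sub>m n \<and>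
      P = Q * proj_mat n ?r * Q'"
    using Q Q' QQ' Q'Q unfolding Nn by blast
qed

lemma conj_proj_mat_rank:
  fixes Q :: "'k::field mat"
  assumes Q: "Q \<in> carrier_mat n n" and Q': "Q' \<in> carrier_mat n n" and Q'Q: "Q' * Q = 1\<^sub>m n"
    and r: "r \<le> n"
  defines "P \<equiv> Q * proj_mat n r * Q'"
  shows "P \<in> carrier_mat n n" "P * P = P" "vec_space.rank n P = r"
proof -
  \<comment> \<open>\<open>J\<close> includes the first \<open>r\<close> coordinates and
    \<open>K\<close> projects onto them, which factors \<open>proj_mat n r\<close>.\<close>
  define J :: "'k mat" where "J = mat n r (\<lambda>(i, j). if i = j then 1 else 0)"
  define K :: "'k mat" where "K = mat r n (\<lambda>(i, j). if i = j then 1 else 0)"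
  have J: "J \<in> carrier_mat n r" and K: "K \<in> carrier_mat r n" unfolding J_def K_def by auto
  have JK: "J * K = proj_mat n r"
  proof (rule mat_eqI[of _ n n])
    fix i j assume ij: "i < n" "j < n"
    have "(J * K) $$ (i, j) = (\<Sum>l<r. if l = i then (if i = j then 1 else 0) else 0)"
      unfolding mat_mult_index[OF J K ij] by (rule sum.cong) (use ij r in \<open>auto simp: J_def K_def\<close>)
    then show "(J * K) $$ (i, j) = proj_mat n r $$ (i, j)" using ij by (simp add: proj_mat_def)
  qed (use J K in auto)
  have KJ: "K * J = 1\<^sub>m r"
  proof (rule mat_eqI[of _ r r])
    fix i j assume ij: "i < r" "j < r"
    have "(K * J) $$ (i, j) = (\<Sum>l<n. if l = i then (if i = j then 1 else 0) else 0)"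
      unfolding mat_mult_index[OF K J ij] by (rule sum.cong) (use ij r in \<open>auto simp: J_def K_def\<close>)
    then show "(K * J) $$ (i, j) = 1\<^sub>m r $$ (i, j)" using ij r by simp
  qed (use J K in auto)
  have "idem_factor n r P (Q * J) (K * Q')"
    unfolding idem_factor_def
  proof (intro conjI)
    show "Q * J \<in> carrier_mat n r" "K * Q' \<in> carrier_mat r n" using Q Q' J K by auto
    show "Q * J * (K * Q') = P"
      unfolding P_def JK[symmetric] by (rule assoc_mult_mat4[OF Q J K Q', symmetric])
    have "K * Q' * (Q * J) = K * (Q' * Q) * J"
      by (rule assoc_mult_mat4[OF K Q' Q J, symmetric])
    then show "K * Q' * (Q * J) = 1\<^sub>m r" unfolding Q'Q using K KJ by simp
  qed
  from idem_factor_carrier[OF this] idem_factor_idem[OF this] idem_factor_rank[OF this]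
  show "P \<in> carrier_mat n n" "P * P = P" "vec_space.rank n P = r" by auto
qed

section \<open>Polynomials in a matrix\<close>

lemma mat_minus_index:
  "A \<in> carrier_mat r c \<Longrightarrow> B \<in> carrier_mat r c \<Longrightarrow> i < r \<Longrightarrow> j < c \<Longrightarrow>
    (A - B) $$ (i, j) = A $$ (i, j) - B $$ (i, j)"
  by auto

lemma mat_add_index:
  "A \<in> carrier_mat r c \<Longrightarrow> B \<in> carrier_mat r c \<Longrightarrow> i < r \<Longrightarrow> j < c \<Longrightarrow>
    (A + B) $$ (i, j) = A $$ (i, j) + B $$ (i, j)"
  by auto

lemma mat_smult_index:
  "A \<in> carrier_mat r c \<Longrightarrow> i < r \<Longrightarrow> j < c \<Longrightarrow> (x \<cdot>\<^sub>m A) $$ (i, j) = x * A $$ (i, j)"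
  by auto

lemma mult_mat_zero_vec: "A \<in> carrier_mat r c \<Longrightarrow> A *\<^sub>v 0\<^sub>v c = 0\<^sub>v r"
  by (intro eq_vecI) auto

text \<open>Finite sums are taken entrywise because matrices of all sizes share one type, which has
  no single zero.\<close>

definition lincomb_mat ::
  "nat \<Rightarrow> nat \<Rightarrow> 's set \<Rightarrow> ('s \<Rightarrow> 'k::comm_ring_1) \<Rightarrow> ('s \<Rightarrow> 'k mat) \<Rightarrow> 'k mat" where
  "lincomb_mat r c I w F = mat r c (\<lambda>ij. \<Sum>s\<in>I. w s * F s $$ ij)"

lemma lincomb_mat_carrier [simp]: "lincomb_mat r c I w F \<in> carrier_mat r c"
  unfolding lincomb_mat_def by simp

lemma lincomb_mat_index:
  "i < r \<Longrightarrow> j < c \<Longrightarrow> lincomb_mat r c I w F $$ (i, j) = (\<Sum>s\<in>I. w s * F s $$ (i, j))"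
  unfolding lincomb_mat_def by simp

lemma mult_lincomb_mat:
  assumes X: "X \<in> carrier_mat q r" and F: "\<And>s. s \<in> I \<Longrightarrow> F s \<in> carrier_mat r c"
  shows "X * lincomb_mat r c I w F = lincomb_mat q c I w (\<lambda>s. X * F s)"
proof (rule mat_eqI[of _ q c])
  fix i j assume ij: "i < q" "j < c"
  have "(X * lincomb_mat r c I w F) $$ (i, j) = (\<Sum>l<r. \<Sum>s\<in>I. w s * (X $$ (i, l) * F s $$ (l, j)))"
    unfolding mat_mult_index[OF X lincomb_mat_carrier ij]
    by (rule sum.cong) (use ij in \<open>auto simp: lincomb_mat_index sum_distrib_left ac_simps\<close>)
  also have "\<dots> = (\<Sum>s\<in>I. w s * (\<Sum>l<r. X $$ (i, l) * F s $$ (l, j)))"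
    unfolding sum_distrib_left by (rule sum.swap)
  also have "\<dots> = (\<Sum>s\<in>I. w s * (X * F s) $$ (i, j))"
    by (rule sum.cong) (simp_all add: mat_mult_index[OF X F ij] del: index_mult_mat(1))
  finally show "(X * lincomb_mat r c I w F) $$ (i, j) = lincomb_mat q c I w (\<lambda>s. X * F s) $$ (i, j)"
    unfolding lincomb_mat_index[OF ij] .
qed (use X in \<open>auto intro: mult_carrier_mat[of _ q r]\<close>)

lemma lincomb_mat_mult:
  assumes X: "X \<in> carrier_mat c q" and F: "\<And>s. s \<in> I \<Longrightarrow> F s \<in> carrier_mat r c"
  shows "lincomb_mat r c I w F * X = lincomb_mat r q I w (\<lambda>s. F s * X)"
proof (rule mat_eqI[of _ r q])
  fix i j assume ij: "i < r" "j < q"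
  have "(lincomb_mat r c I w F * X) $$ (i, j) = (\<Sum>l<c. \<Sum>s\<in>I. w s * (F s $$ (i, l) * X $$ (l, j)))"
    unfolding mat_mult_index[OF lincomb_mat_carrier X ij]
    by (rule sum.cong) (use ij in \<open>auto simp: lincomb_mat_index sum_distrib_right mult.assoc\<close>)
  also have "\<dots> = (\<Sum>s\<in>I. w s * (\<Sum>l<c. F s $$ (i, l) * X $$ (l, j)))"
    unfolding sum_distrib_left by (rule sum.swap)
  also have "\<dots> = (\<Sum>s\<in>I. w s * (F s * X) $$ (i, j))"
    by (rule sum.cong) (simp_all add: mat_mult_index[OF F X ij] del: index_mult_mat(1))
  finally show "(lincomb_mat r c I w F * X) $$ (i, j) = lincomb_mat r q I w (\<lambda>s. F s * X) $$ (i, j)"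
    unfolding lincomb_mat_index[OF ij] .
qed (use X in \<open>auto intro: mult_carrier_mat[of _ r c]\<close>)

lemma lincomb_mat_cong:
  "(\<And>s. s \<in> I \<Longrightarrow> F s = G s) \<Longrightarrow> lincomb_mat r c I w F = lincomb_mat r c I w G"
  unfolding lincomb_mat_def by auto

lemma pow_mat_commute:
  assumes A: "A \<in> carrier_mat n n" and X: "X \<in> carrier_mat n n" and XA: "X * A = A * X"
  shows "X * A ^\<^sub>m k = A ^\<^sub>m k * X"
proof (induction k)
  case (Suc k)
  have Ak: "A ^\<^sub>m k \<in> carrier_mat n n" using A by simp
  have "X * (A ^\<^sub>m k * A) = X * A ^\<^sub>m k * A" by (rule assoc_mult_mat[OF X Ak A, symmetric])
  also have "\<dots> = A ^\<^sub>m k * (X * A)" unfolding Suc by (rule assoc_mult_mat[OF Ak X A])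
  also have "\<dots> = A ^\<^sub>m k * A * X" unfolding XA by (rule assoc_mult_mat[OF Ak A X, symmetric])
  finally show ?case by simp
qed (use A X in simp)

lemma pow_mat_Suc_left: "A \<in> carrier_mat n n \<Longrightarrow> A ^\<^sub>m Suc k = A * A ^\<^sub>m k"
  using pow_mat_commute[of A n A k] by simp

lemma pow_mat_add:
  assumes A: "A \<in> carrier_mat n n"
  shows "A ^\<^sub>m (k + l) = A ^\<^sub>m k * A ^\<^sub>m l"
proof (induction l)
  case (Suc l)
  have "A ^\<^sub>m (k + Suc l) = A ^\<^sub>m k * A ^\<^sub>m l * A" using Suc by simp
  also have "\<dots> = A ^\<^sub>m k * (A ^\<^sub>m l * A)" by (rule assoc_mult_mat) (use A in auto)
  finally show ?case by simp
qed (use A right_mult_one_mat[of "A ^\<^sub>m k" n n] in simp)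

text \<open>The adjugate argument: comparing coefficients of \<open>X^k\<close> in
  \<open>adj(X - A) (X - A) = char_poly A\<close> gives \<open>c_k = B_k - B_{k+1} A\<close>, where
  \<open>B_k\<close> is the coefficient of \<open>X^{k-1}\<close> in the adjugate. After
  multiplication by \<open>A^k\<close> on the right the sum telescopes.\<close>

lemma cayley_hamilton:
  fixes A :: "'k::field mat"
  assumes A: "A \<in> carrier_mat m m"
  shows "lincomb_mat m m {..m} (coeff (char_poly A)) (\<lambda>s. A ^\<^sub>m s) = 0\<^sub>m m m"
proof -
  let ?M = "char_poly_matrix A"
  let ?c = "coeff (char_poly A)"
  define J where "J = adj_mat ?M"
  have M: "?M \<in> carrier_mat m m" using A by simp
  have J: "J \<in> carrier_mat m m" and JM: "J * ?M = char_poly A \<cdot>\<^sub>m 1\<^sub>m m"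
    unfolding J_def char_poly_def using adj_mat[OF M] by auto
  \<comment> \<open>The shift by one absorbs the multiplication by \<open>X\<close>, and
    \<open>B 0 = 0\<close> makes one end of the telescope vanish.\<close>
  define B where "B k = (if k = 0 then 0\<^sub>m m m else map_mat (\<lambda>p. coeff p (k - 1)) J)" for k
  have B: "B k \<in> carrier_mat m m" for k unfolding B_def using J by simp
  have BA: "B k * A \<in> carrier_mat m m" for k by (rule mult_carrier_mat[OF B A])
  have rec: "?c k \<cdot>\<^sub>m 1\<^sub>m m = B k - B (Suc k) * A" for k
  proof (rule mat_eqI[of _ m m])
    show "B k - B (Suc k) * A \<in> carrier_mat m m" using BA by (rule minus_carrier_mat)
    fix i j assume ij: "i < m" "j < m"
    have "(J * ?M) $$ (i, j) = (\<Sum>l<m. J $$ (i, l) * ?M $$ (l, j))"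
      by (rule mat_mult_index[OF J M ij])
    also have "\<dots> = (\<Sum>l<m. (if l = j then pCons 0 (J $$ (i, j)) else 0) - smult (A $$ (l, j)) (J $$ (i, l)))"
      by (rule sum.cong) (use ij A in \<open>auto simp: char_poly_matrix_def\<close>)
    also have "\<dots> = pCons 0 (J $$ (i, j)) - (\<Sum>l<m. smult (A $$ (l, j)) (J $$ (i, l)))"
      using ij by (simp add: sum_subtractf)
    finally have "coeff ((J * ?M) $$ (i, j)) k
        = coeff (pCons 0 (J $$ (i, j))) k - (\<Sum>l<m. A $$ (l, j) * coeff (J $$ (i, l)) k)"
      by (simp add: coeff_sum)
    also have "coeff (pCons 0 (J $$ (i, j))) k = B k $$ (i, j)"
      unfolding B_def using ij J by (cases k) auto
    also have "(\<Sum>l<m. A $$ (l, j) * coeff (J $$ (i, l)) k) = (B (Suc k) * A) $$ (i, j)"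
      unfolding mat_mult_index[OF B A ij] using ij J by (auto simp: B_def ac_simps intro!: sum.cong)
    finally have "coeff ((J * ?M) $$ (i, j)) k = (B k - B (Suc k) * A) $$ (i, j)"
      using ij A carrier_matD[OF B[of "Suc k"]] by (simp del: index_mult_mat(1))
    then show "(?c k \<cdot>\<^sub>m 1\<^sub>m m) $$ (i, j) = (B k - B (Suc k) * A) $$ (i, j)"
      unfolding JM using ij by (cases "i = j") (simp_all del: index_mult_mat(1) index_minus_mat)
  qed simp
  have step: "?c k * (A ^\<^sub>m k) $$ (i, j) = (B k * A ^\<^sub>m k) $$ (i, j) - (B (Suc k) * A ^\<^sub>m Suc k) $$ (i, j)"
    if ij: "i < m" "j < m" for i j k
  proof -
    have Ak: "A ^\<^sub>m k \<in> carrier_mat m m" using A by simp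
    have "?c k \<cdot>\<^sub>m A ^\<^sub>m k = ?c k \<cdot>\<^sub>m 1\<^sub>m m * A ^\<^sub>m k"
      using mult_smult_assoc_mat[OF one_carrier_mat Ak, of "?c k"] left_mult_one_mat[OF Ak] by simp
    also have "\<dots> = B k * A ^\<^sub>m k - B (Suc k) * A * A ^\<^sub>m k"
      unfolding rec by (rule minus_mult_distrib_mat[OF B BA Ak])
    also have "B (Suc k) * A * A ^\<^sub>m k = B (Suc k) * A ^\<^sub>m Suc k"
      unfolding pow_mat_Suc_left[OF A] by (rule assoc_mult_mat[OF B A Ak])
    finally have "(?c k \<cdot>\<^sub>m A ^\<^sub>m k) $$ (i, j) = (B k * A ^\<^sub>m k - B (Suc k) * A ^\<^sub>m Suc k) $$ (i, j)"
      by simp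
    moreover have "B (Suc k) * A ^\<^sub>m Suc k \<in> carrier_mat m m"
      using B pow_carrier_mat[OF A] mult_carrier_mat by blast
    ultimately show ?thesis
      using mat_smult_index[OF Ak ij] mat_minus_index[OF mult_carrier_mat[OF B Ak] _ ij] by simp
  qed
  define d where "d = (\<Sum>(i, l)\<in>{..<m} \<times> {..<m}. degree (J $$ (i, l)))"
  \<comment> \<open>Exceeds the degree \<open>m\<close> of the characteristic polynomial and, even
    after the shift by one, all degrees in the adjugate.\<close>
  define K where "K = m + d + 2"
  have BK: "B K = 0\<^sub>m m m"
  proof (rule mat_eqI[of _ m m])
    fix i j assume ij: "i < m" "j < m"
    have "degree (J $$ (i, j)) \<le> d"
      unfolding d_def
      using member_le_sum[of "(i, j)" "{..<m} \<times> {..<m}" "\<lambda>(i, l). degree (J $$ (i, l))"] ij by auto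
    then have "coeff (J $$ (i, j)) (K - 1) = 0" unfolding K_def by (intro coeff_eq_0) simp
    then show "B K $$ (i, j) = 0\<^sub>m m m $$ (i, j)" unfolding B_def using ij J by simp
  qed (use B in auto)
  show ?thesis
  proof (rule mat_eqI[of _ m m])
    fix i j assume ij: "i < m" "j < m"
    have "(\<Sum>s\<le>m. ?c s * (A ^\<^sub>m s) $$ (i, j)) = (\<Sum>s<K. ?c s * (A ^\<^sub>m s) $$ (i, j))"
      by (rule sum.mono_neutral_left)
        (use degree_monic_char_poly[OF A] in \<open>auto simp: K_def coeff_eq_0\<close>)
    also have "\<dots> = (\<Sum>s<K. (B s * A ^\<^sub>m s) $$ (i, j) - (B (Suc s) * A ^\<^sub>m Suc s) $$ (i, j))"
      by (rule sum.cong[OF refl]) (rule step[OF ij])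
    also have "\<dots> = (B 0 * A ^\<^sub>m 0) $$ (i, j) - (B K * A ^\<^sub>m K) $$ (i, j)"
      by (rule sum_lessThan_telescope')
    also have "\<dots> = 0"
      unfolding BK using ij left_mult_zero_mat[OF pow_carrier_mat[OF A]]
      by (simp add: B_def del: index_mult_mat(1) pow_mat.simps)
    finally show "lincomb_mat m m {..m} ?c (\<lambda>s. A ^\<^sub>m s) $$ (i, j) = 0\<^sub>m m m $$ (i, j)"
      using ij by (simp add: lincomb_mat_index)
  qed auto
qed

text \<open>Solving the Cayley-Hamilton relation for its lowest nonzero term expresses
  \<open>N^a\<close> through higher powers. As \<open>S\<close> is a combination of powers of
  \<open>N\<close>, it commutes with everything that commutes with \<open>N\<close>.\<close>

lemma pow_mat_stabilizes:
  fixes N :: "'k::field mat"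
  assumes N: "N \<in> carrier_mat n n"
  shows "\<exists>a S. S \<in> carrier_mat n n \<and> N ^\<^sub>m a = N ^\<^sub>m Suc a * S \<and>
    (\<forall>X\<in>carrier_mat n n. X * N = N * X \<longrightarrow> X * S = S * X)"
proof -
  define c where "c = coeff (char_poly N)"
  have cn: "c n \<noteq> 0" unfolding c_def using degree_monic_char_poly[OF N] by simp
  define a where "a = (LEAST s. c s \<noteq> 0)"
  have ca: "c a \<noteq> 0" unfolding a_def by (rule LeastI[of _ n]) (rule cn)
  have an: "a \<le> n" unfolding a_def by (rule Least_le) (rule cn)
  have below: "c s = 0" if "s < a" for s using not_less_Least[of s "\<lambda>s. c s \<noteq> 0"] that unfolding a_def by simp
  define S where "S = lincomb_mat n n {Suc a..n} (\<lambda>s. - c s / c a) (\<lambda>s. N ^\<^sub>m (s - Suc a))"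
  have "N ^\<^sub>m Suc a * S = lincomb_mat n n {Suc a..n} (\<lambda>s. - c s / c a) (\<lambda>s. N ^\<^sub>m Suc a * N ^\<^sub>m (s - Suc a))"
    unfolding S_def by (rule mult_lincomb_mat) (use N pow_carrier_mat in blast)+
  also have "\<dots> = lincomb_mat n n {Suc a..n} (\<lambda>s. - c s / c a) (\<lambda>s. N ^\<^sub>m s)"
    by (rule lincomb_mat_cong) (simp add: pow_mat_add[OF N, symmetric] del: pow_mat.simps)
  also have "\<dots> = N ^\<^sub>m a"
  proof (rule mat_eqI[of _ n n])
    fix i j assume ij: "i < n" "j < n"
    have "0 = (\<Sum>s\<le>n. c s * (N ^\<^sub>m s) $$ (i, j))"
      using arg_cong[OF cayley_hamilton[OF N], of "\<lambda>M. M $$ (i, j)"] ij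
      by (simp add: lincomb_mat_index c_def)
    also have "\<dots> = (\<Sum>s\<in>{a..n}. c s * (N ^\<^sub>m s) $$ (i, j))"
      by (rule sum.mono_neutral_right) (use below in \<open>auto simp: not_le\<close>)
    also have "\<dots> = c a * (N ^\<^sub>m a) $$ (i, j) + (\<Sum>s\<in>{Suc a..n}. c s * (N ^\<^sub>m s) $$ (i, j))"
      by (rule sum.atLeast_Suc_atMost[OF an])
    finally have "(\<Sum>s\<in>{Suc a..n}. c s * (N ^\<^sub>m s) $$ (i, j)) = - (c a * (N ^\<^sub>m a) $$ (i, j))"
      by (simp add: eq_neg_iff_add_eq_0 add.commute)
    then have "(\<Sum>s\<in>{Suc a..n}. - c s / c a * (N ^\<^sub>m s) $$ (i, j)) = (N ^\<^sub>m a) $$ (i, j)"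
      using ca by (simp add: sum_divide_distrib[symmetric] sum_negf)
    then show "lincomb_mat n n {Suc a..n} (\<lambda>s. - c s / c a) (\<lambda>s. N ^\<^sub>m s) $$ (i, j) = (N ^\<^sub>m a) $$ (i, j)"
      unfolding lincomb_mat_index[OF ij] .
  qed (use N in auto)
  finally have "N ^\<^sub>m a = N ^\<^sub>m Suc a * S" ..
  moreover have "X * S = S * X" if X: "X \<in> carrier_mat n n" and XN: "X * N = N * X" for X
  proof -
    have Ns: "\<And>s. N ^\<^sub>m s \<in> carrier_mat n n" using N by simp
    show ?thesis
      unfolding S_def mult_lincomb_mat[OF X Ns] lincomb_mat_mult[OF X Ns]
      by (rule lincomb_mat_cong) (rule pow_mat_commute[OF N X XN])
  qed
  moreover have "S \<in> carrier_mat n n" unfolding S_def by simp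
  ultimately show ?thesis by blast
qed

text \<open>Iterating \<open>N^a = N^(a+1) S\<close> doubles the exponent. The relation obtained
  makes \<open>N^a T\<close> the Fitting idempotent, the projection onto the part where
  \<open>N\<close> is invertible.\<close>

lemma fitting_idempotent:
  fixes N :: "'k::field mat"
  assumes N: "N \<in> carrier_mat n n"
  shows "\<exists>a T. 0 < a \<and> T \<in> carrier_mat n n \<and> N ^\<^sub>m a = N ^\<^sub>m a * N ^\<^sub>m a * T \<and>
    (\<forall>X\<in>carrier_mat n n. X * N = N * X \<longrightarrow> X * T = T * X)"
proof -
  obtain a S where S: "S \<in> carrier_mat n n" and aS: "N ^\<^sub>m a = N ^\<^sub>m Suc a * S"
    and com: "\<And>X. X \<in> carrier_mat n n \<Longrightarrow> X * N = N * X \<Longrightarrow> X * S = S * X"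
    using pow_mat_stabilizes[OF N] by blast
  have Np: "N ^\<^sub>m k \<in> carrier_mat n n" "S ^\<^sub>m k \<in> carrier_mat n n" for k using N S by auto
  have iter: "N ^\<^sub>m a = N ^\<^sub>m (a + k) * S ^\<^sub>m k" for k
  proof (induction k)
    case (Suc k)
    have "N ^\<^sub>m (a + k) = N ^\<^sub>m k * N ^\<^sub>m a"
      using pow_mat_add[OF N, of k a] by (simp add: add.commute)
    also have "\<dots> = N ^\<^sub>m k * N ^\<^sub>m Suc a * S"
      unfolding aS by (rule assoc_mult_mat[OF Np(1) Np(1) S, symmetric])
    also have "N ^\<^sub>m k * N ^\<^sub>m Suc a = N ^\<^sub>m (a + Suc k)"
      unfolding pow_mat_add[OF N, symmetric] by (simp add: add.commute)
    finally have "N ^\<^sub>m (a + k) * S ^\<^sub>m k = N ^\<^sub>m (a + Suc k) * S * S ^\<^sub>m k"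
      by (rule arg_cong[where f = "\<lambda>M. M * S ^\<^sub>m k"])
    also have "\<dots> = N ^\<^sub>m (a + Suc k) * (S * S ^\<^sub>m k)" by (rule assoc_mult_mat[OF Np(1) S Np(2)])
    finally have "N ^\<^sub>m (a + k) * S ^\<^sub>m k = N ^\<^sub>m (a + Suc k) * (S * S ^\<^sub>m k)" .
    then show ?case using Suc pow_mat_Suc_left[OF S, of k] by simp
  qed (use Np(1) S N in simp)
  \<comment> \<open>One more than \<open>a\<close>, so that the exponent is positive even when
    \<open>a = 0\<close>; a positive power annihilates the kernel of \<open>N\<close>, which is used
    to see that the idempotent is not \<open>1\<close>.\<close>
  let ?b = "Suc a"
  define T where "T = S ^\<^sub>m ?b"
  have T: "T \<in> carrier_mat n n" unfolding T_def by (rule Np)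
  have "N ^\<^sub>m ?b = N * N ^\<^sub>m a" by (rule pow_mat_Suc_left[OF N])
  also have "N ^\<^sub>m a = N ^\<^sub>m (a + ?b) * T" unfolding T_def by (rule iter)
  also have "N * (N ^\<^sub>m (a + ?b) * T) = N * N ^\<^sub>m (a + ?b) * T"
    by (rule assoc_mult_mat[OF N Np(1) T, symmetric])
  also have "N * N ^\<^sub>m (a + ?b) = N ^\<^sub>m ?b * N ^\<^sub>m ?b"
    unfolding pow_mat_Suc_left[OF N, symmetric] pow_mat_add[OF N, symmetric] by simp
  finally have "N ^\<^sub>m ?b = N ^\<^sub>m ?b * N ^\<^sub>m ?b * T" .
  moreover have "X * T = T * X" if "X \<in> carrier_mat n n" "X * N = N * X" for X
    unfolding T_def by (rule pow_mat_commute[OF S that(1) com[OF that]])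
  ultimately show ?thesis using T by blast
qed

text \<open>Subtracting an eigenvalue makes \<open>N = C - k\<close> singular but nonzero, so its
  Fitting idempotent is not \<open>1\<close>. If it is \<open>0\<close>, then \<open>N\<close> is
  nilpotent and its last nonzero power has square zero. Both candidates for \<open>E\<close> inherit
  commutation from \<open>C\<close>.\<close>

lemma nonscalar_commutant:
  fixes C :: "'k::alg_closed_field mat"
  assumes C: "C \<in> carrier_mat n n" and ns: "\<not> scalar_matrix n C" and n: "0 < n"
  shows "\<exists>E\<in>carrier_mat n n. (\<forall>X\<in>carrier_mat n n. X * C = C * X \<longrightarrow> X * E = E * X) \<and>
    E \<noteq> 0\<^sub>m n n \<and> (E * E = 0\<^sub>m n n \<or> E * E = E \<and> E \<noteq> 1\<^sub>m n)"
proof -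
  have "degree (char_poly C) > 0" using degree_monic_char_poly[OF C] n by simp
  then obtain k where "poly (char_poly C) k = 0" using alg_closed_imp_poly_has_root by blast
  then have "eigenvalue C k" using eigenvalue_root_char_poly[OF C] by simp
  then obtain v where v: "v \<in> carrier_vec n" "v \<noteq> 0\<^sub>v n" "C *\<^sub>v v = k \<cdot>\<^sub>v v"
    unfolding eigenvalue_def eigenvector_def using C by auto
  define N where "N = C - k \<cdot>\<^sub>m 1\<^sub>m n"
  have k1: "k \<cdot>\<^sub>m 1\<^sub>m n \<in> carrier_mat n n" by simp
  have N: "N \<in> carrier_mat n n" unfolding N_def by (rule minus_carrier_mat) simp
  have Nv: "N *\<^sub>v v = 0\<^sub>v n"
  proof -
    have "k \<cdot>\<^sub>m 1\<^sub>m n *\<^sub>v v = k \<cdot>\<^sub>v v"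
    proof (rule eq_vecI)
      fix i assume "i < dim_vec (k \<cdot>\<^sub>v v)"
      then have i: "i < n" using v(1) by simp
      have "(k \<cdot>\<^sub>m 1\<^sub>m n *\<^sub>v v) $ i = (\<Sum>l=0..<n. k * (if l = i then 1 else 0) * v $ l)"
        using i v(1) by (simp add: scalar_prod_def)
      also have "\<dots> = (\<Sum>l=0..<n. if l = i then k * v $ i else 0)"
        by (rule sum.cong) auto
      finally have "(k \<cdot>\<^sub>m 1\<^sub>m n *\<^sub>v v) $ i = (\<Sum>l=0..<n. if l = i then k * v $ i else 0)" .
      then show "(k \<cdot>\<^sub>m 1\<^sub>m n *\<^sub>v v) $ i = (k \<cdot>\<^sub>v v) $ i" using i v(1) by simp
    qed (use v(1) in simp)
    then show ?thesis unfolding N_def minus_mult_distrib_mat_vec[OF C k1 v(1)] v(3) using v(1) by simp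
  qed
  have XN: "X * N = N * X" if X: "X \<in> carrier_mat n n" "X * C = C * X" for X
    unfolding N_def mult_minus_distrib_mat[OF X(1) C k1] minus_mult_distrib_mat[OF C k1 X(1)] X(2)
    using mult_smult_distrib[OF X(1) one_carrier_mat, of k] mult_smult_assoc_mat[OF one_carrier_mat X(1), of k] X(1)
    by simp
  have N0: "N \<noteq> 0\<^sub>m n n"
  proof
    assume "N = 0\<^sub>m n n"
    have "C = k \<cdot>\<^sub>m 1\<^sub>m n"
    proof (rule mat_eqI[OF C k1])
      fix i j assume ij: "i < n" "j < n"
      have "N $$ (i, j) = 0" unfolding \<open>N = 0\<^sub>m n n\<close> using ij by simp
      then show "C $$ (i, j) = (k \<cdot>\<^sub>m 1\<^sub>m n) $$ (i, j)" unfolding N_def using C ij by simp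
    qed
    with ns show False unfolding scalar_matrix_def by blast
  qed
  obtain a T where a: "0 < a" and T: "T \<in> carrier_mat n n" and NaT: "N ^\<^sub>m a = N ^\<^sub>m a * N ^\<^sub>m a * T"
    and com: "\<And>X. X \<in> carrier_mat n n \<Longrightarrow> X * N = N * X \<Longrightarrow> X * T = T * X"
    using fitting_idempotent[OF N] by blast
  have Np: "N ^\<^sub>m k \<in> carrier_mat n n" for k using N by simp
  let ?e = "N ^\<^sub>m a * T"
  have e: "?e \<in> carrier_mat n n" by (rule mult_carrier_mat[OF Np T])
  have NT: "N ^\<^sub>m a * T = T * N ^\<^sub>m a"
    by (rule com[OF Np]) (simp add: pow_mat_commute[OF N N, symmetric])
  have ee: "?e * ?e = ?e"
  proof -
    have "?e * ?e = N ^\<^sub>m a * T * (T * N ^\<^sub>m a)" using NT by simp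
    also have "\<dots> = T * N ^\<^sub>m a * (N ^\<^sub>m a * T)" unfolding NT by (simp add: NT)
    also have "\<dots> = T * (N ^\<^sub>m a * N ^\<^sub>m a * T)"
      using assoc_mult_mat[OF T Np e, of a] assoc_mult_mat[OF Np Np T, of a a] by simp
    finally show ?thesis unfolding NaT[symmetric] NT .
  qed
  have Nea: "N ^\<^sub>m a = N ^\<^sub>m a * ?e"
    using NaT assoc_mult_mat[OF Np Np T, of a a] by simp
  have comp: "X * ?e = ?e * X" if X: "X \<in> carrier_mat n n" "X * C = C * X" for X
  proof -
    have "X * ?e = N ^\<^sub>m a * X * T"
      using assoc_mult_mat[OF X(1) Np T, of a] pow_mat_commute[OF N X(1) XN[OF X], of a] by simp
    also have "\<dots> = N ^\<^sub>m a * (T * X)"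
      using assoc_mult_mat[OF Np X(1) T, of a] com[OF X(1) XN[OF X]] by simp
    finally show ?thesis using assoc_mult_mat[OF Np T X(1), of a] by simp
  qed
  show ?thesis
  proof (cases "?e = 0\<^sub>m n n")
    case False
    \<comment> \<open>A positive power of \<open>N\<close> kills the eigenvector \<open>v\<close>,
      which the identity would fix.\<close>
    have "?e \<noteq> 1\<^sub>m n"
    proof
      assume e1: "?e = 1\<^sub>m n"
      obtain b where b: "a = Suc b" using a by (cases a) auto
      have "N ^\<^sub>m a *\<^sub>v v = 0\<^sub>v n"
        unfolding b using assoc_mult_mat_vec[OF Np N v(1), of b] Nv mult_mat_zero_vec[OF Np] by simp
      then have "(T * N ^\<^sub>m a) *\<^sub>v v = 0\<^sub>v n"
        using assoc_mult_mat_vec[OF T Np v(1), of a] mult_mat_zero_vec[OF T] by simp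
      then have "1\<^sub>m n *\<^sub>v v = 0\<^sub>v n" unfolding NT[symmetric] e1 .
      then have "v = 0\<^sub>v n" using v(1) by simp
      with v(2) show False by simp
    qed
    with False e ee comp show ?thesis by (intro bexI[of _ ?e]) auto
  next
    case True
    then have Na: "N ^\<^sub>m a = 0\<^sub>m n n" using Nea right_mult_zero_mat[OF Np] by simp
    define k where "k = (LEAST k. N ^\<^sub>m k = 0\<^sub>m n n)"
    have k: "N ^\<^sub>m k = 0\<^sub>m n n" unfolding k_def by (rule LeastI[of _ a]) (rule Na)
    have below: "N ^\<^sub>m j \<noteq> 0\<^sub>m n n" if "j < k" for j using that not_less_Least unfolding k_def by blast
    have "k \<noteq> 0"
    proof
      assume "k = 0"
      then have "1\<^sub>m n = (0\<^sub>m n n :: 'k mat)" using k N by simp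
      then have "(1\<^sub>m n :: 'k mat) $$ (0, 0) = 0\<^sub>m n n $$ (0, 0)" by simp
      then show False using n by simp
    qed
    moreover have "k \<noteq> 1" using k N0 N by auto
    \<comment> \<open>The last nonzero power is \<open>E = N^(j+1)\<close>, and
      \<open>E^2 = N^(2j+2) = N^(k+j)\<close> contains the factor \<open>N^k = 0\<close>.\<close>
    ultimately obtain j where j: "k = Suc (Suc j)" by (metis One_nat_def not0_implies_Suc)
    let ?E = "N ^\<^sub>m Suc j"
    have "?E * ?E = N ^\<^sub>m (k + j)" unfolding pow_mat_add[OF N, symmetric] j by simp
    also have "\<dots> = 0\<^sub>m n n" unfolding pow_mat_add[OF N] k by (rule left_mult_zero_mat[OF Np])
    finally have "?E * ?E = 0\<^sub>m n n" .
    moreover have "?E \<noteq> 0\<^sub>m n n" using below[of "Suc j"] j by simp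
    moreover have "X * ?E = ?E * X" if "X \<in> carrier_mat n n" "X * C = C * X" for X
      by (rule pow_mat_commute[OF N that(1) XN[OF that]])
    ultimately show ?thesis using Np by blast
  qed
qed

section \<open>Commuting distance at most two\<close>

lemma scalar_matrix_commute:
  "scalar_matrix n A \<Longrightarrow> C \<in> carrier_mat n n \<Longrightarrow> A * C = C * A"
  unfolding scalar_matrix_def
  using mult_smult_assoc_mat[of "1\<^sub>m n" n n C n] mult_smult_distrib[of C n n "1\<^sub>m n" n] by auto

lemma nonscalar_exists:
  assumes "n \<ge> 2"
  shows "\<exists>C\<in>carrier_mat n n. \<not> scalar_matrix n (C :: 'k::field mat)"
proof -
  define C :: "'k mat" where "C = mat n n (\<lambda>(i, j). if i = 0 \<and> j = 1 then 1 else 0)"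
  have "\<not> scalar_matrix n C"
  proof
    assume "scalar_matrix n C"
    then obtain k where "C = k \<cdot>\<^sub>m 1\<^sub>m n" unfolding scalar_matrix_def by blast
    from arg_cong[OF this, of "\<lambda>M. M $$ (0, 1)"] show False using assms by (simp add: C_def)
  qed
  then show ?thesis unfolding C_def by (intro bexI[of _ C]) (auto simp: C_def)
qed

lemma commuting_graph_dist_le_2:
  "commuting_graph_dist n A B \<le> 2 \<longleftrightarrow> (\<exists>m\<le>2. (A, B) \<in> commuting_graph_edges n ^^ m)"
proof
  assume le: "commuting_graph_dist n A B \<le> 2"
  show "\<exists>m\<le>2. (A, B) \<in> commuting_graph_edges n ^^ m"
  proof (rule ccontr)
    assume "\<not> ?thesis"
    then have "enat 3 \<le> enat m" if "(A, B) \<in> commuting_graph_edges n ^^ m" for m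
      using that by (metis enat_ord_simps(1) not_less_eq_eq numeral_2_eq_2 numeral_3_eq_3)
    then have "enat 3 \<le> commuting_graph_dist n A B"
      unfolding commuting_graph_dist_def by (intro INF_greatest) auto
    from order_trans[OF this le] have "enat 3 \<le> 2" .
    then show False by (simp add: numeral_eq_enat)
  qed
next
  assume "\<exists>m\<le>2. (A, B) \<in> commuting_graph_edges n ^^ m"
  then obtain m where m: "m \<le> 2" "(A, B) \<in> commuting_graph_edges n ^^ m" by blast
  have "commuting_graph_dist n A B \<le> enat m"
    unfolding commuting_graph_dist_def using m(2) by (intro INF_lower) simp
  also have "enat m \<le> 2" using m(1) by (simp add: numeral_eq_enat)
  finally show "commuting_graph_dist n A B \<le> 2" .
qed

text \<open>Scalar arguments and distances below two are covered by taking \<open>C\<close> to be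
  \<open>A\<close> or \<open>B\<close>, or any nonscalar matrix if both are scalar. Conversely, for
  nonscalar \<open>A\<close> and \<open>B\<close> that do not commute, \<open>C\<close> differs from
  both and is the middle vertex of a walk.\<close>

lemma commuting_C2_iff:
  assumes n: "n \<ge> 2"
  shows "(A, B) \<in> commuting_C2 n \<longleftrightarrow> A \<in> carrier_mat n n \<and> B \<in> carrier_mat n n \<and>
    (\<exists>C\<in>carrier_mat n n. \<not> scalar_matrix n C \<and> A * C = C * A \<and> B * C = C * B)"
proof (cases "A \<in> carrier_mat n n \<and> B \<in> carrier_mat n n")
  case False
  then show ?thesis unfolding commuting_C2_def mat_pairs_def by auto
next
  case True
  then have A: "A \<in> carrier_mat n n" and B: "B \<in> carrier_mat n n" by auto
  let ?Q = "\<exists>C\<in>carrier_mat n n. \<not> scalar_matrix n C \<and> A * C = C * A \<and> B * C = C * B"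
  have "commuting_dist n A B \<le> 2 \<longleftrightarrow> ?Q"
  proof (cases "scalar_matrix n A \<or> scalar_matrix n B \<or> A = B")
    case True
    have "?Q"
    proof (cases "scalar_matrix n A")
      case sA: True
      show ?thesis
      proof (cases "scalar_matrix n B")
        case True
        then show ?thesis using nonscalar_exists[OF n] scalar_matrix_commute sA by metis
      next
        case False
        then show ?thesis using B scalar_matrix_commute[OF sA B] by blast
      qed
    next
      case False
      moreover have "B * A = A * B" using True False scalar_matrix_commute[of n B A] A by auto
      ultimately show ?thesis using A by blast
    qed
    moreover have "commuting_dist n A B \<le> 2"
      using True unfolding commuting_dist_def by (auto simp: numeral_eq_enat one_enat_def)
    ultimately show ?thesis by blast
  next
    case False
    then have V: "A \<in> commuting_graph_vertices n" "B \<in> commuting_graph_vertices n"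
      using A B unfolding commuting_graph_vertices_def by auto
    have "commuting_dist n A B \<le> 2 \<longleftrightarrow> (\<exists>m\<le>2. (A, B) \<in> commuting_graph_edges n ^^ m)"
      using False commuting_graph_dist_le_2 unfolding commuting_dist_def by auto
    also have "\<dots> \<longleftrightarrow> ?Q"
    proof
      assume "\<exists>m\<le>2. (A, B) \<in> commuting_graph_edges n ^^ m"
      then obtain m where m: "m \<le> 2" "(A, B) \<in> commuting_graph_edges n ^^ m" by blast
      then consider "m = 0" | "m = 1" | "m = 2" by linarith
      then show ?Q
      proof cases
        case 1
        then show ?thesis using m False by auto
      next
        case 2
        then have "A * B = B * A" using m unfolding commuting_graph_edges_def by auto
        then show ?thesis using A False by (intro bexI[of _ A]) auto
      next
        case 3
        then obtain C where "(A, C) \<in> commuting_graph_edges n" "(C, B) \<in> commuting_graph_edges n"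
          using m by (auto simp: numeral_2_eq_2)
        then show ?thesis
          unfolding commuting_graph_edges_def commuting_graph_vertices_def by auto
      qed
    next
      assume ?Q
      then obtain C where C: "C \<in> carrier_mat n n" "\<not> scalar_matrix n C" "A * C = C * A" "B * C = C * B"
        by blast
      show "\<exists>m\<le>2. (A, B) \<in> commuting_graph_edges n ^^ m"
      proof (cases "A * B = B * A")
        case True
        then have "(A, B) \<in> commuting_graph_edges n ^^ 1"
          using V False unfolding commuting_graph_edges_def by auto
        then show ?thesis by (intro exI[of _ 1]) simp
      next
        case nAB: False
        then have "C \<noteq> A" "C \<noteq> B" using C by auto
        then have "(A, C) \<in> commuting_graph_edges n" "(C, B) \<in> commuting_graph_edges n"
          using C V unfolding commuting_graph_edges_def commuting_graph_vertices_def by auto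
        then have "(A, B) \<in> commuting_graph_edges n ^^ 2" by (auto simp: numeral_2_eq_2)
        then show ?thesis by blast
      qed
    qed
    finally show ?thesis .
  qed
  then show ?thesis using True unfolding commuting_C2_def mat_pairs_def by auto
qed

section \<open>Elementary properties of the sets Z_i and ranks of idempotents\<close>

lemma commuting_Z_subset: "commuting_Z n i \<subseteq> mat_pairs n"
  unfolding commuting_Z_def by auto

lemma commuting_ZI:
  "A \<in> carrier_mat n n \<Longrightarrow> B \<in> carrier_mat n n \<Longrightarrow> P \<in> carrier_mat n n \<Longrightarrow> P * P = P \<Longrightarrow>
    vec_space.rank n P = i \<Longrightarrow> A * P = P * A \<Longrightarrow> B * P = P * B \<Longrightarrow> (A, B) \<in> commuting_Z n i"
  unfolding commuting_Z_def mat_pairs_def by auto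

lemma commuting_ZE:
  assumes "X \<in> commuting_Z n i"
  obtains A B P where "X = (A, B)" "A \<in> carrier_mat n n" "B \<in> carrier_mat n n" "P \<in> carrier_mat n n"
    "P * P = P" "vec_space.rank n P = i" "A * P = P * A" "B * P = P * B"
  using assms unfolding commuting_Z_def mat_pairs_def by auto

lemma commuting_Z_sym: "commuting_Z n i \<subseteq> commuting_Z n (n - i)"
proof
  fix X :: "'k::field mat_pair" assume "X \<in> commuting_Z n i"
  then obtain A B P where X: "X = (A, B)" and A: "A \<in> carrier_mat n n" and B: "B \<in> carrier_mat n n"
    and P: "P \<in> carrier_mat n n" "P * P = P" "vec_space.rank n P = i" "A * P = P * A" "B * P = P * B"
    by (rule commuting_ZE)
  note * = complement_idempotent[OF P(1,2)]
  have "vec_space.rank n (1\<^sub>m n - P) = n - i"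
    using idempotent_diagonal(1)[OF P(1,2)] P(3) by simp
  then show "X \<in> commuting_Z n (n - i)"
    unfolding X using A B * P(4,5) by (intro commuting_ZI[of _ _ _ "1\<^sub>m n - P"]) auto
qed

lemma idempotent_rank_0:
  assumes "P \<in> carrier_mat n n" "P * P = (P :: 'k::field mat)" "vec_space.rank n P = 0"
  shows "P = 0\<^sub>m n n"
proof -
  obtain F H where "idem_factor n 0 P F H" using idempotent_factor[OF assms(1,2)] assms(3) by auto
  then show ?thesis unfolding idem_factor_def
    by (intro eq_matI) (auto simp: scalar_prod_def)
qed

lemma idempotent_rank_bounds:
  assumes P: "P \<in> carrier_mat n n" "P * P = (P :: 'k::field mat)" and "P \<noteq> 0\<^sub>m n n" "P \<noteq> 1\<^sub>m n"
  shows "1 \<le> vec_space.rank n P" "vec_space.rank n P < n"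
proof -
  show "1 \<le> vec_space.rank n P" using idempotent_rank_0[OF P] assms(3) by linarith
  have "vec_space.rank n (1\<^sub>m n - P) \<noteq> 0"
  proof
    assume "vec_space.rank n (1\<^sub>m n - P) = 0"
    with complement_idempotent[OF P] have z: "1\<^sub>m n - P = 0\<^sub>m n n" by (intro idempotent_rank_0)
    have "P = 1\<^sub>m n"
    proof (rule mat_eqI[OF P(1) one_carrier_mat])
      fix i j assume ij: "i < n" "j < n"
      have "(1\<^sub>m n - P) $$ (i, j) = 0" unfolding z using ij by simp
      then show "P $$ (i, j) = 1\<^sub>m n $$ (i, j)" using mat_minus_index[OF one_carrier_mat P(1) ij] by simp
    qed
    with assms(4) show False by simp
  qed
  then show "vec_space.rank n P < n" using idempotent_diagonal(1)[OF P] by linarith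
qed

text \<open>Together with \<open>C C = 0\<close>, the extra condition \<open>G G = 0\<close> makes
  \<open>C G\<close> and \<open>G C\<close> orthogonal idempotents, so that \<open>C\<close> and
  \<open>G\<close> behave like the matrix units \<open>E_12\<close> and \<open>E_21\<close>.\<close>

lemma square_zero_inverse:
  fixes C :: "'k::field mat"
  assumes C: "C \<in> carrier_mat n n" and CC: "C * C = 0\<^sub>m n n"
  obtains G where "G \<in> carrier_mat n n" "C * (G * C) = C" "G * (C * G) = G" "G * G = 0\<^sub>m n n"
proof -
  note A = assoc_mult_mat[of _ n n _ n _ n] and M = mult_carrier_mat[of _ n n _ n]
  obtain H where H: "H \<in> carrier_mat n n" "C * H * C = C" using inner_inverse[OF C] by blast
  have CHC: "C * (H * C) = C" using H C by (simp add: A)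
  \<comment> \<open>Sandwiching \<open>C\<close> between two inner inverses gives a reflexive one,
    \<open>K C K = K\<close>.\<close>
  define K where "K = H * (C * H)"
  have K: "K \<in> carrier_mat n n" unfolding K_def using H C by (simp add: M)
  have CKC: "C * (K * C) = C" unfolding K_def using H C CHC by (simp add: A M)
  have CHCX: "C * (H * (C * X)) = C * X" if "X \<in> carrier_mat n n" for X
    using arg_cong[OF CHC, of "\<lambda>M. M * X"] that H C by (simp add: A M)
  have KCK: "K * (C * K) = K" unfolding K_def using H C CHCX by (simp add: A M)
  have KCKX: "K * (C * (K * X)) = K * X" if "X \<in> carrier_mat n n" for X
    using arg_cong[OF KCK, of "\<lambda>M. M * X"] that K C by (simp add: A M)
  have CCX: "C * (C * X) = 0\<^sub>m n n" if "X \<in> carrier_mat n n" for X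
    using arg_cong[OF CC, of "\<lambda>M. M * X"] that C by (simp add: A M)
  \<comment> \<open>Since \<open>C C = 0\<close>, the correction leaves \<open>C G = C K\<close>; it
    also yields \<open>K G = K K - K C K K = 0\<close>, hence \<open>G G = 0\<close>.\<close>
  define G where "G = K - C * (K * K)"
  have CKK: "C * (K * K) \<in> carrier_mat n n" using C K by (simp add: M)
  have G: "G \<in> carrier_mat n n" unfolding G_def using CKK by (rule minus_carrier_mat)
  have z: "X - 0\<^sub>m n n = X" if "X \<in> carrier_mat n n" for X :: "'k mat"
    using that by (intro eq_matI) auto
  have zz: "X - X = 0\<^sub>m n n" if "X \<in> carrier_mat n n" for X :: "'k mat"
    using that by (intro eq_matI) auto
  have GX: "G * X = K * X - C * (K * (K * X))" if X: "X \<in> carrier_mat n n" for X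
    unfolding G_def using minus_mult_distrib_mat[OF K CKK X] X K C by (simp add: A M)
  have CG: "C * G = C * K"
    unfolding G_def using mult_minus_distrib_mat[OF C K CKK] C K CCX by (simp add: M z)
  have "C * (G * C) = C"
    unfolding GX[OF C] using mult_minus_distrib_mat[of C n n "K * C" n "C * (K * (K * C))"] C K CCX CKC
    by (simp add: M z)
  moreover have "G * (C * G) = G"
    unfolding CG using GX[of "C * K"] C K KCK by (simp add: M G_def)
  moreover have "G * G = 0\<^sub>m n n"
  proof -
    have KG: "K * G = K * K - K * K"
      using mult_minus_distrib_mat[OF K K CKK] K C KCKX[OF K] unfolding G_def by simp
    then have "K * G = 0\<^sub>m n n" using zz[of "K * K"] K by (simp add: M)
    then show ?thesis using GX[OF G] K C z[of "0\<^sub>m n n"] by (simp add: M)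
  qed
  ultimately show ?thesis using that G by blast
qed

text \<open>Expand the commutator of \<open>A + t D\<close> with \<open>f + C / t\<close>, where
  \<open>f = G C\<close>, in powers of \<open>t\<close>. It vanishes if \<open>A\<close> commutes
  with \<open>C\<close>, \<open>D\<close> commutes with \<open>f\<close>, and the commutators of
  \<open>A\<close> with \<open>f\<close> and of \<open>D\<close> with \<open>C\<close> cancel; the
  last two conditions are those imposed on \<open>D\<close>.\<close>

lemma square_zero_deformation:
  fixes A C G :: "'k::field mat"
  assumes C: "C \<in> carrier_mat n n" and G: "G \<in> carrier_mat n n" and A: "A \<in> carrier_mat n n"
    and CC: "C * C = 0\<^sub>m n n" and CGC: "C * (G * C) = C" and GCG: "G * (C * G) = G"
    and GG: "G * G = 0\<^sub>m n n" and AC: "A * C = C * A"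
  shows "\<exists>D\<in>carrier_mat n n. D * (G * C) = G * C * D \<and> A * (G * C) + D * C = G * C * A + C * D"
proof -
  note R = assoc_mult_mat[of _ n n _ n _ n] add_mult_distrib_mat[where nr = n and n = n and nc = n]
    mult_add_distrib_mat[where nr = n and n = n and nc = n]
    minus_mult_distrib_mat[where nr = n and n = n and nc = n]
    mult_minus_distrib_mat[where nr = n and n = n and nc = n]
    mult_carrier_mat[of _ n n _ n] minus_carrier_mat[of _ n n]
    mat_add_index[of _ n n] mat_minus_index[of _ n n]
  have X: "\<And>X. X \<in> carrier_mat n n \<Longrightarrow> C * (C * X) = 0\<^sub>m n n"
    "\<And>X. X \<in> carrier_mat n n \<Longrightarrow> C * (G * (C * X)) = C * X"
    "\<And>X. X \<in> carrier_mat n n \<Longrightarrow> G * (C * (G * X)) = G * X"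
    "\<And>X. X \<in> carrier_mat n n \<Longrightarrow> G * (G * X) = 0\<^sub>m n n"
    "\<And>X. X \<in> carrier_mat n n \<Longrightarrow> A * (C * X) = C * (A * X)"
  proof -
    fix X :: "'k mat" assume X: "X \<in> carrier_mat n n"
    show "C * (C * X) = 0\<^sub>m n n" using arg_cong[OF CC, of "\<lambda>M. M * X"] X C by (simp add: R)
    show "C * (G * (C * X)) = C * X" using arg_cong[OF CGC, of "\<lambda>M. M * X"] X C G by (simp add: R)
    show "G * (C * (G * X)) = G * X" using arg_cong[OF GCG, of "\<lambda>M. M * X"] X C G by (simp add: R)
    show "G * (G * X) = 0\<^sub>m n n" using arg_cong[OF GG, of "\<lambda>M. M * X"] X G by (simp add: R)
    show "A * (C * X) = C * (A * X)" using arg_cong[OF AC, of "\<lambda>M. M * X"] X C A by (simp add: R)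
  qed
  have CAGC: "C * (A * (G * C)) = C * A"
    using X(5)[OF mult_carrier_mat[OF G C]] unfolding CGC AC by (rule sym)
  \<comment> \<open>In blocks for the idempotents \<open>C G\<close>, \<open>G C\<close> and
    \<open>1 - C G - G C\<close>, where \<open>C = E_12\<close> and \<open>G = E_21\<close>,
    commuting with \<open>C\<close> means \<open>A = [[a, b, c], [0, a, 0], [0, d, e]]\<close>. For
    \<open>D\<close> commuting with \<open>G C = E_22\<close>, the mixed condition reads
    \<open>D_22 - D_11 = b\<close> and \<open>D_31 = -d\<close>. This \<open>D\<close> has
    \<open>b\<close> at (2,2), \<open>-d\<close> at (3,1) and zeros elsewhere: its first and third
    summands cancel the other blocks of \<open>A G\<close>.\<close>
  define D where "D = G * (A * (C * G)) + G * (A * (G * C)) + C * (G * (A * G)) - A * G"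
  have D: "D \<in> carrier_mat n n" unfolding D_def using A G C by (simp add: R)
  have "D * (G * C) = G * C * D"
    by (rule mat_eqI[of _ n n])
      (use A G C D in \<open>simp_all add: R D_def X CC CGC GCG GG AC CAGC del: index_mult_mat(1)\<close>)
  moreover have "A * (G * C) + D * C = G * C * A + C * D"
    by (rule mat_eqI[of _ n n])
      (use A G C D in \<open>simp_all add: R D_def X CC CGC GCG GG AC CAGC del: index_mult_mat(1)\<close>)
  ultimately show ?thesis using D by blast
qed

lemma pencil_commute:
  fixes A C D f :: "'k::field mat"
  assumes A: "A \<in> carrier_mat n n" and C: "C \<in> carrier_mat n n" and D: "D \<in> carrier_mat n n"
    and f: "f \<in> carrier_mat n n"
    and AC: "A * C = C * A" and Df: "D * f = f * D" and eq: "A * f + D * C = f * A + C * D"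
    and ts: "t * s = 1"
  shows "(A + t \<cdot>\<^sub>m D) * (f + s \<cdot>\<^sub>m C) = (f + s \<cdot>\<^sub>m C) * (A + t \<cdot>\<^sub>m D)"
proof (rule mat_eqI[of _ n n])
  note R = add_mult_distrib_mat[where nr = n and n = n and nc = n]
    mult_add_distrib_mat[where nr = n and n = n and nc = n]
    mult_smult_assoc_mat[where nr = n and n = n and nc = n]
    mult_smult_distrib[where nr = n and n = n and nc = n]
    mult_carrier_mat[of _ n n _ n] mat_add_index[of _ n n] mat_smult_index[of _ n n]
  fix i j assume ij: "i < n" "j < n"
  have e: "(A * f) $$ (i, j) + (D * C) $$ (i, j) = (f * A) $$ (i, j) + (C * D) $$ (i, j)"
    using arg_cong[OF eq, of "\<lambda>M. M $$ (i, j)"] A C D f ij by (simp add: R del: index_mult_mat(1))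
  have ts': "t * (s * x) = x" "s * (t * x) = x" for x
    using ts by (metis mult.assoc mult.commute mult_1_left)+
  show "((A + t \<cdot>\<^sub>m D) * (f + s \<cdot>\<^sub>m C)) $$ (i, j) = ((f + s \<cdot>\<^sub>m C) * (A + t \<cdot>\<^sub>m D)) $$ (i, j)"
    using A C D f ij e
    by (simp add: R AC Df ts' distrib_left add.commute add.left_commute del: index_mult_mat(1))
qed (use A C D f in \<open>auto intro!: mult_carrier_mat[of _ n n]\<close>)

text \<open>Conjugating \<open>f\<close> by \<open>1 + s C\<close>, whose inverse is
  \<open>1 - s C\<close>, gives \<open>f + s C\<close> because \<open>C f = C\<close> and
  \<open>f C = 0\<close>. Carrying the factorisation along keeps the rank at \<open>r\<close> for
  every \<open>s\<close>.\<close>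

lemma square_zero_conj:
  fixes C f :: "'k::field mat"
  assumes C: "C \<in> carrier_mat n n" and CC: "C * C = 0\<^sub>m n n" and Cf: "C * f = C" and fC: "f * C = 0\<^sub>m n n"
    and F: "idem_factor n r f F H"
  shows "idem_factor n r (f + s \<cdot>\<^sub>m C) ((1\<^sub>m n + s \<cdot>\<^sub>m C) * F) (H * (1\<^sub>m n - s \<cdot>\<^sub>m C))"
proof -
  note R = add_mult_distrib_mat[where nr = n and n = n and nc = n]
    mult_add_distrib_mat[where nr = n and n = n and nc = n]
    minus_mult_distrib_mat[where nr = n and n = n and nc = n]
    mult_minus_distrib_mat[where nr = n and n = n and nc = n]
    mult_smult_assoc_mat[where nr = n and n = n and nc = n]
    mult_smult_distrib[where nr = n and n = n and nc = n]
    mult_carrier_mat[of _ n n _ n] minus_carrier_mat[of _ n n]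
    mat_add_index[of _ n n] mat_minus_index[of _ n n] mat_smult_index[of _ n n]
  let ?U = "1\<^sub>m n + s \<cdot>\<^sub>m C" and ?V = "1\<^sub>m n - s \<cdot>\<^sub>m C"
  note FH = F[unfolded idem_factor_def]
  have F': "F \<in> carrier_mat n r" and H: "H \<in> carrier_mat r n" using FH by auto
  have f: "f \<in> carrier_mat n n" by (rule idem_factor_carrier[OF F])
  have U: "?U \<in> carrier_mat n n" and V: "?V \<in> carrier_mat n n" using C by (simp_all add: R)
  have VU: "?V * ?U = 1\<^sub>m n"
    by (rule mat_eqI[of _ n n]) (use C U V in \<open>simp_all add: R CC del: index_mult_mat(1)\<close>)
  have UfV: "?U * f * ?V = f + s \<cdot>\<^sub>m C"
    by (rule mat_eqI[of _ n n]) (use C f U V in \<open>simp_all add: R CC Cf fC del: index_mult_mat(1)\<close>)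
  show ?thesis
    unfolding idem_factor_def
  proof (intro conjI)
    show "?U * F \<in> carrier_mat n r" "H * ?V \<in> carrier_mat r n"
      using U V F' H by (auto intro: mult_carrier_mat[of _ n n] mult_carrier_mat[of _ r n])
    have "?U * F * (H * ?V) = ?U * (F * H) * ?V" by (rule assoc_mult_mat4[OF U F' H V, symmetric])
    then show "?U * F * (H * ?V) = f + s \<cdot>\<^sub>m C" using FH UfV by simp
    have "H * ?V * (?U * F) = H * (?V * ?U) * F" by (rule assoc_mult_mat4[OF H V U F', symmetric])
    then show "H * ?V * (?U * F) = 1\<^sub>m r" unfolding VU right_mult_one_mat[OF H] using FH by simp
  qed
qed

text \<open>The centralisers of the idempotents \<open>G * C + inverse t \<cdot>\<^sub>m C\<close> all have the dimension of the
  centraliser of \<open>C\<close> and degenerate to it as \<open>t\<close> tends to \<open>0\<close>.\<close>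

lemma square_zero_closure:
  fixes A B C :: "'k::alg_closed_field mat"
  assumes A: "A \<in> carrier_mat n n" and B: "B \<in> carrier_mat n n" and C: "C \<in> carrier_mat n n"
    and C0: "C \<noteq> 0\<^sub>m n n" and CC: "C * C = 0\<^sub>m n n" and AC: "A * C = C * A" and BC: "B * C = C * B"
  shows "\<exists>r. 1 \<le> r \<and> r < n \<and> (A, B) \<in> zariski_closure n (commuting_Z n r)"
proof -
  obtain G where G: "G \<in> carrier_mat n n" "C * (G * C) = C" "G * (C * G) = G" "G * G = 0\<^sub>m n n"
    by (rule square_zero_inverse[OF C CC])
  define f where "f = G * C"
  have f: "f \<in> carrier_mat n n" unfolding f_def using G C by simp
  have ff: "f * f = f" unfolding f_def using assoc_mult_mat[OF G(1) C f] G(2) unfolding f_def by simp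
  have Cf: "C * f = C" unfolding f_def by (rule G)
  have fC: "f * C = 0\<^sub>m n n" unfolding f_def using assoc_mult_mat[OF G(1) C C] CC G(1) by simp
  obtain DA where DA: "DA \<in> carrier_mat n n" "DA * f = f * DA" "A * f + DA * C = f * A + C * DA"
    using square_zero_deformation[OF C G(1) A CC G(2-4) AC] unfolding f_def by blast
  obtain DB where DB: "DB \<in> carrier_mat n n" "DB * f = f * DB" "B * f + DB * C = f * B + C * DB"
    using square_zero_deformation[OF C G(1) B CC G(2-4) BC] unfolding f_def by blast
  define r where "r = vec_space.rank n f"
  obtain F H where FH: "idem_factor n r f F H" using idempotent_factor[OF f ff] unfolding r_def by blast
  \<comment> \<open>Nontriviality of \<open>f\<close> is inherited from \<open>C\<close>:
    \<open>f = 0\<close> would give \<open>C = C f = 0\<close>, and \<open>f = 1\<close> would give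
    \<open>C = f C = 0\<close>.\<close>
  have "f \<noteq> 0\<^sub>m n n" using Cf C0 C by auto
  moreover have "f \<noteq> 1\<^sub>m n" using fC C0 C by auto
  ultimately have r: "1 \<le> r" "r < n" using idempotent_rank_bounds[OF f ff] unfolding r_def by auto
  let ?a = "\<lambda>t. A + t \<cdot>\<^sub>m DA" and ?b = "\<lambda>t. B + t \<cdot>\<^sub>m DB"
  have "(?a 0, ?b 0) \<in> zariski_closure n (commuting_Z n r)"
  proof (rule zariski_closure_curve[where T = "{0}" and a = ?a and b = ?b])
    show "?a \<in> uf.mats n n" "?b \<in> uf.mats n n"
      using A B DA DB by (auto intro!: uf.mats_add uf.mats_smult uf.mats_const id_upoly_fun)
    fix t :: 'k assume "t \<notin> {0}"
    then have ts: "t * inverse t = 1" by simp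
    note P = square_zero_conj[OF C CC Cf fC FH, of "inverse t"]
    show "(?a t, ?b t) \<in> commuting_Z n r"
      by (rule commuting_ZI[OF _ _ idem_factor_carrier[OF P] idem_factor_idem[OF P] idem_factor_rank[OF P]
            pencil_commute[OF A C DA(1) f AC DA(2,3) ts] pencil_commute[OF B C DB(1) f BC DB(2,3) ts]])
        (use A B DA DB in auto)
  qed simp
  moreover have "?a 0 = A" "?b 0 = B" using A B DA DB by (auto intro!: eq_matI)
  ultimately show ?thesis using r by auto
qed

lemma commuting_C2_subset:
  assumes n: "n \<ge> 2"
  shows "(commuting_C2 n :: 'k::alg_closed_field mat_pair set)
    \<subseteq> (\<Union>i\<in>{1..n div 2}. zariski_closure n (commuting_Z n i))"
proof
  fix X :: "'k mat_pair" assume "X \<in> commuting_C2 n"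
  moreover obtain A B where X: "X = (A, B)" by (cases X)
  ultimately obtain C where A: "A \<in> carrier_mat n n" and B: "B \<in> carrier_mat n n"
    and C: "C \<in> carrier_mat n n" "\<not> scalar_matrix n C" "A * C = C * A" "B * C = C * B"
    using commuting_C2_iff[OF n] by blast
  obtain E where E: "E \<in> carrier_mat n n" "A * E = E * A" "B * E = E * B" "E \<noteq> 0\<^sub>m n n"
    and cases: "E * E = 0\<^sub>m n n \<or> E * E = E \<and> E \<noteq> 1\<^sub>m n"
    using nonscalar_commutant[OF C(1,2)] n A B C(3,4) by (metis less_le_trans pos2)
  have "\<exists>r. 1 \<le> r \<and> r < n \<and> (A, B) \<in> zariski_closure n (commuting_Z n r)"
    using cases
  proof
    assume "E * E = 0\<^sub>m n n"
    then show ?thesis using square_zero_closure[OF A B E(1,4) _ E(2,3)] by blast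
  next
    assume EE: "E * E = E \<and> E \<noteq> 1\<^sub>m n"
    have "(A, B) \<in> commuting_Z n (vec_space.rank n E)"
      by (rule commuting_ZI[OF A B E(1) _ refl E(2,3)]) (use EE in simp)
    then show ?thesis
      using idempotent_rank_bounds[OF E(1) _ E(4)] EE zariski_closure_superset by blast
  qed
  then obtain r where r: "1 \<le> r" "r < n" "(A, B) \<in> zariski_closure n (commuting_Z n r)" by blast
  show "X \<in> (\<Union>i\<in>{1..n div 2}. zariski_closure n (commuting_Z n i))"
  proof (cases "r \<le> n div 2")
    case True
    then show ?thesis using r X by auto
  next
    case False
    have "zariski_closure n (commuting_Z n r) \<subseteq> zariski_closure n (commuting_Z n (n - r) :: 'k mat_pair set)"
      by (intro zariski_closure_minimal zariski_closure_variety commuting_Z_subset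
          order_trans[OF commuting_Z_sym zariski_closure_superset])
    moreover have "n - r \<in> {1..n div 2}" using r False by auto
    ultimately show ?thesis using r(3) X by blast
  qed
qed

section \<open>The common commutants as solutions of a linear system, and the resulting
  equations\<close>

definition unit_mat :: "nat \<Rightarrow> nat \<Rightarrow> 'k::field mat" where
  "unit_mat n s = mat n n (\<lambda>(i, j). if i * n + j = s then 1 else 0)"

text \<open>The system \<open>A C = C A\<close>, \<open>B C = C B\<close>, \<open>C\<^sub>0\<^sub>0 = 0\<close>; the last equation removes the scalar solutions.\<close>

definition comm_system :: "nat \<Rightarrow> 'k::field mat_pair \<Rightarrow> 'k mat" where
  "comm_system n X = mat (2 * (n * n) + 1) (n * n) (\<lambda>(r, s).
     if r < n * n
     then (fst X * unit_mat n s - unit_mat n s * fst X) $$ (r div n, r mod n)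
     else if r < 2 * (n * n)
     then (snd X * unit_mat n s - unit_mat n s * snd X) $$ ((r - n * n) div n, (r - n * n) mod n)
     else if s = 0 then 1 else 0)"

lemma unit_mat_carrier [simp]: "unit_mat n s \<in> carrier_mat n n"
  unfolding unit_mat_def by simp

lemma index_flat:
  fixes i j n :: nat
  assumes "i < n" "j < n"
  shows "i * n + j < n * n" "(i * n + j) div n = i" "(i * n + j) mod n = j"
proof -
  have "i * n + j < Suc i * n" using assms by simp
  also have "\<dots> \<le> n * n" using assms by (intro mult_le_mono1) simp
  finally show "i * n + j < n * n" .
qed (use assms in auto)

lemma index_unflat:
  fixes r n :: nat
  assumes "r < n * n"
  shows "r div n < n" "r mod n < n"
proof -
  have "0 < n" using assms by (cases n) auto
  then show "r mod n < n" by simp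
  show "r div n < n" using assms by (simp add: less_mult_imp_div_less)
qed

lemma lincomb_unit_mat:
  assumes "i < n" "j < n"
  shows "lincomb_mat n n {..<n * n} w (unit_mat n) $$ (i, j) = w (i * n + j)"
proof -
  have "lincomb_mat n n {..<n * n} w (unit_mat n) $$ (i, j)
      = (\<Sum>s<n * n. if s = i * n + j then w (i * n + j) else 0)"
    unfolding lincomb_mat_index[OF assms] by (rule sum.cong) (use assms in \<open>auto simp: unit_mat_def\<close>)
  then show ?thesis using index_flat(1)[OF assms] by simp
qed

lemma comm_system_carrier: "comm_system n X \<in> carrier_mat (2 * (n * n) + 1) (n * n)"
  unfolding comm_system_def by simp

lemma comm_system_poly: "comm_system n \<in> pf.mats n (2 * (n * n) + 1) (n * n)"
proof -
  have c: "(\<lambda>X. (p X * unit_mat n s - unit_mat n s * p X) $$ (r div n, r mod n)) \<in> poly_funs n"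
    if "p \<in> pf.mats n n n" "r < n * n" for r s and p :: "'k::field mat_pair \<Rightarrow> 'k mat"
    by (rule pf.mats_index[OF pf.mats_diff[OF pf.mats_mult[OF that(1)] pf.mats_mult[OF _ that(1)]]])
      (use index_unflat[OF that(2)] in \<open>auto intro: pf.mats_const\<close>)
  show ?thesis
    unfolding comm_system_def
  proof (rule pf.mats_mat)
    fix r s assume r: "r < 2 * (n * n) + 1" and s: "s < n * n"
    consider "r < n * n" | "\<not> r < n * n" "r < 2 * (n * n)" | "\<not> r < n * n" "\<not> r < 2 * (n * n)" by blast
    then show "(\<lambda>X. if r < n * n
       then (fst X * unit_mat n s - unit_mat n s * fst X) $$ (r div n, r mod n)
       else if r < 2 * (n * n)
       then (snd X * unit_mat n s - unit_mat n s * snd X) $$ ((r - n * n) div n, (r - n * n) mod n)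
       else if s = 0 then 1 else (0::'k::field)) \<in> poly_funs n"
    proof cases
      case 1
      then show ?thesis using c[OF fst_poly_mats 1] by (simp del: index_mult_mat(1) index_minus_mat(1))
    next
      case 2
      then have "r - n * n < n * n" by simp
      from c[OF snd_poly_mats this] 2 show ?thesis by (simp del: index_mult_mat(1) index_minus_mat(1))
    next
      case 3
      then show ?thesis by (cases "s = 0") (simp_all add: pf.const)
    qed
  qed
qed

lemma comm_system_kernel:
  fixes A B :: "'k::field mat"
  assumes A: "A \<in> carrier_mat n n" and B: "B \<in> carrier_mat n n" and v: "v \<in> carrier_vec (n * n)"
    and n: "0 < n"
  defines "C \<equiv> lincomb_mat n n {..<n * n} (($) v) (unit_mat n)"
  shows "comm_system n (A, B) *\<^sub>v v = 0\<^sub>v (2 * (n * n) + 1) \<longleftrightarrow>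
    A * C = C * A \<and> B * C = C * B \<and> C $$ (0, 0) = 0"
proof -
  let ?K = "comm_system n (A, B)"
  have C: "C \<in> carrier_mat n n" unfolding C_def by simp
  have row: "(?K *\<^sub>v v) $ r = (\<Sum>s<n * n. v $ s * ?K $$ (r, s))" if "r < 2 * (n * n) + 1" for r
    using that carrier_matD[OF comm_system_carrier[of n "(A, B)"]] v
    by (auto simp: scalar_prod_def atLeast0LessThan ac_simps intro!: sum.cong)
  have comm: "(M * C) $$ (i, j) - (C * M) $$ (i, j)
      = (\<Sum>s<n * n. v $ s * (M * unit_mat n s - unit_mat n s * M) $$ (i, j))"
    if M: "M \<in> carrier_mat n n" and ij: "i < n" "j < n" for M i j
  proof -
    have "(M * C) $$ (i, j) - (C * M) $$ (i, j)
        = (\<Sum>s<n * n. v $ s * (M * unit_mat n s) $$ (i, j)) - (\<Sum>s<n * n. v $ s * (unit_mat n s * M) $$ (i, j))"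
      unfolding C_def mult_lincomb_mat[OF M unit_mat_carrier] lincomb_mat_mult[OF M unit_mat_carrier]
        lincomb_mat_index[OF ij] ..
    also have "\<dots> = (\<Sum>s<n * n. v $ s * (M * unit_mat n s - unit_mat n s * M) $$ (i, j))"
      unfolding sum_subtractf[symmetric] right_diff_distrib[symmetric]
      by (rule sum.cong[OF refl])
        (simp only: mat_minus_index[OF mult_carrier_mat[OF M unit_mat_carrier]
            mult_carrier_mat[OF unit_mat_carrier M] ij])
    finally show ?thesis .
  qed
  have commute: "M * C = C * M \<longleftrightarrow> (\<forall>r<n * n. (M * C) $$ (r div n, r mod n) - (C * M) $$ (r div n, r mod n) = 0)"
    if M: "M \<in> carrier_mat n n" for M
  proof
    assume z: "\<forall>r<n * n. (M * C) $$ (r div n, r mod n) - (C * M) $$ (r div n, r mod n) = 0"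
    show "M * C = C * M"
    proof (rule mat_eqI[OF mult_carrier_mat[OF M C] mult_carrier_mat[OF C M]])
      fix i j assume ij: "i < n" "j < n"
      then show "(M * C) $$ (i, j) = (C * M) $$ (i, j)"
        using z[rule_format, OF index_flat(1)[OF ij]] unfolding index_flat(2,3)[OF ij] by simp
    qed
  qed simp
  have Arow: "(?K *\<^sub>v v) $ r = (A * C) $$ (r div n, r mod n) - (C * A) $$ (r div n, r mod n)"
    if r: "r < n * n" for r
    unfolding comm[OF A index_unflat[OF r]]
    by (subst row) (use r in \<open>auto simp: comm_system_def simp del: index_mult_mat(1) index_minus_mat(1)\<close>)
  have Brow: "(?K *\<^sub>v v) $ (n * n + r) = (B * C) $$ (r div n, r mod n) - (C * B) $$ (r div n, r mod n)"
    if r: "r < n * n" for r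
    unfolding comm[OF B index_unflat[OF r]]
    by (subst row) (use r in \<open>auto simp: comm_system_def simp del: index_mult_mat(1) index_minus_mat(1)\<close>)
  have last: "(?K *\<^sub>v v) $ (2 * (n * n)) = C $$ (0, 0)"
  proof -
    have "(?K *\<^sub>v v) $ (2 * (n * n)) = (\<Sum>s<n * n. v $ s * (if s = 0 then 1 else 0))"
      by (subst row) (auto simp: comm_system_def intro!: sum.cong)
    also have "\<dots> = (\<Sum>s<n * n. if s = 0 then v $ 0 else 0)"
      by (rule sum.cong) auto
    also have "\<dots> = v $ 0" using n by simp
    also have "\<dots> = C $$ (0, 0)" unfolding C_def lincomb_unit_mat[OF n n] by simp
    finally show ?thesis .
  qed
  have "?K *\<^sub>v v = 0\<^sub>v (2 * (n * n) + 1) \<longleftrightarrow> (\<forall>r<2 * (n * n) + 1. (?K *\<^sub>v v) $ r = 0)"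
  proof
    assume z: "\<forall>r<2 * (n * n) + 1. (?K *\<^sub>v v) $ r = 0"
    show "?K *\<^sub>v v = 0\<^sub>v (2 * (n * n) + 1)"
    proof (rule eq_vecI)
      show "dim_vec (?K *\<^sub>v v) = dim_vec (0\<^sub>v (2 * (n * n) + 1))"
        using carrier_matD[OF comm_system_carrier[of n "(A, B)"]] by simp
    next
      fix r assume "r < dim_vec (0\<^sub>v (2 * (n * n) + 1) :: 'k vec)"
      then have "r < 2 * (n * n) + 1" by simp
      then show "(?K *\<^sub>v v) $ r = 0\<^sub>v (2 * (n * n) + 1) $ r" using z by simp
    qed
  qed simp
  also have "\<dots> \<longleftrightarrow> (\<forall>r<n * n. (?K *\<^sub>v v) $ r = 0) \<and> (\<forall>r<n * n. (?K *\<^sub>v v) $ (n * n + r) = 0) \<and>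
      (?K *\<^sub>v v) $ (2 * (n * n)) = 0"
  proof (intro iffI conjI allI impI)
    assume z: "(\<forall>r<n * n. (?K *\<^sub>v v) $ r = 0) \<and> (\<forall>r<n * n. (?K *\<^sub>v v) $ (n * n + r) = 0) \<and>
      (?K *\<^sub>v v) $ (2 * (n * n)) = 0"
    fix r assume r: "r < 2 * (n * n) + 1"
    consider "r < n * n" | "n * n \<le> r" "r - n * n < n * n" | "r = 2 * (n * n)" using r by linarith
    then show "(?K *\<^sub>v v) $ r = 0"
    proof cases
      case 2
      then have "r = n * n + (r - n * n)" by simp
      then show ?thesis using z 2(2) by metis
    qed (use z in auto)
  qed auto
  also have "\<dots> \<longleftrightarrow> A * C = C * A \<and> B * C = C * B \<and> C $$ (0, 0) = 0"
    unfolding commute[OF A] commute[OF B] last using Arow Brow by auto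
  finally show ?thesis .
qed

text \<open>Subtracting a scalar moves any common commutant to one with corner entry zero. A scalar
  matrix with this corner is zero, so nonscalar commutants correspond to nonzero kernel
  vectors.\<close>

lemma commuting_C2_kernel:
  fixes A B :: "'k::field mat"
  assumes n: "n \<ge> 2" and A: "A \<in> carrier_mat n n" and B: "B \<in> carrier_mat n n"
  shows "(A, B) \<in> commuting_C2 n \<longleftrightarrow>
    (\<exists>v\<in>carrier_vec (n * n). v \<noteq> 0\<^sub>v (n * n) \<and> comm_system n (A, B) *\<^sub>v v = 0\<^sub>v (2 * (n * n) + 1))"
proof
  have n0: "0 < n" using n by simp
  assume "(A, B) \<in> commuting_C2 n"
  then obtain C where C: "C \<in> carrier_mat n n" "\<not> scalar_matrix n C" "A * C = C * A" "B * C = C * B"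
    using commuting_C2_iff[OF n] by blast
  define k where "k = C $$ (0, 0)"
  define D where "D = C - k \<cdot>\<^sub>m 1\<^sub>m n"
  have k1: "k \<cdot>\<^sub>m 1\<^sub>m n \<in> carrier_mat n n" by simp
  have D: "D \<in> carrier_mat n n" unfolding D_def by (rule minus_carrier_mat[OF k1])
  have DM: "M * D = D * M" if M: "M \<in> carrier_mat n n" "M * C = C * M" for M
    unfolding D_def mult_minus_distrib_mat[OF M(1) C(1) k1] minus_mult_distrib_mat[OF C(1) k1 M(1)] M(2)
    using scalar_matrix_commute[of n "k \<cdot>\<^sub>m 1\<^sub>m n" M] M(1) unfolding scalar_matrix_def by auto
  define v where "v = vec (n * n) (\<lambda>s. D $$ (s div n, s mod n))"
  have v: "v \<in> carrier_vec (n * n)" unfolding v_def by simp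
  have L: "lincomb_mat n n {..<n * n} (($) v) (unit_mat n) = D"
  proof (rule mat_eqI[OF lincomb_mat_carrier D])
    fix i j assume ij: "i < n" "j < n"
    show "lincomb_mat n n {..<n * n} (($) v) (unit_mat n) $$ (i, j) = D $$ (i, j)"
      unfolding lincomb_unit_mat[OF ij] v_def using index_flat[OF ij] by simp
  qed
  have "D $$ (0, 0) = 0" unfolding D_def k_def using n0 C(1) by simp
  then have "comm_system n (A, B) *\<^sub>v v = 0\<^sub>v (2 * (n * n) + 1)"
    unfolding comm_system_kernel[OF A B v n0] L using DM A B C by blast
  moreover have "v \<noteq> 0\<^sub>v (n * n)"
  proof
    assume "v = 0\<^sub>v (n * n)"
    have "C = k \<cdot>\<^sub>m 1\<^sub>m n"
    proof (rule mat_eqI[OF C(1) k1])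
      fix i j assume ij: "i < n" "j < n"
      have "D $$ (i, j) = 0"
        unfolding L[symmetric] lincomb_unit_mat[OF ij] \<open>v = 0\<^sub>v (n * n)\<close> using index_flat(1)[OF ij] by simp
      then show "C $$ (i, j) = (k \<cdot>\<^sub>m 1\<^sub>m n) $$ (i, j)"
        unfolding D_def mat_minus_index[OF C(1) k1 ij] by simp
    qed
    with C(2) show False unfolding scalar_matrix_def by blast
  qed
  ultimately show "\<exists>v\<in>carrier_vec (n * n). v \<noteq> 0\<^sub>v (n * n) \<and>
      comm_system n (A, B) *\<^sub>v v = 0\<^sub>v (2 * (n * n) + 1)"
    using v by blast
next
  have n0: "0 < n" using n by simp
  assume "\<exists>v\<in>carrier_vec (n * n). v \<noteq> 0\<^sub>v (n * n) \<and>
      comm_system n (A, B) *\<^sub>v v = 0\<^sub>v (2 * (n * n) + 1)"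
  then obtain v where v: "v \<in> carrier_vec (n * n)" "v \<noteq> 0\<^sub>v (n * n)"
    "comm_system n (A, B) *\<^sub>v v = 0\<^sub>v (2 * (n * n) + 1)" by blast
  define C where "C = lincomb_mat n n {..<n * n} (($) v) (unit_mat n)"
  have C: "A * C = C * A" "B * C = C * B" "C $$ (0, 0) = 0"
    using v(3) unfolding comm_system_kernel[OF A B v(1) n0] C_def by auto
  have "\<not> scalar_matrix n C"
  proof
    assume "scalar_matrix n C"
    then obtain k where k: "C = k \<cdot>\<^sub>m 1\<^sub>m n" unfolding scalar_matrix_def by blast
    then have "k = 0" using C(3) n0 by simp
    have "v = 0\<^sub>v (n * n)"
    proof (rule eq_vecI)
      fix s assume "s < dim_vec (0\<^sub>v (n * n) :: 'k vec)"
      then have s: "s < n * n" by simp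
      have "C $$ (s div n, s mod n) = v $ s"
        unfolding C_def lincomb_unit_mat[OF index_unflat[OF s]] by simp
      then show "v $ s = 0\<^sub>v (n * n) $ s" unfolding k \<open>k = 0\<close> using s index_unflat[OF s] by simp
    qed (use v(1) in simp)
    with v(2) show False by simp
  qed
  moreover have "C \<in> carrier_mat n n" unfolding C_def by simp
  ultimately show "(A, B) \<in> commuting_C2 n" using commuting_C2_iff[OF n] A B C by blast
qed

text \<open>The kernel is trivial iff a left inverse exists. Hence it is nontrivial iff
  \<open>det (L K) = 0\<close> for all constant \<open>L\<close> of matching shape, a family of
  equations that takes the place of the maximal minors of \<open>K\<close>.\<close>

lemma commuting_C2_variety:
  assumes n: "n \<ge> 2"
  shows "variety n (commuting_C2 n :: 'k::field mat_pair set)"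
proof -
  let ?m = "2 * (n * n) + 1"
  let ?F = "(\<lambda>L X. det (L * comm_system n X)) ` (carrier_mat (n * n) ?m :: 'k mat set)"
  have "f \<in> poly_funs n" if "f \<in> ?F" for f
    using that by (auto intro!: pf.det pf.mats_mult[OF pf.mats_const comm_system_poly])
  then have "variety n {X \<in> mat_pairs n. \<forall>f\<in>?F. f X = 0}" by (rule varietyI)
  also have "{X \<in> mat_pairs n. \<forall>f\<in>?F. f X = 0} = commuting_C2 n"
  proof (rule Set.set_eqI)
    fix X :: "'k mat_pair"
    obtain A B where X: "X = (A, B)" by (cases X)
    let ?K = "comm_system n (A, B)"
    have K: "?K \<in> carrier_mat ?m (n * n)" by (rule comm_system_carrier)
    show "X \<in> {X \<in> mat_pairs n. \<forall>f\<in>?F. f X = 0} \<longleftrightarrow> X \<in> commuting_C2 n"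
    proof (cases "A \<in> carrier_mat n n \<and> B \<in> carrier_mat n n")
      case False
      then show ?thesis unfolding X commuting_C2_def mat_pairs_def by auto
    next
      case True
      then have A: "A \<in> carrier_mat n n" and B: "B \<in> carrier_mat n n" by auto
      have "(\<forall>L\<in>carrier_mat (n * n) ?m. det (L * ?K) = 0) \<longleftrightarrow> (A, B) \<in> commuting_C2 n"
      proof
        assume z: "\<forall>L\<in>carrier_mat (n * n) ?m. det (L * ?K) = 0"
        show "(A, B) \<in> commuting_C2 n"
        proof (rule ccontr)
          assume "(A, B) \<notin> commuting_C2 n"
          then have "v = 0\<^sub>v (n * n)" if "v \<in> carrier_vec (n * n)" "?K *\<^sub>v v = 0\<^sub>v ?m" for v
            using that commuting_C2_kernel[OF n A B] by blast
          from left_inverse[OF K this] obtain L where "L \<in> carrier_mat (n * n) ?m" "L * ?K = 1\<^sub>m (n * n)"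
            by blast
          with z show False by force
        qed
      next
        assume "(A, B) \<in> commuting_C2 n"
        then obtain v where v: "v \<in> carrier_vec (n * n)" "v \<noteq> 0\<^sub>v (n * n)" "?K *\<^sub>v v = 0\<^sub>v ?m"
          using commuting_C2_kernel[OF n A B] by blast
        show "\<forall>L\<in>carrier_mat (n * n) ?m. det (L * ?K) = 0"
        proof
          fix L :: "'k mat" assume L: "L \<in> carrier_mat (n * n) ?m"
          have "(L * ?K) *\<^sub>v v = 0\<^sub>v (n * n)"
            using assoc_mult_mat_vec[OF L K v(1)] v(3) mult_mat_zero_vec[OF L] by simp
          then show "det (L * ?K) = 0"
            using det_0_iff_vec_prod_zero_field[OF mult_carrier_mat[OF L K]] v by blast
        qed
      qed
      then show ?thesis using A B unfolding X mat_pairs_def by simp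
    qed
  qed
  finally show ?thesis .
qed

lemma commuting_Z_subset_C2:
  assumes n: "n \<ge> 2" and i: "1 \<le> i" "i < n"
  shows "commuting_Z n i \<subseteq> (commuting_C2 n :: 'k::field mat_pair set)"
proof
  fix X :: "'k mat_pair" assume "X \<in> commuting_Z n i"
  then obtain A B P where X: "X = (A, B)" and A: "A \<in> carrier_mat n n" and B: "B \<in> carrier_mat n n"
    and P: "P \<in> carrier_mat n n" "P * P = P" "vec_space.rank n P = i" "A * P = P * A" "B * P = P * B"
    by (rule commuting_ZE)
  have "\<not> scalar_matrix n P"
  proof
    assume "scalar_matrix n P"
    then obtain k where k: "P = k \<cdot>\<^sub>m 1\<^sub>m n" unfolding scalar_matrix_def by blast
    have "P * P = k \<cdot>\<^sub>m P"
      unfolding k using mult_smult_assoc_mat[of "1\<^sub>m n" n n "k \<cdot>\<^sub>m 1\<^sub>m n" n k] by simp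
    then have "(k \<cdot>\<^sub>m P) $$ (0, 0) = P $$ (0, 0)" using P(2) by simp
    then have "k * k = k" unfolding k using n by simp
    then have "k = 0 \<or> k = 1" by simp
    then show False
    proof
      assume "k = 0"
      then have "P = 0\<^sub>m n n" unfolding k by (intro eq_matI) auto
      then have "idem_factor n 0 P (0\<^sub>m n 0) (0\<^sub>m 0 n)"
        unfolding idem_factor_def by (auto intro!: eq_matI simp: scalar_prod_def)
      then show False using idem_factor_rank P(3) i by force
    next
      assume "k = 1"
      then have "P = 1\<^sub>m n" unfolding k by (intro eq_matI) auto
      then have "idem_factor n n P (1\<^sub>m n) (1\<^sub>m n)"
        unfolding idem_factor_def by simp
      then show False using idem_factor_rank P(3) i by force
    qed
  qed
  then show "X \<in> commuting_C2 n" unfolding X commuting_C2_iff[OF n] using A B P by blast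
qed

section \<open>Polynomial parametrisation and irreducibility of Z_i\<close>

lemma conj_mult:
  fixes Q Q' M N :: "'k::field mat"
  assumes "Q \<in> carrier_mat n n" "Q' \<in> carrier_mat n n" "M \<in> carrier_mat n n" "N \<in> carrier_mat n n"
    and "Q' * Q = 1\<^sub>m n"
  shows "Q * M * Q' * (Q * N * Q') = Q * (M * N) * Q'"
proof -
  have "Q * M * Q' * (Q * N * Q') = Q * M * Q' * (Q * (N * Q'))"
    using assms assoc_mult_mat[of Q n n N n Q' n] by simp
  also have "\<dots> = Q * M * (Q' * Q) * (N * Q')"
    using assms by (intro assoc_mult_mat4[symmetric]) auto
  also have "\<dots> = Q * M * (N * Q')" unfolding assms(5) using assms by simp
  also have "\<dots> = Q * (M * N) * Q'"
    using assms by (intro assoc_mult_mat4[symmetric]) auto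
  finally show ?thesis .
qed

lemma adj_mat_smult_inverse:
  fixes Q :: "'k::field mat"
  assumes Q: "Q \<in> carrier_mat n n" and Q': "Q' \<in> carrier_mat n n" and QQ': "Q * Q' = 1\<^sub>m n"
  shows "adj_mat Q = det Q \<cdot>\<^sub>m Q'"
proof -
  note adj = adj_mat[OF Q]
  have "adj_mat Q = adj_mat Q * (Q * Q')" unfolding QQ' using adj by simp
  also have "\<dots> = (adj_mat Q * Q) * Q'" using assoc_mult_mat[OF adj(1) Q Q'] by simp
  also have "\<dots> = det Q \<cdot>\<^sub>m Q'" unfolding adj(3) using Q' mult_smult_assoc_mat[of "1\<^sub>m n" n n Q' n] by simp
  finally show ?thesis .
qed

text \<open>The adjugate keeps the parametrisation polynomial where the inverse would not. The
  factor \<open>det Q\<close> that it introduces is absorbed into \<open>M\<close> and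
  \<open>N\<close>, since commuting with \<open>proj_mat n r\<close> is stable under
  scaling.\<close>

lemma commuting_Z_param:
  fixes A B :: "'k::field mat"
  assumes r: "r \<le> n"
  shows "(A, B) \<in> commuting_Z n r \<longleftrightarrow> (\<exists>Q\<in>carrier_mat n n. \<exists>M\<in>carrier_mat n n. \<exists>N\<in>carrier_mat n n.
    det Q \<noteq> 0 \<and> M * proj_mat n r = proj_mat n r * M \<and> N * proj_mat n r = proj_mat n r * N \<and>
    A = Q * M * adj_mat Q \<and> B = Q * N * adj_mat Q)"
proof
  let ?E = "proj_mat n r :: 'k mat"
  have E: "?E \<in> carrier_mat n n" by simp
  assume "(A, B) \<in> commuting_Z n r"
  then obtain P where A: "A \<in> carrier_mat n n" and B: "B \<in> carrier_mat n n"
    and P: "P \<in> carrier_mat n n" "P * P = P" "vec_space.rank n P = r" "A * P = P * A" "B * P = P * B"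
    by (auto elim: commuting_ZE)
  obtain Q Q' where Q: "Q \<in> carrier_mat n n" and Q': "Q' \<in> carrier_mat n n"
    and QQ': "Q * Q' = 1\<^sub>m n" and Q'Q: "Q' * Q = 1\<^sub>m n" and PQ: "P = Q * ?E * Q'"
    using idempotent_diagonal(2)[OF P(1,2)] P(3) by auto
  have d: "det Q \<noteq> 0" using det_mult[OF Q Q'] unfolding QQ' by auto
  have E': "?E = Q' * P * Q"
  proof -
    have "Q' * P * Q = Q' * (Q * (?E * Q')) * Q" unfolding PQ using assoc_mult_mat[OF Q E Q'] by simp
    also have "\<dots> = Q' * Q * (?E * Q' * Q)"
      by (rule assoc_mult_mat4[OF Q' Q mult_carrier_mat[OF E Q'] Q])
    also have "\<dots> = ?E * Q' * Q"
      unfolding Q'Q by (rule left_mult_one_mat[OF mult_carrier_mat[OF mult_carrier_mat[OF E Q'] Q]])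
    also have "\<dots> = ?E" unfolding assoc_mult_mat[OF E Q' Q] Q'Q by (rule right_mult_one_mat[OF E])
    finally show ?thesis ..
  qed
  have *: "\<exists>M\<in>carrier_mat n n. M * ?E = ?E * M \<and> T = Q * M * adj_mat Q"
    if T: "T \<in> carrier_mat n n" and TP: "T * P = P * T" for T
  proof -
    define M where "M = Q' * T * Q"
    have Q'T: "Q' * T \<in> carrier_mat n n" using Q' T by simp
    have M: "M \<in> carrier_mat n n" unfolding M_def using Q'T Q by simp
    have ME: "M * ?E = ?E * M"
      unfolding M_def E' conj_mult[OF Q' Q T P(1) QQ'] conj_mult[OF Q' Q P(1) T QQ'] TP ..
    have "Q * M * Q' = T"
    proof -
      have "Q * M * Q' = Q * (Q' * (T * Q)) * Q'" unfolding M_def using assoc_mult_mat[OF Q' T Q] by simp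
      also have "\<dots> = Q * Q' * (T * Q * Q')"
        by (rule assoc_mult_mat4[OF Q Q' mult_carrier_mat[OF T Q] Q'])
      also have "\<dots> = T" unfolding QQ' assoc_mult_mat[OF T Q Q'] using T by simp
      finally show ?thesis .
    qed
    moreover have "Q * (inverse (det Q) \<cdot>\<^sub>m M) * adj_mat Q = inverse (det Q) \<cdot>\<^sub>m (det Q \<cdot>\<^sub>m (Q * M * Q'))"
      unfolding adj_mat_smult_inverse[OF Q Q' QQ'] mult_smult_distrib[OF Q M]
        mult_smult_assoc_mat[OF mult_carrier_mat[OF Q M] smult_carrier_mat[OF Q']]
        mult_smult_distrib[OF mult_carrier_mat[OF Q M] Q'] ..
    ultimately have TM: "T = Q * (inverse (det Q) \<cdot>\<^sub>m M) * adj_mat Q"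
      using T d by (auto intro!: eq_matI)
    have "(inverse (det Q) \<cdot>\<^sub>m M) * ?E = ?E * (inverse (det Q) \<cdot>\<^sub>m M)"
      using mult_smult_assoc_mat[OF M E] mult_smult_distrib[OF E M] ME by simp
    with TM M show ?thesis by (intro bexI[of _ "inverse (det Q) \<cdot>\<^sub>m M"]) auto
  qed
  from *[OF A P(4)] *[OF B P(5)] d Q
  show "\<exists>Q\<in>carrier_mat n n. \<exists>M\<in>carrier_mat n n. \<exists>N\<in>carrier_mat n n.
    det Q \<noteq> 0 \<and> M * ?E = ?E * M \<and> N * ?E = ?E * N \<and>
    A = Q * M * adj_mat Q \<and> B = Q * N * adj_mat Q" by blast
next
  let ?E = "proj_mat n r :: 'k mat"
  have E: "?E \<in> carrier_mat n n" by simp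
  assume "\<exists>Q\<in>carrier_mat n n. \<exists>M\<in>carrier_mat n n. \<exists>N\<in>carrier_mat n n.
    det Q \<noteq> 0 \<and> M * ?E = ?E * M \<and> N * ?E = ?E * N \<and>
    A = Q * M * adj_mat Q \<and> B = Q * N * adj_mat Q"
  then obtain Q M N where Q: "Q \<in> carrier_mat n n" "det Q \<noteq> 0"
    and M: "M \<in> carrier_mat n n" "M * ?E = ?E * M" "A = Q * M * adj_mat Q"
    and N: "N \<in> carrier_mat n n" "N * ?E = ?E * N" "B = Q * N * adj_mat Q" by blast
  note adj = adj_mat[OF Q(1)]
  define Q' where "Q' = inverse (det Q) \<cdot>\<^sub>m adj_mat Q"
  have Q': "Q' \<in> carrier_mat n n" unfolding Q'_def using adj by simp
  have Q'Q: "Q' * Q = 1\<^sub>m n"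
    unfolding Q'_def mult_smult_assoc_mat[OF adj(1) Q(1)] adj(3) using Q(2) by (intro eq_matI) auto
  have adjQ: "adj_mat Q = det Q \<cdot>\<^sub>m Q'"
    unfolding Q'_def using adj Q(2) by (intro eq_matI) auto
  have *: "Q * T * adj_mat Q * (Q * ?E * Q') = Q * ?E * Q' * (Q * T * adj_mat Q)"
    if T: "T \<in> carrier_mat n n" "T * ?E = ?E * T" for T
  proof -
    have "Q * T * adj_mat Q = Q * (det Q \<cdot>\<^sub>m T) * Q'"
      unfolding adjQ using T Q Q'
      by (simp add: mult_smult_assoc_mat[of _ n n _ n] mult_smult_distrib[of _ n n _ n])
    moreover have "(det Q \<cdot>\<^sub>m T) * ?E = ?E * (det Q \<cdot>\<^sub>m T)"
      using mult_smult_assoc_mat[OF T(1) E] mult_smult_distrib[OF E T(1)] T(2) by simp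
    ultimately show ?thesis
      using conj_mult[OF Q(1) Q' _ E Q'Q, of "det Q \<cdot>\<^sub>m T"] conj_mult[OF Q(1) Q' E _ Q'Q, of "det Q \<cdot>\<^sub>m T"] T(1)
      by simp
  qed
  note P = conj_proj_mat_rank[OF Q(1) Q' Q'Q r]
  show "(A, B) \<in> commuting_Z n r"
    by (rule commuting_ZI[OF _ _ P]) (use M N Q adj * in auto)
qed

text \<open>Parameters of two points are interpolated linearly: block diagonality is a linear
  condition and survives, and the determinant of the interpolated \<open>Q\<close> is a polynomial
  nonzero at \<open>0\<close>, so only finitely many parameters leave Z_r.\<close>

lemma irreducible_commuting_Z:
  assumes r: "r \<le> n"
  shows "irreducible_variety n (zariski_closure n (commuting_Z n r :: 'k::alg_closed_field mat_pair set))"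
proof (rule irreducible_zariski_closure[OF commuting_Z_subset])
  let ?E = "proj_mat n r :: 'k mat"
  have E: "?E \<in> carrier_mat n n" by simp
  define lin where "lin M N t = M + t \<cdot>\<^sub>m (N - M)" for M N :: "'k mat" and t
  have linc: "lin M N t \<in> carrier_mat n n"
    and lin0: "lin M N 0 = M" and lin1: "lin M N 1 = N"
    and linp: "lin M N \<in> uf.mats n n"
    if M: "M \<in> carrier_mat n n" and N: "N \<in> carrier_mat n n" for M N t
  proof -
    have NM: "N - M \<in> carrier_mat n n" using M by (rule minus_carrier_mat)
    show "lin M N t \<in> carrier_mat n n" unfolding lin_def using M NM by simp
    show "lin M N 0 = M" "lin M N 1 = N" unfolding lin_def using M N by (auto intro!: eq_matI)
    show "lin M N \<in> uf.mats n n"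
      unfolding lin_def using M NM by (intro uf.mats_add uf.mats_smult uf.mats_const id_upoly_fun)
  qed
  have linE: "lin M N t * ?E = ?E * lin M N t"
    if M: "M \<in> carrier_mat n n" and N: "N \<in> carrier_mat n n"
      and ME: "M * ?E = ?E * M" and NE: "N * ?E = ?E * N" for M N t
  proof -
    have NM: "N - M \<in> carrier_mat n n" using M by (rule minus_carrier_mat)
    have tNM: "t \<cdot>\<^sub>m (N - M) \<in> carrier_mat n n" using NM by simp
    show ?thesis
      unfolding lin_def add_mult_distrib_mat[OF M tNM E] mult_add_distrib_mat[OF E M tNM]
        mult_smult_assoc_mat[OF NM E] mult_smult_distrib[OF E NM]
        minus_mult_distrib_mat[OF N M E] mult_minus_distrib_mat[OF E N M] ME NE ..
  qed
  fix X Y :: "'k mat_pair" assume X: "X \<in> commuting_Z n r" and Y: "Y \<in> commuting_Z n r"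
  obtain Q M N where Q: "Q \<in> carrier_mat n n" "det Q \<noteq> 0" and M: "M \<in> carrier_mat n n" "M * ?E = ?E * M"
    and N: "N \<in> carrier_mat n n" "N * ?E = ?E * N" and XQ: "X = (Q * M * adj_mat Q, Q * N * adj_mat Q)"
    using X commuting_Z_param[OF r, of "fst X" "snd X"] by (metis prod.collapse)
  obtain Q' M' N' where Q': "Q' \<in> carrier_mat n n" "det Q' \<noteq> 0" and M': "M' \<in> carrier_mat n n" "M' * ?E = ?E * M'"
    and N': "N' \<in> carrier_mat n n" "N' * ?E = ?E * N'" and YQ: "Y = (Q' * M' * adj_mat Q', Q' * N' * adj_mat Q')"
    using Y commuting_Z_param[OF r, of "fst Y" "snd Y"] by (metis prod.collapse)
  let ?q = "lin Q Q'"
  let ?a = "\<lambda>t. ?q t * lin M M' t * adj_mat (?q t)" and ?b = "\<lambda>t. ?q t * lin N N' t * adj_mat (?q t)"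
  let ?T = "{t. det (?q t) = 0}"
  have q: "?q \<in> uf.mats n n" by (rule linp[OF Q(1) Q'(1)])
  have "?a \<in> uf.mats n n" "?b \<in> uf.mats n n"
    by (rule uf.mats_mult[OF uf.mats_mult[OF q linp] uf.mats_adj[OF q]]; fact)+
  moreover have "(?a 0, ?b 0) = X" "(?a 1, ?b 1) = Y"
    unfolding XQ YQ using lin0 lin1 Q Q' M M' N N' by auto
  moreover have "finite ?T"
    by (rule upoly_fun_finite_zeros[OF uf.det[OF q], of 0]) (use lin0[OF Q(1) Q'(1)] Q(2) in simp)
  moreover have "(?a t, ?b t) \<in> commuting_Z n r" if "t \<notin> ?T" for t
    unfolding commuting_Z_param[OF r]
    using that linc[OF Q(1) Q'(1)] linc[OF M(1) M'(1)] linc[OF N(1) N'(1)]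
      linE[OF M(1) M'(1) M(2) M'(2)] linE[OF N(1) N'(1) N(2) N'(2)] by blast
  ultimately show "\<exists>a b T. a \<in> uf.mats n n \<and> b \<in> uf.mats n n \<and> (a 0, b 0) = X \<and> (a 1, b 1) = Y \<and>
      finite T \<and> (\<forall>t. t \<notin> T \<longrightarrow> (a t, b t) \<in> commuting_Z n r)"
    by (intro exI[of _ ?a] exI[of _ ?b] exI[of _ ?T]) blast
qed

section \<open>An alternating polynomial separating the components\<close>

fun mat_chain :: "'k::comm_ring_1 mat \<Rightarrow> (nat \<Rightarrow> 'k mat) \<Rightarrow> nat \<Rightarrow> 'k mat" where
  "mat_chain B x 0 = x 0"
| "mat_chain B x (Suc m) = mat_chain B x m * B * x (Suc m)"

lemma mat_chain_carrier:
  "B \<in> carrier_mat n n \<Longrightarrow> (\<And>s. x s \<in> carrier_mat n n) \<Longrightarrow> mat_chain B x m \<in> carrier_mat n n"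
  by (induction m) (auto intro!: mult_carrier_mat[of _ n n])

text \<open>The Capelli polynomial in the \<open>m + 1\<close> matrices
  \<open>x 0, ..., x m\<close>, with all separating variables set to \<open>B\<close>.\<close>

definition alt_chain :: "nat \<Rightarrow> nat \<Rightarrow> 'k::comm_ring_1 mat \<Rightarrow> (nat \<Rightarrow> 'k mat) \<Rightarrow> 'k mat" where
  "alt_chain n m B x =
     lincomb_mat n n {p. p permutes {0..<Suc m}} signof (\<lambda>p. mat_chain B (x \<circ> p) m)"

lemma alt_chain_carrier [simp]: "alt_chain n m B x \<in> carrier_mat n n"
  unfolding alt_chain_def by simp

text \<open>Expanding the products of a chain entrywise turns the alternating sum into a sum of
  determinants \<open>det (x\<^sub>s $$ (u\<^sub>r, v\<^sub>r))\<^sub>r\<^sub>s\<close>, which vanish because of the linear dependency.\<close>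

lemma alt_chain_dependent:
  fixes x :: "nat \<Rightarrow> 'k::field mat"
  assumes B: "B \<in> carrier_mat n n" and x: "\<And>s. x s \<in> carrier_mat n n"
    and dep: "\<And>i j. i < n \<Longrightarrow> j < n \<Longrightarrow> (\<Sum>s<Suc M. c s * x s $$ (i, j)) = 0"
    and c: "s0 < Suc M" "c s0 \<noteq> 0"
  shows "alt_chain n M B x = 0\<^sub>m n n"
proof -
  let ?S = "{p. p permutes {0..<Suc M}}"
  \<comment> \<open>A chain expanded only beyond position \<open>m\<close>: the later factors are
    replaced by single entries at fixed positions \<open>(u r, w r)\<close>. At \<open>m = 0\<close>
    a determinant is reached, while at \<open>m = M\<close> the product is empty and the whole chain
    remains.\<close>
  have claim: "(\<Sum>p\<in>?S. signof p * (mat_chain B (x \<circ> p) m $$ (a, b) *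
      (\<Prod>r\<in>{Suc m..<Suc M}. x (p r) $$ (u r, w r)))) = 0"
    if "m \<le> M" "a < n" "b < n" "\<And>r. u r < n" "\<And>r. w r < n" for m a b u w
    using that
  proof (induction m arbitrary: a b u w)
    case 0
    \<comment> \<open>Row \<open>r\<close> lists one fixed entry of all the matrices
      \<open>x s\<close>; row \<open>0\<close> takes the position \<open>(a, b)\<close> of the
      one-term chain. The dependency \<open>c\<close> becomes a kernel vector of
      \<open>T\<close>.\<close>
    define T where "T = mat (Suc M) (Suc M) (\<lambda>(r, s). x s $$ ((u(0 := a)) r, (w(0 := b)) r))"
    have T: "T \<in> carrier_mat (Suc M) (Suc M)" unfolding T_def by simp
    define v where "v = vec (Suc M) c"
    have "T *\<^sub>v v = 0\<^sub>v (Suc M)"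
    proof (rule eq_vecI)
      fix r assume "r < dim_vec (0\<^sub>v (Suc M) :: 'k vec)"
      then have r: "r < Suc M" by simp
      have "(T *\<^sub>v v) $ r = (\<Sum>s<Suc M. c s * x s $$ ((u(0 := a)) r, (w(0 := b)) r))"
        using r T by (auto simp: scalar_prod_def v_def T_def atLeast0LessThan ac_simps intro!: sum.cong)
      also have "\<dots> = 0" by (rule dep) (use 0 in auto)
      finally show "(T *\<^sub>v v) $ r = 0\<^sub>v (Suc M) $ r" using r by simp
    qed (use T in simp)
    moreover have "v \<noteq> 0\<^sub>v (Suc M)"
    proof
      assume "v = 0\<^sub>v (Suc M)"
      from arg_cong[OF this, of "\<lambda>v. v $ s0"] show False using c by (simp add: v_def)
    qed
    moreover have "v \<in> carrier_vec (Suc M)" unfolding v_def by simp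
    ultimately have "det T = 0" using det_0_iff_vec_prod_zero_field[OF T] by blast
    moreover have "det T = (\<Sum>p\<in>?S. signof p * (mat_chain B (x \<circ> p) 0 $$ (a, b) *
      (\<Prod>r\<in>{Suc 0..<Suc M}. x (p r) $$ (u r, w r))))"
      unfolding det_def'[OF T]
    proof (rule sum.cong[OF refl], rule arg_cong[where f = "(*) _"])
      fix p assume "p \<in> ?S"
      then have p: "p r < Suc M" if "r < Suc M" for r
        using permutes_in_image[of p "{0..<Suc M}" r] that by simp
      have "(\<Prod>r=0..<Suc M. T $$ (r, p r)) = T $$ (0, p 0) * (\<Prod>r=Suc 0..<Suc M. T $$ (r, p r))"
        by (rule prod.atLeast_Suc_lessThan) simp
      also have "T $$ (0, p 0) = x (p 0) $$ (a, b)" unfolding T_def using p[of 0] by simp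
      also have "(\<Prod>r=Suc 0..<Suc M. T $$ (r, p r)) = (\<Prod>r\<in>{Suc 0..<Suc M}. x (p r) $$ (u r, w r))"
        by (rule prod.cong) (use p in \<open>auto simp: T_def\<close>)
      finally show "(\<Prod>r=0..<Suc M. T $$ (r, p r)) = mat_chain B (x \<circ> p) 0 $$ (a, b) *
        (\<Prod>r\<in>{Suc 0..<Suc M}. x (p r) $$ (u r, w r))" by simp
    qed
    ultimately show ?case by simp
  next
    case (Suc m)
    have ch: "mat_chain B (x \<circ> p) m \<in> carrier_mat n n" for p
      by (rule mat_chain_carrier[OF B]) (simp add: x)
    \<comment> \<open>The summation indices on the two sides of \<open>B\<close> turn into the
      column index of the shorter chain and the row index of the factor split off.\<close>
    have entry: "mat_chain B (x \<circ> p) (Suc m) $$ (a, b)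
        = (\<Sum>d<n. \<Sum>e<n. B $$ (e, d) * (mat_chain B (x \<circ> p) m $$ (a, e) * x (p (Suc m)) $$ (d, b)))" for p
    proof -
      have "mat_chain B (x \<circ> p) (Suc m) = mat_chain B (x \<circ> p) m * B * x (p (Suc m))" by simp
      then have "mat_chain B (x \<circ> p) (Suc m) $$ (a, b)
          = (\<Sum>d<n. (mat_chain B (x \<circ> p) m * B) $$ (a, d) * x (p (Suc m)) $$ (d, b))"
        by (simp only: mat_mult_index[OF mult_carrier_mat[OF ch B] x Suc.prems(2,3)])
      also have "\<dots> = (\<Sum>d<n. \<Sum>e<n. B $$ (e, d) *
          (mat_chain B (x \<circ> p) m $$ (a, e) * x (p (Suc m)) $$ (d, b)))"
      proof (rule sum.cong[OF refl])
        fix d assume "d \<in> {..<n}"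
        then have d: "d < n" by simp
        show "(mat_chain B (x \<circ> p) m * B) $$ (a, d) * x (p (Suc m)) $$ (d, b)
          = (\<Sum>e<n. B $$ (e, d) * (mat_chain B (x \<circ> p) m $$ (a, e) * x (p (Suc m)) $$ (d, b)))"
          unfolding mat_mult_index[OF ch B Suc.prems(2) d] sum_distrib_right
          by (rule sum.cong) (auto simp: ac_simps)
      qed
      finally show ?thesis .
    qed
    have prod: "(\<Prod>r\<in>{Suc m..<Suc M}. x (p r) $$ ((u(Suc m := d)) r, (w(Suc m := b)) r))
        = x (p (Suc m)) $$ (d, b) * (\<Prod>r\<in>{Suc (Suc m)..<Suc M}. x (p r) $$ (u r, w r))" for p d
    proof -
      have "(\<Prod>r\<in>{Suc m..<Suc M}. x (p r) $$ ((u(Suc m := d)) r, (w(Suc m := b)) r))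
        = x (p (Suc m)) $$ ((u(Suc m := d)) (Suc m), (w(Suc m := b)) (Suc m)) *
          (\<Prod>r\<in>{Suc (Suc m)..<Suc M}. x (p r) $$ ((u(Suc m := d)) r, (w(Suc m := b)) r))"
        by (rule prod.atLeast_Suc_lessThan) (use Suc.prems in simp)
      also have "(\<Prod>r\<in>{Suc (Suc m)..<Suc M}. x (p r) $$ ((u(Suc m := d)) r, (w(Suc m := b)) r))
        = (\<Prod>r\<in>{Suc (Suc m)..<Suc M}. x (p r) $$ (u r, w r))"
        by (rule prod.cong) auto
      finally show ?thesis by simp
    qed
    have "(\<Sum>p\<in>?S. signof p * (mat_chain B (x \<circ> p) (Suc m) $$ (a, b) *
        (\<Prod>r\<in>{Suc (Suc m)..<Suc M}. x (p r) $$ (u r, w r))))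
      = (\<Sum>p\<in>?S. \<Sum>d<n. \<Sum>e<n. B $$ (e, d) * (signof p * (mat_chain B (x \<circ> p) m $$ (a, e) *
        (\<Prod>r\<in>{Suc m..<Suc M}. x (p r) $$ ((u(Suc m := d)) r, (w(Suc m := b)) r)))))"
      unfolding entry prod sum_distrib_right sum_distrib_left
      by (intro sum.cong refl) (simp add: ac_simps)
    also have "\<dots> = (\<Sum>d<n. \<Sum>e<n. B $$ (e, d) * (\<Sum>p\<in>?S. signof p * (mat_chain B (x \<circ> p) m $$ (a, e) *
        (\<Prod>r\<in>{Suc m..<Suc M}. x (p r) $$ ((u(Suc m := d)) r, (w(Suc m := b)) r)))))"
      unfolding sum_distrib_left
      by (subst sum.swap, rule sum.cong[OF refl], rule sum.swap)
    also have "\<dots> = 0"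
      by (intro sum.neutral ballI) (subst Suc.IH, use Suc.prems in auto)
    finally show ?case .
  qed
  show ?thesis
  proof (rule mat_eqI[of _ n n])
    fix i j assume ij: "i < n" "j < n"
    show "alt_chain n M B x $$ (i, j) = 0\<^sub>m n n $$ (i, j)"
      unfolding alt_chain_def lincomb_mat_index[OF ij]
      using claim[of M i j "\<lambda>_. i" "\<lambda>_. i"] ij by simp
  qed auto
qed

text \<open>\<open>P\<close> moves left through the chain, and \<open>P P = P\<close> allows a copy
  to stay behind at every factor.\<close>

lemma mat_chain_idempotent:
  fixes P :: "'k::comm_ring_1 mat"
  assumes B: "B \<in> carrier_mat n n" and P: "P \<in> carrier_mat n n" and x: "\<And>s. x s \<in> carrier_mat n n"
    and PP: "P * P = P" and BP: "B * P = P * B" and xP: "\<And>s. x s * P = P * x s"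
  shows "mat_chain B x m * P = mat_chain B (\<lambda>s. x s * P) m"
proof (induction m)
  case (Suc m)
  let ?c = "mat_chain B x m" and ?y = "x (Suc m)"
  have c: "?c \<in> carrier_mat n n" by (rule mat_chain_carrier[OF B x])
  have cB: "?c * B \<in> carrier_mat n n" by (rule mult_carrier_mat[OF c B])
  have y: "?y * P \<in> carrier_mat n n" by (rule mult_carrier_mat[OF x P])
  have "?c * B * ?y * P = ?c * B * (?y * P)" by (rule assoc_mult_mat[OF cB x P])
  also have "?y * P = P * (?y * P)"
  proof -
    have "?y * P = ?y * (P * P)" by (simp only: PP)
    also have "\<dots> = ?y * P * P" by (rule assoc_mult_mat[OF x P P, symmetric])
    also have "\<dots> = P * ?y * P" by (simp only: xP)
    also have "\<dots> = P * (?y * P)" by (rule assoc_mult_mat[OF P x P])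
    finally show ?thesis .
  qed
  also have "?c * B * (P * (?y * P)) = ?c * B * P * (?y * P)"
    by (rule assoc_mult_mat[OF cB P y, symmetric])
  also have "?c * B * P = ?c * (P * B)" unfolding BP[symmetric] by (rule assoc_mult_mat[OF c B P])
  also have "\<dots> = ?c * P * B" by (rule assoc_mult_mat[OF c P B, symmetric])
  finally show ?case unfolding Suc by simp
qed simp

definition alt_poly :: "nat \<Rightarrow> nat \<Rightarrow> 'k::comm_ring_1 mat_pair \<Rightarrow> 'k mat" where
  "alt_poly n m X = alt_chain n m (snd X) (\<lambda>s. fst X ^\<^sub>m s)"

lemma alt_poly_poly: "alt_poly n m \<in> pf.mats n n n"
proof -
  have "(\<lambda>X. mat_chain (snd X) ((\<lambda>s. fst X ^\<^sub>m s) \<circ> p) k) \<in> pf.mats n n n" for p k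
  proof (induction k)
    case 0
    show ?case using pf.mats_pow[OF fst_poly_mats, where k = "p 0"] by (simp add: comp_def)
  next
    case (Suc k)
    from pf.mats_mult[OF pf.mats_mult[OF Suc snd_poly_mats] pf.mats_pow[OF fst_poly_mats, where k = "p (Suc k)"]]
    show ?case by (simp add: comp_def)
  qed
  then show ?thesis
    unfolding alt_poly_def alt_chain_def
    by (intro pf.matsI)
      (auto simp: lincomb_mat_index intro!: pf.sum pf.mult pf.const pf.mats_index)
qed

text \<open>On the image of \<open>P\<close> the powers \<open>A\<^sup>0, \<dots>, A\<^sup>r\<close> are linearly dependent by Cayley-Hamilton.\<close>

lemma alt_poly_idempotent:
  fixes A B P :: "'k::field mat"
  assumes A: "A \<in> carrier_mat n n" and B: "B \<in> carrier_mat n n" and P: "P \<in> carrier_mat n n"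
    and PP: "P * P = P" and AP: "A * P = P * A" and BP: "B * P = P * B"
    and rank: "vec_space.rank n P \<le> m"
  shows "alt_poly n m (A, B) * P = 0\<^sub>m n n"
proof -
  define r where "r = vec_space.rank n P"
  obtain F H where FH: "idem_factor n r P F H" using idempotent_factor[OF P PP] unfolding r_def by blast
  then have F: "F \<in> carrier_mat n r" and H: "H \<in> carrier_mat r n" and FHP: "F * H = P"
    and HF: "H * F = 1\<^sub>m r" unfolding idem_factor_def by auto
  have Ap: "A ^\<^sub>m s \<in> carrier_mat n n" for s using A by simp
  have ApP: "A ^\<^sub>m s * P = P * A ^\<^sub>m s" for s by (rule pow_mat_commute[OF A P AP[symmetric], symmetric])
  \<comment> \<open>The matrix of \<open>A\<close> on the image of \<open>P\<close>, in the basis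
    formed by the columns of \<open>F\<close>; its size is \<open>r\<close> instead of
    \<open>n\<close>.\<close>
  define L where "L = H * A * F"
  have HA: "H * A \<in> carrier_mat r n" using H A by (rule mult_carrier_mat)
  have L: "L \<in> carrier_mat r r" unfolding L_def using HA F by (rule mult_carrier_mat)
  have Lp: "L ^\<^sub>m s \<in> carrier_mat r r" for s using L by simp
  have PF: "P * F = F" using assoc_mult_mat[OF F H F] F unfolding FHP HF by simp
  have AF: "A * F = F * L"
  proof -
    have "F * L = F * (H * (A * F))" unfolding L_def by (simp only: assoc_mult_mat[OF H A F])
    also have "\<dots> = P * (A * F)"
      unfolding FHP[symmetric] by (rule assoc_mult_mat[OF F H mult_carrier_mat[OF A F], symmetric])
    also have "\<dots> = P * A * F" by (rule assoc_mult_mat[OF P A F, symmetric])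
    also have "\<dots> = A * F" unfolding AP[symmetric] assoc_mult_mat[OF A P F] PF ..
    finally show ?thesis ..
  qed
  have ApF: "A ^\<^sub>m s * F = F * L ^\<^sub>m s" for s
  proof (induction s)
    case (Suc s)
    have "A ^\<^sub>m Suc s * F = A ^\<^sub>m s * (F * L)"
      unfolding pow_mat.simps assoc_mult_mat[OF Ap A F] AF ..
    also have "\<dots> = F * L ^\<^sub>m s * L" unfolding Suc[symmetric] by (rule assoc_mult_mat[OF Ap F L, symmetric])
    also have "\<dots> = F * L ^\<^sub>m Suc s" unfolding pow_mat.simps by (rule assoc_mult_mat[OF F Lp L])
    finally show ?case .
  qed (use A F L in simp)
  \<comment> \<open>Coefficients of \<open>X^(m - r)\<close> times the characteristic polynomial of
    \<open>L\<close>: the shift makes the top power exactly \<open>m\<close>, and the leading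
    coefficient \<open>1\<close> makes the dependency nontrivial.\<close>
  define c where "c s = (if s < m - r then 0 else coeff (char_poly L) (s - (m - r)))" for s
  have cm: "c m = 1" unfolding c_def using rank degree_monic_char_poly[OF L] r_def by simp
  have dep: "(\<Sum>s<Suc m. c s * (A ^\<^sub>m s * P) $$ (i, j)) = 0" if ij: "i < n" "j < n" for i j
  proof -
    let ?T = "lincomb_mat r r {..r} (coeff (char_poly L)) (\<lambda>s. L ^\<^sub>m s)"
    let ?V = "A ^\<^sub>m (m - r) * F"
    have V: "?V \<in> carrier_mat n r" using Ap F by (rule mult_carrier_mat)
    have VT: "?V * L ^\<^sub>m s * H = A ^\<^sub>m (m - r + s) * P" for s
    proof -
      have "?V * L ^\<^sub>m s = A ^\<^sub>m (m - r) * (F * L ^\<^sub>m s)" by (rule assoc_mult_mat[OF Ap F Lp])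
      also have "\<dots> = A ^\<^sub>m (m - r) * A ^\<^sub>m s * F"
        unfolding ApF[symmetric] by (rule assoc_mult_mat[OF Ap Ap F, symmetric])
      finally show ?thesis unfolding pow_mat_add[OF A] FHP[symmetric]
        using assoc_mult_mat[OF mult_carrier_mat[OF Ap Ap] F H] by simp
    qed
    have VL: "?V * L ^\<^sub>m s \<in> carrier_mat n r" for s using V Lp by (rule mult_carrier_mat)
    have "?V * ?T * H = lincomb_mat n n {..r} (coeff (char_poly L)) (\<lambda>s. ?V * L ^\<^sub>m s * H)"
      unfolding mult_lincomb_mat[OF V Lp] by (rule lincomb_mat_mult[OF H VL])
    moreover have "?V * ?T * H = 0\<^sub>m n n"
      unfolding cayley_hamilton[OF L] right_mult_zero_mat[OF V] by (rule left_mult_zero_mat[OF H])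
    ultimately have z: "lincomb_mat n n {..r} (coeff (char_poly L)) (\<lambda>s. A ^\<^sub>m (m - r + s) * P) = 0\<^sub>m n n"
      unfolding VT by simp
    have "0 = lincomb_mat n n {..r} (coeff (char_poly L)) (\<lambda>s. A ^\<^sub>m (m - r + s) * P) $$ (i, j)"
      unfolding z using ij by simp
    also have "\<dots> = (\<Sum>s\<le>r. coeff (char_poly L) s * (A ^\<^sub>m (m - r + s) * P) $$ (i, j))"
      by (rule lincomb_mat_index[OF ij])
    also have "\<dots> = (\<Sum>s\<in>{m - r..m}. c s * (A ^\<^sub>m s * P) $$ (i, j))"
      by (rule sum.reindex_bij_witness[of _ "\<lambda>s. s - (m - r)" "\<lambda>s. s + (m - r)"])
        (use rank r_def in \<open>auto simp: c_def add.commute\<close>)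
    also have "\<dots> = (\<Sum>s<Suc m. c s * (A ^\<^sub>m s * P) $$ (i, j))"
      by (rule sum.mono_neutral_left) (auto simp: c_def)
    finally show ?thesis ..
  qed
  let ?S = "{p. p permutes {0..<Suc m}}"
  have ch: "mat_chain B ((\<lambda>s. A ^\<^sub>m s) \<circ> p) m \<in> carrier_mat n n" for p
    by (rule mat_chain_carrier[OF B]) (simp add: Ap)
  have "alt_poly n m (A, B) * P = lincomb_mat n n ?S signof (\<lambda>p. mat_chain B ((\<lambda>s. A ^\<^sub>m s) \<circ> p) m * P)"
    unfolding alt_poly_def alt_chain_def fst_conv snd_conv by (rule lincomb_mat_mult[OF P ch])
  also have "\<dots> = alt_chain n m B (\<lambda>s. A ^\<^sub>m s * P)"
    unfolding alt_chain_def
  proof (rule lincomb_mat_cong)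
    fix p
    have "mat_chain B (\<lambda>s. A ^\<^sub>m (p s)) m * P = mat_chain B (\<lambda>s. A ^\<^sub>m (p s) * P) m"
      by (rule mat_chain_idempotent[OF B P Ap PP BP ApP])
    then show "mat_chain B ((\<lambda>s. A ^\<^sub>m s) \<circ> p) m * P = mat_chain B ((\<lambda>s. A ^\<^sub>m s * P) \<circ> p) m"
      by (simp add: comp_def)
  qed
  also have "\<dots> = 0\<^sub>m n n"
    by (rule alt_chain_dependent[OF B mult_carrier_mat[OF Ap P] dep, of m]) (use cm in auto)
  finally show ?thesis .
qed

section \<open>The separating pair: a diagonal matrix and a permutation with two cycles\<close>

lemma vandermonde_det_nonzero:
  fixes l :: "nat \<Rightarrow> 'k::field"
  assumes inj: "inj_on l {..<k}"
  shows "det (mat k k (\<lambda>(r, s). l r ^ s)) \<noteq> 0"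
proof
  let ?V = "mat k k (\<lambda>(r, s). l r ^ s)"
  assume "det ?V = 0"
  then obtain v where v: "v \<in> carrier_vec k" "v \<noteq> 0\<^sub>v k" "?V *\<^sub>v v = 0\<^sub>v k"
    using det_0_iff_vec_prod_zero_field[of ?V k] by auto
  \<comment> \<open>A kernel vector would be the coefficient vector of a nonzero polynomial of
    degree below \<open>k\<close> with the \<open>k\<close> distinct roots
    \<open>l r\<close>.\<close>
  define p where "p = (\<Sum>s<k. monom (v $ s) s)"
  have coeff: "coeff p s = (if s < k then v $ s else 0)" for s
    unfolding p_def by (simp add: coeff_sum)
  obtain s where s: "s < k" "v $ s \<noteq> 0"
    using v(1,2) by (metis carrier_vecD eq_vecI index_zero_vec)
  then have p0: "p \<noteq> 0" using coeff[of s] by auto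
  have deg: "degree p < k"
    using s coeff p0 by (metis leading_coeff_0_iff)
  have "poly p (l r) = 0" if r: "r < k" for r
  proof -
    have "poly p (l r) = (\<Sum>s<k. v $ s * l r ^ s)" unfolding p_def by (simp add: poly_sum poly_monom)
    also have "\<dots> = (?V *\<^sub>v v) $ r"
      using r v(1) by (auto simp: scalar_prod_def atLeast0LessThan ac_simps intro!: sum.cong)
    finally show ?thesis unfolding v(3) using r by simp
  qed
  then have "l ` {..<k} \<subseteq> {x. poly p x = 0}" by auto
  then have "card (l ` {..<k}) \<le> card {x. poly p x = 0}"
    using poly_roots_finite[OF p0] by (intro card_mono) auto
  also have "\<dots> \<le> degree p" by (rule card_poly_roots_bound[OF p0])
  finally show False using deg card_image[OF inj] by simp
qed

text \<open>The \<open>s\<close>-th power of the permutation with cycles \<open>{0..<i}\<close> and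
  \<open>{i..<n}\<close>, in closed form, so that composition is addition of times modulo the cycle
  lengths.\<close>

definition block_cycle :: "nat \<Rightarrow> nat \<Rightarrow> nat \<Rightarrow> nat \<Rightarrow> nat" where
  "block_cycle n i s v = (if v < i then (v + s) mod i else i + (v - i + s) mod (n - i))"

lemma block_cycle_less:
  assumes "i < n" "v < n"
  shows "block_cycle n i s v < n"
proof (cases "v < i")
  case True
  then have "(v + s) mod i < i" by simp
  then have "(v + s) mod i < n" using assms(1) by (rule less_trans)
  then show ?thesis using True unfolding block_cycle_def by simp
next
  case False
  have "(v - i + s) mod (n - i) < n - i" using assms by simp
  then show ?thesis using False unfolding block_cycle_def by simp
qed

lemma block_cycle_less_iff: "i < n \<Longrightarrow> v < n \<Longrightarrow> block_cycle n i s v < i \<longleftrightarrow> v < i"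
  unfolding block_cycle_def by auto

lemma block_cycle_0: "v < n \<Longrightarrow> block_cycle n i 0 v = v"
  unfolding block_cycle_def by auto

lemma block_cycle_add:
  assumes "i < n" "v < n"
  shows "block_cycle n i s (block_cycle n i t v) = block_cycle n i (s + t) v"
proof (cases "v < i")
  case True
  have "((v + t) mod i + s) mod i = (v + (s + t)) mod i"
    unfolding mod_add_left_eq by (simp add: ac_simps)
  then show ?thesis using True unfolding block_cycle_def by simp
next
  case False
  have "((v - i + t) mod (n - i) + s) mod (n - i) = (v - i + (s + t)) mod (n - i)"
    unfolding mod_add_left_eq by (simp only: ac_simps)
  then show ?thesis using False unfolding block_cycle_def by simp
qed

lemma mod_add_inj:
  fixes a s t k :: nat
  assumes "s < k" "t < k" "(a + s) mod k = (a + t) mod k"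
  shows "s = t"
proof -
  have le: "s' = t'" if "s' \<le> t'" "t' < k" "(a + t') mod k = (a + s') mod k" for s' t'
  proof -
    have "k dvd (a + t') - (a + s')" using mod_eq_dvd_iff_nat[of "a + s'" "a + t'" k] that by simp
    then have "k dvd t' - s'" by simp
    then show ?thesis using that nat_dvd_not_less[of "t' - s'" k] by (cases "t' - s' = 0") auto
  qed
  show ?thesis using le[of s t] le[of t s] assms by (cases "s \<le> t") auto
qed

text \<open>An orbit returns only after a full cycle, so the \<open>m + 1\<close> points visited up
  to time \<open>m\<close> are distinct while \<open>m\<close> is below the cycle length.\<close>

lemma block_cycle_inj_time:
  assumes "i < n" "v < n" "s \<le> m" "t \<le> m" "m < (if v < i then i else n - i)"
    "block_cycle n i s v = block_cycle n i t v"
  shows "s = t"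
  using assms mod_add_inj[of s i t v] mod_add_inj[of s "n - i" t "v - i"]
  unfolding block_cycle_def by (auto split: if_splits)

lemma block_cycle_inj:
  assumes "0 < i" "i < n" "v < n" "w < n" "block_cycle n i s v = block_cycle n i s w"
  shows "v = w"
proof -
  have iff: "v < i \<longleftrightarrow> w < i" using block_cycle_less_iff assms by metis
  show ?thesis
  proof (cases "v < i")
    case True
    then show ?thesis using assms iff mod_add_inj[of v i w s]
      unfolding block_cycle_def by (auto simp: add.commute)
  next
    case False
    then have "v - i = w - i"
      using assms iff mod_add_inj[of "v - i" "n - i" "w - i" s]
      unfolding block_cycle_def by (auto simp: add.commute)
    then show ?thesis using False iff by simp
  qed
qed

definition cycle_mat :: "nat \<Rightarrow> nat \<Rightarrow> 'k::field mat" where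
  "cycle_mat n i = mat n n (\<lambda>(a, b). if a = block_cycle n i 1 b then 1 else 0)"

definition diagonal :: "nat \<Rightarrow> (nat \<Rightarrow> 'k::field) \<Rightarrow> 'k mat" where
  "diagonal n l = mat n n (\<lambda>(a, b). if a = b then l a else 0)"

lemma cycle_mat_carrier [simp]: "cycle_mat n i \<in> carrier_mat n n"
  unfolding cycle_mat_def by simp

lemma diagonal_carrier [simp]: "diagonal n l \<in> carrier_mat n n"
  unfolding diagonal_def by simp

lemma mult_diagonal_index:
  assumes M: "M \<in> carrier_mat n n" and ab: "a < n" "b < n"
  shows "(M * diagonal n l) $$ (a, b) = M $$ (a, b) * l b"
proof -
  have "(M * diagonal n l) $$ (a, b) = (\<Sum>k<n. if k = b then M $$ (a, b) * l b else 0)"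
    unfolding mat_mult_index[OF M diagonal_carrier ab]
    by (rule sum.cong) (use ab in \<open>auto simp: diagonal_def\<close>)
  then show ?thesis using ab by simp
qed

lemma mult_cycle_mat_index:
  assumes M: "M \<in> carrier_mat n n" and ab: "a < n" "b < n" and i: "i < n"
  shows "(M * cycle_mat n i) $$ (a, b) = M $$ (a, block_cycle n i 1 b)"
proof -
  have "(M * cycle_mat n i) $$ (a, b) = (\<Sum>k<n. if k = block_cycle n i 1 b then M $$ (a, block_cycle n i 1 b) else 0)"
    unfolding mat_mult_index[OF M cycle_mat_carrier ab]
    by (rule sum.cong) (use ab in \<open>auto simp: cycle_mat_def\<close>)
  then show ?thesis using block_cycle_less[OF i ab(2), of 1] by simp
qed

lemma diagonal_pow: "diagonal n l ^\<^sub>m s = diagonal n (\<lambda>a. l a ^ s)"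
proof (induction s)
  case 0
  have "dim_row (diagonal n l) = n" using diagonal_carrier by (rule carrier_matD)
  then show ?case by (auto intro!: eq_matI simp: diagonal_def)
next
  case (Suc s)
  show ?case
  proof (rule mat_eqI[of _ n n])
    show "diagonal n l ^\<^sub>m Suc s \<in> carrier_mat n n" by (rule pow_carrier_mat) simp
    fix a b assume ab: "a < n" "b < n"
    show "(diagonal n l ^\<^sub>m Suc s) $$ (a, b) = diagonal n (\<lambda>a. l a ^ Suc s) $$ (a, b)"
      unfolding pow_mat.simps Suc mult_diagonal_index[OF diagonal_carrier ab]
      using ab by (simp add: diagonal_def)
  qed simp
qed

text \<open>Read from right to left, each \<open>B\<close> moves the basis vector \<open>b\<close>
  one step along its cycle. The factor at position \<open>r\<close> meets it after
  \<open>m - r\<close> steps and contributes its diagonal entry there.\<close>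

lemma chain_cycle_diagonal:
  assumes i: "i < n" and ab: "a < n" "b < n"
  shows "mat_chain (cycle_mat n i) (\<lambda>s. diagonal n (l s)) m $$ (a, b)
    = (if a = block_cycle n i m b then \<Prod>r=0..<Suc m. l r (block_cycle n i (m - r) b) else 0)"
  using ab
proof (induction m arbitrary: b)
  case 0
  then show ?case by (simp add: diagonal_def block_cycle_0)
next
  case (Suc m)
  let ?c = "mat_chain (cycle_mat n i) (\<lambda>s. diagonal n (l s)) m"
  let ?b = "block_cycle n i 1 b"
  have c: "?c \<in> carrier_mat n n" by (rule mat_chain_carrier) auto
  have b: "?b < n" by (rule block_cycle_less[OF i Suc.prems(2)])
  have "mat_chain (cycle_mat n i) (\<lambda>s. diagonal n (l s)) (Suc m) $$ (a, b) = ?c $$ (a, ?b) * l (Suc m) b"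
    unfolding mat_chain.simps mult_diagonal_index[OF mult_carrier_mat[OF c cycle_mat_carrier] Suc.prems]
      mult_cycle_mat_index[OF c Suc.prems i] ..
  also have "?c $$ (a, ?b) = (if a = block_cycle n i (Suc m) b
      then \<Prod>r=0..<Suc m. l r (block_cycle n i (Suc m - r) b) else 0)"
    unfolding Suc.IH[OF Suc.prems(1) b] block_cycle_add[OF i Suc.prems(2)]
    by (auto intro!: prod.cong simp: Suc_diff_le)
  finally show ?case
    using block_cycle_0[OF Suc.prems(2), of i] by simp
qed

text \<open>Permuting the exponents only changes the powers of the diagonal entries met along the
  orbit, so the alternating sum is the Leibniz formula of a Vandermonde matrix. Each column has at
  most one nonzero entry.\<close>

lemma alt_poly_cycle:
  fixes l :: "nat \<Rightarrow> 'k::field"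
  assumes i: "i < n" and ab: "a < n" "b < n"
  shows "alt_poly n m (diagonal n l, cycle_mat n i) $$ (a, b)
    = (if a = block_cycle n i m b then det (mat (Suc m) (Suc m) (\<lambda>(r, s). l (block_cycle n i (m - r) b) ^ s)) else 0)"
proof -
  let ?V = "mat (Suc m) (Suc m) (\<lambda>(r, s). l (block_cycle n i (m - r) b) ^ s)"
  let ?S = "{p. p permutes {0..<Suc m}}"
  have "alt_poly n m (diagonal n l, cycle_mat n i) $$ (a, b)
    = (\<Sum>p\<in>?S. signof p * mat_chain (cycle_mat n i) (\<lambda>s. diagonal n (\<lambda>a. l a ^ p s)) m $$ (a, b))"
    unfolding alt_poly_def alt_chain_def lincomb_mat_index[OF ab] fst_conv snd_conv comp_def diagonal_pow ..
  also have "\<dots> = (\<Sum>p\<in>?S. if a = block_cycle n i m b then signof p * (\<Prod>r=0..<Suc m. ?V $$ (r, p r)) else 0)"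
  proof (rule sum.cong[OF refl])
    fix p assume "p \<in> ?S"
    then have p: "p r < Suc m" if "r < Suc m" for r
      using permutes_in_image[of p "{0..<Suc m}" r] that by simp
    have "(\<Prod>r=0..<Suc m. l (block_cycle n i (m - r) b) ^ p r) = (\<Prod>r=0..<Suc m. ?V $$ (r, p r))"
      by (rule prod.cong) (use p in auto)
    then show "signof p * mat_chain (cycle_mat n i) (\<lambda>s. diagonal n (\<lambda>a. l a ^ p s)) m $$ (a, b)
      = (if a = block_cycle n i m b then signof p * (\<Prod>r=0..<Suc m. ?V $$ (r, p r)) else 0)"
      unfolding chain_cycle_diagonal[OF i ab, of "\<lambda>s a. l a ^ p s"] by simp
  qed
  also have "\<dots> = (if a = block_cycle n i m b then det ?V else 0)"
    by (subst det_def'[of ?V "Suc m"]) auto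
  finally show ?thesis .
qed

lemma alt_poly_cycle_nonzero:
  fixes l :: "nat \<Rightarrow> 'k::field"
  assumes i: "i < n" and b: "b < n" and l: "inj_on l {..<n}" and m: "m < (if b < i then i else n - i)"
  shows "det (mat (Suc m) (Suc m) (\<lambda>(r, s). l (block_cycle n i (m - r) b) ^ s)) \<noteq> 0"
proof (rule vandermonde_det_nonzero, rule inj_onI)
  fix r s assume rs: "r \<in> {..<Suc m}" "s \<in> {..<Suc m}"
    and eq: "l (block_cycle n i (m - r) b) = l (block_cycle n i (m - s) b)"
  have "block_cycle n i (m - r) b = block_cycle n i (m - s) b"
    by (rule inj_onD[OF l eq]) (use block_cycle_less[OF i b] in auto)
  from block_cycle_inj_time[OF i b _ _ m this] have "m - r = m - s" by simp
  then show "r = s" using rs by auto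
qed

lemma cycle_in_commuting_Z:
  fixes l :: "nat \<Rightarrow> 'k::field"
  assumes i: "i < n"
  shows "(diagonal n l, cycle_mat n i) \<in> commuting_Z n i"
proof (rule commuting_ZI)
  let ?E = "proj_mat n i :: 'k mat"
  have "1\<^sub>m n * ?E * 1\<^sub>m n = ?E"
    unfolding left_mult_one_mat[OF proj_mat_carrier] right_mult_one_mat[OF proj_mat_carrier] ..
  then show "?E \<in> carrier_mat n n" "?E * ?E = ?E" "vec_space.rank n ?E = i"
    using conj_proj_mat_rank[of "1\<^sub>m n :: 'k mat" n "1\<^sub>m n" i] i by simp_all
  show "diagonal n l * ?E = ?E * diagonal n l"
  proof (rule mat_eqI[of _ n n])
    fix a b assume ab: "a < n" "b < n"
    show "(diagonal n l * ?E) $$ (a, b) = (?E * diagonal n l) $$ (a, b)"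
      unfolding mult_proj_mat_index[OF diagonal_carrier ab] proj_mat_mult_index[OF diagonal_carrier ab]
      using ab by (auto simp: diagonal_def)
  qed (auto intro: mult_carrier_mat[of _ n n])
  show "cycle_mat n i * ?E = ?E * cycle_mat n i"
  proof (rule mat_eqI[of _ n n])
    fix a b assume ab: "a < n" "b < n"
    show "(cycle_mat n i * ?E) $$ (a, b) = (?E * cycle_mat n i) $$ (a, b)"
      unfolding mult_proj_mat_index[OF cycle_mat_carrier ab] proj_mat_mult_index[OF cycle_mat_carrier ab]
      using ab block_cycle_less_iff[OF i ab(2), of 1] by (auto simp: cycle_mat_def)
  qed (auto intro: mult_carrier_mat[of _ n n])
qed auto

text \<open>For \<open>i < j\<close>: as \<open>j <= n - j\<close>, on Z_j the polynomial f_{n-j}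
  kills the images of both \<open>P\<close> and \<open>1 - P\<close>, but it is nonzero on the cycle
  of length \<open>n - i > n - j\<close>. For \<open>j < i\<close>: both cycles are longer than
  \<open>j\<close>, since \<open>j < i <= n - i\<close>, so f_j is an invertible monomial matrix at
  the separating pair, whereas on Z_j it kills the nonzero image of \<open>P\<close>.\<close>

lemma commuting_Z_not_subset:
  assumes i: "1 \<le> i" "i \<le> n div 2" and j: "1 \<le> j" "j \<le> n div 2" and ij: "i \<noteq> j"
  shows "\<not> zariski_closure n (commuting_Z n i :: 'k::alg_closed_field mat_pair set)
    \<subseteq> zariski_closure n (commuting_Z n j)"
proof
  assume sub: "zariski_closure n (commuting_Z n i :: 'k mat_pair set) \<subseteq> zariski_closure n (commuting_Z n j)"
  have "i < n" using i by linarith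
  obtain l :: "nat \<Rightarrow> 'k" where "inj l"
    using infinite_countable_subset[OF alg_closed_infinite] by blast
  then have l: "inj_on l {..<n}" by (rule inj_on_subset) simp
  let ?X = "(diagonal n l, cycle_mat n i) :: 'k mat_pair"
  have X: "?X \<in> zariski_closure n (commuting_Z n j)"
    using sub cycle_in_commuting_Z[OF \<open>i < n\<close>, of l] zariski_closure_superset by blast
  consider "i < j" | "j < i" using ij by linarith
  then show False
  proof cases
    case 1
    define m where "m = n - j"
    have "alt_poly n m X $$ (a, b) = 0"
      if X: "X \<in> commuting_Z n j" and ab: "a < n" "b < n" for X :: "'k mat_pair" and a b
      using X
    proof (rule commuting_ZE)
      fix A B P :: "'k mat"
      assume X: "X = (A, B)" and A: "A \<in> carrier_mat n n" and B: "B \<in> carrier_mat n n"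
        and P: "P \<in> carrier_mat n n" "P * P = P" "vec_space.rank n P = j" "A * P = P * A" "B * P = P * B"
      let ?f = "alt_poly n m X"
      have f: "?f \<in> carrier_mat n n" unfolding alt_poly_def by simp
      note P' = complement_idempotent[OF P(1,2)]
      have "?f * P = 0\<^sub>m n n"
        unfolding X by (rule alt_poly_idempotent[OF A B P(1,2,4,5)]) (use P(3) j m_def in simp)
      moreover have "?f * (1\<^sub>m n - P) = 0\<^sub>m n n"
        unfolding X
        by (rule alt_poly_idempotent[OF A B P'(1,2) P'(3)[OF A P(4)] P'(3)[OF B P(5)]])
          (use idempotent_diagonal(1)[OF P(1,2)] P(3) m_def in simp)
      moreover have "?f * (1\<^sub>m n - P) = ?f - ?f * P"
        using mult_minus_distrib_mat[OF f one_carrier_mat P(1)] f by simp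
      ultimately have "(?f - 0\<^sub>m n n) $$ (a, b) = 0" using ab by simp
      then show "?f $$ (a, b) = 0" using ab by simp
    qed
    note van = zariski_closure_vanish[OF pf.mats_index[OF alt_poly_poly] commuting_Z_subset this X]
    \<comment> \<open>The starting point \<open>i\<close> lies on the cycle of length
      \<open>n - i\<close>, the only one longer than \<open>m\<close>.\<close>
    have a: "block_cycle n i m i < n" by (rule block_cycle_less[OF \<open>i < n\<close> \<open>i < n\<close>])
    have "alt_poly n m ?X $$ (block_cycle n i m i, i) = 0" by (rule van) (use a \<open>i < n\<close> in auto)
    moreover have "m < n - i" using 1 j m_def by linarith
    ultimately show False
      using alt_poly_cycle[OF \<open>i < n\<close> a \<open>i < n\<close>, of m l]
        alt_poly_cycle_nonzero[OF \<open>i < n\<close> \<open>i < n\<close> l, of m] by simp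
  next
    case 2
    have "det (alt_poly n j X) = 0" if X: "X \<in> commuting_Z n j" for X :: "'k mat_pair"
      using X
    proof (rule commuting_ZE)
      fix A B P :: "'k mat"
      assume X: "X = (A, B)" and A: "A \<in> carrier_mat n n" and B: "B \<in> carrier_mat n n"
        and P: "P \<in> carrier_mat n n" "P * P = P" "vec_space.rank n P = j" "A * P = P * A" "B * P = P * B"
      let ?f = "alt_poly n j X"
      have f: "?f \<in> carrier_mat n n" unfolding alt_poly_def by simp
      have fP: "?f * P = 0\<^sub>m n n"
        unfolding X by (rule alt_poly_idempotent[OF A B P(1,2,4,5)]) (use P(3) in simp)
      show "det ?f = 0"
      proof (rule ccontr)
        assume "det ?f \<noteq> 0"
        then have inj: "v = 0\<^sub>v n" if "v \<in> carrier_vec n" "?f *\<^sub>v v = 0\<^sub>v n" for v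
          using det_0_iff_vec_prod_zero_field[OF f] that by blast
        have "P = 0\<^sub>m n n"
          by (rule inj_mat_cancel[OF f inj P(1)]) (use fP f in auto)
        then have "idem_factor n 0 P (0\<^sub>m n 0) (0\<^sub>m 0 n)"
          unfolding idem_factor_def by (auto intro!: eq_matI simp: scalar_prod_def)
        then show False using idem_factor_rank P(3) j by force
      qed
    qed
    from zariski_closure_vanish[OF pf.det[OF alt_poly_poly] commuting_Z_subset this X]
    have "det (alt_poly n j ?X) = 0" by simp
    moreover have f: "alt_poly n j ?X \<in> carrier_mat n n" unfolding alt_poly_def by simp
    ultimately obtain v where v: "v \<in> carrier_vec n" "v \<noteq> 0\<^sub>v n" "alt_poly n j ?X *\<^sub>v v = 0\<^sub>v n"
      using det_0_iff_vec_prod_zero_field[OF f] by blast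
    \<comment> \<open>Row \<open>?a\<close> of the matrix has its only nonzero entry in column
      \<open>b\<close>, because moving \<open>j\<close> steps along the cycles is injective.\<close>
    have "v $ b = 0" if b: "b < n" for b
    proof -
      let ?a = "block_cycle n i j b"
      let ?d = "det (mat (Suc j) (Suc j) (\<lambda>(r, s). l (block_cycle n i (j - r) b) ^ s))"
      have a: "?a < n" by (rule block_cycle_less[OF \<open>i < n\<close> b])
      have "0 = (alt_poly n j ?X *\<^sub>v v) $ ?a" unfolding v(3) using a by simp
      also have "\<dots> = (\<Sum>k<n. alt_poly n j ?X $$ (?a, k) * v $ k)"
        using a f v(1) by (auto simp: scalar_prod_def atLeast0LessThan intro!: sum.cong)
      also have "\<dots> = (\<Sum>k<n. if k = b then ?d * v $ b else 0)"
      proof (rule sum.cong[OF refl])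
        fix k assume "k \<in> {..<n}"
        then have k: "k < n" by simp
        show "alt_poly n j ?X $$ (?a, k) * v $ k = (if k = b then ?d * v $ b else 0)"
          unfolding alt_poly_cycle[OF \<open>i < n\<close> a k, of j l]
          using block_cycle_inj[of i n b k j] i \<open>i < n\<close> b k by auto
      qed
      finally have "?d * v $ b = 0" using b by simp
      moreover have "?d \<noteq> 0"
        by (rule alt_poly_cycle_nonzero[OF \<open>i < n\<close> b l]) (use 2 i in auto)
      ultimately show ?thesis by simp
    qed
    then have "v = 0\<^sub>v n" using v(1) by (intro eq_vecI) auto
    with v(2) show False by simp
  qed
qed

theorem theorem3p8:
  fixes n :: nat
  assumes "n \<ge> 3"
  shows "(commuting_C2 n :: 'k::alg_closed_field mat_pair set)
           = (\<Union>i\<in>{1..n div 2}. zariski_closure n (commuting_Z n i))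
       \<and> (\<forall>i\<in>{1..n div 2}.
            irreducible_variety n (zariski_closure n (commuting_Z n i :: 'k mat_pair set)))
       \<and> (\<forall>i\<in>{1..n div 2}. \<forall>j\<in>{1..n div 2}. i \<noteq> j \<longrightarrow>
            \<not> zariski_closure n (commuting_Z n i :: 'k mat_pair set)
                \<subseteq> zariski_closure n (commuting_Z n j))
       \<and> (\<forall>F. irredundant_decomposition n (commuting_C2 n :: 'k mat_pair set) F \<longrightarrow>
            F = (\<lambda>i. zariski_closure n (commuting_Z n i)) ` {1..n div 2})"
proof -
  let ?Z = "\<lambda>i. zariski_closure n (commuting_Z n i :: 'k mat_pair set)"
  have n: "n \<ge> 2" using assms by simp
  have "?Z i \<subseteq> commuting_C2 n" if "i \<in> {1..n div 2}" for i
    by (rule zariski_closure_minimal[OF commuting_C2_variety[OF n] commuting_Z_subset_C2[OF n]])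
      (use that n in auto)
  then have un: "commuting_C2 n = (\<Union>i\<in>{1..n div 2}. ?Z i)"
    using commuting_C2_subset[OF n] by blast
  have irr: "\<forall>i\<in>{1..n div 2}. irreducible_variety n (?Z i)"
    by (intro ballI irreducible_commuting_Z) auto
  have irred: "\<forall>i\<in>{1..n div 2}. \<forall>j\<in>{1..n div 2}. i \<noteq> j \<longrightarrow> \<not> ?Z i \<subseteq> ?Z j"
    by (intro ballI impI commuting_Z_not_subset) auto
  have dec: "irredundant_decomposition n (commuting_C2 n) (?Z ` {1..n div 2})"
    unfolding irredundant_decomposition_def using un irr irred by auto
  have "(0\<^sub>m n n, 0\<^sub>m n n) \<in> (commuting_C2 n :: 'k mat_pair set)"
    unfolding commuting_C2_iff[OF n] using nonscalar_exists[OF n, where 'k = 'k] by auto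
  then have ne: "(commuting_C2 n :: 'k mat_pair set) \<noteq> {}" by blast
  show ?thesis
    using un irr irred irredundant_decomposition_unique[OF _ dec ne] by blast
qed

end
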